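(* Let $\mathcal{A}$ be a finite-dimensional associative semisimple $C^*$-pre-bialgebra (with coproduct $\Delta$), where the dual algebra $\mathcal{A}^*$ may lack a unit and need not be semisimple. Let $\{e_I\}$ be a basis of $\mathcal{A}$ with dual basis $\{e^I\}$ of $\mathcal{A}^*$, let $\psi$ be a faithful representation of the algebra $\mathcal{A}^*$, and let $\{\phi_{\mathbf a}\}_{\mathbf a\in\mathrm{Irr}(\mathcal{A})}$ be the irreducible representations of $\mathcal{A}$, with fusion multiplicities $N^{\mathbf c}_{\mathbf{ab}}$ defined by $(\phi_{\mathbf a}\otimes\phi_{\mathbf b})\circ\Delta\simeq\bigoplus_{\mathbf c}\mathbb{1}_{N^{\mathbf c}_{\mathbf{ab}}}\otimes\phi_{\mathbf c}$, and matrices $N_{\mathbf a}$ with entries $(N_{\mathbf a})_{\mathbf{cb}}=N^{\mathbf c}_{\mathbf{ab}}$. Suppose (1) the fusion multiplicities are transitive: for all $\mathbf a,\mathbf b\in\mathrm{Irr}(\mathcal{A})$ there exist $\mathbf c,\mathbf d\in\mathrm{Irr}(\mathcal{A})$ with $N^{\mathbf d}_{\mathbf{ac}}>0$ and $N^{\mathbf b}_{\mathbf{da}}>0$; and (2) for every $\mathbf a\in\mathrm{Irr}(\mathcal{A})$ there exists $\mathbf a^*\in\mathrm{Irr}(\mathcal{A})$ with $N_{\mathbf a^*}=N_{\mathbf a}^T$. Let $d_{\mathbf a}$ be the spectral radius of $N_{\mathbf a}$, $\mathrm{FPdim}:=\sum_{\mathbf a}d_{\mathbf a}^2$, and define the MPO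 tensor $M$ with physical space $\bigoplus_{\mathbf a}V_{\mathbf a}$ (where $V_{\mathbf a}$ is the carrier space of $\phi_{\mathbf a}$) and virtual space the carrier space of $\psi$ by $$M^{ij}_{\alpha\beta}=\sum_I\big[b\,\phi(e_I)\big]_{ij}\,[\psi(e^I)]_{\alpha\beta},\qquad \phi=\bigoplus_{\mathbf a}\phi_{\mathbf a},\quad b=\bigoplus_{\mathbf a}\frac{d_{\mathbf a}}{\mathrm{FPdim}}\mathbb{1}_{V_{\mathbf a}},$$ i.e. $M=\bigoplus_{\mathbf a}\frac{d_{\mathbf a}}{\mathrm{FPdim}}\tilde M_{\mathbf a}$ with $(\tilde M_{\mathbf a})^{ij}_{\alpha\beta}=\sum_I[\phi_{\mathbf a}(e_I)]_{ij}[\psi(e^I)]_{\alpha\beta}$. Then $M$ is a renormalization fixed point: there exist quantum channels $\mathcal{T}$ and $\mathcal{S}$ acting only on the physical indices such that $\mathcal{T}$ maps the one-site tensor $M$ to the two-site tensor $MM$ (two copies of $M$ contracted along one virtual bond) and $\mathcal{S}$ maps $MM$ back to $M$, with the virtual indices left untouched.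
   Context: A pre-bialgebra is an associative algebra $\mathcal{A}$ with a linear map $\Delta:\mathcal{A}\to\mathcal{A}\otimes\mathcal{A}$ that is coassociative, $(\Delta\otimes\mathrm{Id})\circ\Delta=(\mathrm{Id}\otimes\Delta)\circ\Delta$, and multiplicative, $\Delta(xy)=\Delta(x)\Delta(y)$ (componentwise product on $\mathcal{A}\otimes\mathcal{A}$); no counit is assumed. A $C^*$-pre-bialgebra is a unital pre-bialgebra with an anti-linear involution $*$ that is an anti-homomorphism, $(xy)^*=y^*x^*$, and a cohomomorphism, $\Delta\circ *=( *\otimes * )\circ\Delta$, and which admits a faithful $*$-representation. The dual space $\mathcal{A}^*$ is an algebra with product dual to $\Delta$: if $\Delta(e_I)=\sum_{JK}\Lambda_I^{JK}e_J\otimes e_K$ then $e^Ie^J=\sum_K\Lambda^{IJ}_K e^K$. For an MPO tensor $M$ with entries $M^{ij}_{\alpha\beta}$ ($i,j$ physical, $\alpha,\beta$ virtual), one regards $M_{\alpha\beta}=\sum_{ij}M^{ij}_{\alpha\beta}|i\rangle\langle j|$ as a physical operator for each virtual pair; a channel $\mathcal{T}$ "maps $M$ to $MM$" means $\mathcal{T}(M_{\alpha\beta})=\sum_\gamma M_{\alpha\gamma}\otimes M_{\gamma\beta}$ for all $\alpha,\beta$, and similarly $\mathcal{S}(\sum_\gamma M_{\alpha\gamma}\otimes M_{\gamma\beta})=M_{\alpha\beta}$.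
   Formalization: The irreducible representations φ_a are taken to be *-representations (unitary representatives, which exist in every class); for arbitrary non-unitary representatives the claim fails, e.g. for the group algebra of S_3 with its 2-dimensional irrep conjugated by a non-unitary matrix. *)

theory Defs
  imports "Jordan_Normal_Form.Spectral_Radius"
begin

text \<open>
  Conventions.  A finite-dimensional algebra A of dimension n is represented in
  coordinates w.r.t. a basis e_0, ..., e_(n-1): an element is a coefficient
  function x :: nat => complex vanishing at indices >= n.  The structure is given by
    e_I e_J = sum_K mu I J K e_K,  1 = sum_I u I e_I,
    Delta(e_I) = sum_(J,K) Lam I J K e_J (x) e_K,  (e_I)^* = sum_J st I J e_J
  (the involution is extended anti-linearly).  Elements of A (x) A are coefficient
  functions nat => nat => complex, elements of A (x) A (x) A are functions of three indices.
  The dual basis e^I of the dual space then multiplies as e^I e^J = sum_K Lam K I J e^K.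
\<close>

primrec msum :: "nat \<Rightarrow> nat \<Rightarrow> (nat \<Rightarrow> complex mat) \<Rightarrow> nat \<Rightarrow> complex mat" where
  "msum r c f 0 = 0\<^sub>m r c"
| "msum r c f (Suc k) = msum r c f k + f k"

definition adj :: "complex mat \<Rightarrow> complex mat" where
  "adj A = mat (dim_col A) (dim_row A) (\<lambda>(i,j). cnj (A $$ (j,i)))"

definition kron :: "complex mat \<Rightarrow> complex mat \<Rightarrow> complex mat" where
  "kron A B = mat (dim_row A * dim_row B) (dim_col A * dim_col B)
     (\<lambda>(i,j). A $$ (i div dim_row B, j div dim_col B) * B $$ (i mod dim_row B, j mod dim_col B))"

definition mat_lin_indep :: "nat \<Rightarrow> nat \<Rightarrow> complex mat list \<Rightarrow> bool" where
  "mat_lin_indep r c Ts \<longleftrightarrow>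
     (\<forall>coef. msum r c (\<lambda>i. coef i \<cdot>\<^sub>m (Ts ! i)) (length Ts) = 0\<^sub>m r c
        \<longrightarrow> (\<forall>i < length Ts. coef i = 0))"

definition mat_space_dim :: "nat \<Rightarrow> nat \<Rightarrow> complex mat set \<Rightarrow> nat" where
  "mat_space_dim r c S = (GREATEST k. \<exists>Ts. length Ts = k \<and> set Ts \<subseteq> S \<inter> carrier_mat r c
                                          \<and> mat_lin_indep r c Ts)"

definition inA :: "nat \<Rightarrow> (nat \<Rightarrow> complex) \<Rightarrow> bool" where
  "inA n x \<longleftrightarrow> (\<forall>I\<ge>n. x I = 0)"

definition zeroA :: "nat \<Rightarrow> complex" where "zeroA = (\<lambda>_. 0)"

definition mulA :: "nat \<Rightarrow> (nat \<Rightarrow> nat \<Rightarrow> nat \<Rightarrow> complex) \<Rightarrow>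
    (nat \<Rightarrow> complex) \<Rightarrow> (nat \<Rightarrow> complex) \<Rightarrow> (nat \<Rightarrow> complex)" where
  "mulA n mu x y = (\<lambda>K. if K < n then (\<Sum>I<n. \<Sum>J<n. x I * y J * mu I J K) else 0)"

definition starA :: "nat \<Rightarrow> (nat \<Rightarrow> nat \<Rightarrow> complex) \<Rightarrow> (nat \<Rightarrow> complex) \<Rightarrow> (nat \<Rightarrow> complex)" where
  "starA n st x = (\<lambda>J. if J < n then (\<Sum>I<n. cnj (x I) * st I J) else 0)"

definition DeltaA :: "nat \<Rightarrow> (nat \<Rightarrow> nat \<Rightarrow> nat \<Rightarrow> complex) \<Rightarrow>
    (nat \<Rightarrow> complex) \<Rightarrow> (nat \<Rightarrow> nat \<Rightarrow> complex)" where
  "DeltaA n Lam x = (\<lambda>J K. if J < n \<and> K < n then (\<Sum>I<n. x I * Lam I J K) else 0)"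

definition Delta_Id :: "nat \<Rightarrow> (nat \<Rightarrow> nat \<Rightarrow> nat \<Rightarrow> complex) \<Rightarrow>
    (nat \<Rightarrow> nat \<Rightarrow> complex) \<Rightarrow> (nat \<Rightarrow> nat \<Rightarrow> nat \<Rightarrow> complex)" where
  "Delta_Id n Lam X = (\<lambda>P Q R. if P < n \<and> Q < n \<and> R < n
       then (\<Sum>J<n. X J R * Lam J P Q) else 0)"

definition Id_Delta :: "nat \<Rightarrow> (nat \<Rightarrow> nat \<Rightarrow> nat \<Rightarrow> complex) \<Rightarrow>
    (nat \<Rightarrow> nat \<Rightarrow> complex) \<Rightarrow> (nat \<Rightarrow> nat \<Rightarrow> nat \<Rightarrow> complex)" where
  "Id_Delta n Lam X = (\<lambda>P Q R. if P < n \<and> Q < n \<and> R < n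
       then (\<Sum>K<n. X P K * Lam K Q R) else 0)"

definition mulAA :: "nat \<Rightarrow> (nat \<Rightarrow> nat \<Rightarrow> nat \<Rightarrow> complex) \<Rightarrow>
    (nat \<Rightarrow> nat \<Rightarrow> complex) \<Rightarrow> (nat \<Rightarrow> nat \<Rightarrow> complex) \<Rightarrow> (nat \<Rightarrow> nat \<Rightarrow> complex)" where
  "mulAA n mu X Y = (\<lambda>P Q. if P < n \<and> Q < n then
      (\<Sum>P1<n. \<Sum>Q1<n. \<Sum>P2<n. \<Sum>Q2<n. X P1 Q1 * Y P2 Q2 * mu P1 P2 P * mu Q1 Q2 Q) else 0)"

definition starAA :: "nat \<Rightarrow> (nat \<Rightarrow> nat \<Rightarrow> complex) \<Rightarrow>
    (nat \<Rightarrow> nat \<Rightarrow> complex) \<Rightarrow> (nat \<Rightarrow> nat \<Rightarrow> complex)" where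
  "starAA n st X = (\<lambda>P Q. if P < n \<and> Q < n then
      (\<Sum>J<n. \<Sum>K<n. cnj (X J K) * st J P * st K Q) else 0)"

text \<open>A linear map from A to d x d matrices, given by the images rho I of the basis vectors.\<close>
definition repA :: "nat \<Rightarrow> nat \<Rightarrow> (nat \<Rightarrow> complex mat) \<Rightarrow> (nat \<Rightarrow> complex) \<Rightarrow> complex mat" where
  "repA n d rho x = msum d d (\<lambda>I. x I \<cdot>\<^sub>m rho I) n"

definition is_rep_map :: "nat \<Rightarrow> nat \<Rightarrow> (nat \<Rightarrow> complex mat) \<Rightarrow> bool" where
  "is_rep_map n d rho \<longleftrightarrow> (\<forall>I<n. rho I \<in> carrier_mat d d)"

definition C_star_pre_bialgebra ::
  "nat \<Rightarrow> (nat \<Rightarrow> nat \<Rightarrow> nat \<Rightarrow> complex) \<Rightarrow> (nat \<Rightarrow> complex) \<Rightarrow>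
   (nat \<Rightarrow> nat \<Rightarrow> nat \<Rightarrow> complex) \<Rightarrow> (nat \<Rightarrow> nat \<Rightarrow> complex) \<Rightarrow> bool" where
  "C_star_pre_bialgebra n mu u Lam st \<longleftrightarrow>
     inA n u
   \<and> (\<forall>x y z. inA n x \<and> inA n y \<and> inA n z \<longrightarrow>
         mulA n mu (mulA n mu x y) z = mulA n mu x (mulA n mu y z))
   \<and> (\<forall>x. inA n x \<longrightarrow> mulA n mu u x = x \<and> mulA n mu x u = x)
   \<and> (\<forall>x. inA n x \<longrightarrow> Delta_Id n Lam (DeltaA n Lam x) = Id_Delta n Lam (DeltaA n Lam x))
   \<and> (\<forall>x y. inA n x \<and> inA n y \<longrightarrow>
         DeltaA n Lam (mulA n mu x y) = mulAA n mu (DeltaA n Lam x) (DeltaA n Lam y))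
   \<and> (\<forall>x. inA n x \<longrightarrow> starA n st (starA n st x) = x)
   \<and> (\<forall>x y. inA n x \<and> inA n y \<longrightarrow>
         starA n st (mulA n mu x y) = mulA n mu (starA n st y) (starA n st x))
   \<and> (\<forall>x. inA n x \<longrightarrow> DeltaA n Lam (starA n st x) = starAA n st (DeltaA n Lam x))
   \<and> (\<exists>m pi. is_rep_map n m pi
        \<and> (\<forall>x y. inA n x \<and> inA n y \<longrightarrow>
              repA n m pi (mulA n mu x y) = repA n m pi x * repA n m pi y)
        \<and> (\<forall>x. inA n x \<longrightarrow> repA n m pi (starA n st x) = adj (repA n m pi x))
        \<and> (\<forall>x. inA n x \<and> repA n m pi x = 0\<^sub>m m m \<longrightarrow> x = zeroA))"

definition two_sided_ideal :: "nat \<Rightarrow> (nat \<Rightarrow> nat \<Rightarrow> nat \<Rightarrow> complex) \<Rightarrow> (nat \<Rightarrow> complex) set \<Rightarrow> bool" where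
  "two_sided_ideal n mu S \<longleftrightarrow>
     (\<forall>x\<in>S. inA n x) \<and> zeroA \<in> S
   \<and> (\<forall>x\<in>S. \<forall>y\<in>S. (\<lambda>K. x K + y K) \<in> S)
   \<and> (\<forall>c. \<forall>x\<in>S. (\<lambda>K. c * x K) \<in> S)
   \<and> (\<forall>a. \<forall>x\<in>S. inA n a \<longrightarrow> mulA n mu a x \<in> S \<and> mulA n mu x a \<in> S)"

definition nilpotent_ideal :: "nat \<Rightarrow> (nat \<Rightarrow> nat \<Rightarrow> nat \<Rightarrow> complex) \<Rightarrow> (nat \<Rightarrow> complex) \<Rightarrow>
    (nat \<Rightarrow> complex) set \<Rightarrow> bool" where
  "nilpotent_ideal n mu u S \<longleftrightarrow>
     (\<exists>k>0. \<forall>xs. length xs = k \<and> set xs \<subseteq> S \<longrightarrow> foldr (mulA n mu) xs u = zeroA)"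

text \<open>Semisimple: the (Wedderburn) radical vanishes, i.e. there is no nonzero nilpotent
  two-sided ideal.\<close>
definition semisimpleA :: "nat \<Rightarrow> (nat \<Rightarrow> nat \<Rightarrow> nat \<Rightarrow> complex) \<Rightarrow> (nat \<Rightarrow> complex) \<Rightarrow> bool" where
  "semisimpleA n mu u \<longleftrightarrow>
     (\<forall>S. two_sided_ideal n mu S \<and> nilpotent_ideal n mu u S \<longrightarrow> S \<subseteq> {zeroA})"

definition is_repA :: "nat \<Rightarrow> (nat \<Rightarrow> nat \<Rightarrow> nat \<Rightarrow> complex) \<Rightarrow> (nat \<Rightarrow> complex) \<Rightarrow>
    nat \<Rightarrow> (nat \<Rightarrow> complex mat) \<Rightarrow> bool" where
  "is_repA n mu u d rho \<longleftrightarrow> is_rep_map n d rho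
     \<and> (\<forall>x y. inA n x \<and> inA n y \<longrightarrow> repA n d rho (mulA n mu x y) = repA n d rho x * repA n d rho y)
     \<and> repA n d rho u = 1\<^sub>m d"

definition subspace_vec :: "nat \<Rightarrow> complex vec set \<Rightarrow> bool" where
  "subspace_vec d W \<longleftrightarrow> W \<subseteq> carrier_vec d \<and> 0\<^sub>v d \<in> W
     \<and> (\<forall>v\<in>W. \<forall>w\<in>W. v + w \<in> W) \<and> (\<forall>c. \<forall>v\<in>W. c \<cdot>\<^sub>v v \<in> W)"

definition irreducible_repA :: "nat \<Rightarrow> (nat \<Rightarrow> nat \<Rightarrow> nat \<Rightarrow> complex) \<Rightarrow> (nat \<Rightarrow> complex) \<Rightarrow>
    nat \<Rightarrow> (nat \<Rightarrow> complex mat) \<Rightarrow> bool" where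
  "irreducible_repA n mu u d rho \<longleftrightarrow> is_repA n mu u d rho \<and> d > 0
     \<and> (\<forall>W. subspace_vec d W \<and> (\<forall>I<n. \<forall>w\<in>W. rho I *\<^sub>v w \<in> W)
            \<longrightarrow> W = {0\<^sub>v d} \<or> W = carrier_vec d)"

definition star_repA :: "nat \<Rightarrow> (nat \<Rightarrow> nat \<Rightarrow> complex) \<Rightarrow> nat \<Rightarrow> (nat \<Rightarrow> complex mat) \<Rightarrow> bool" where
  "star_repA n st d rho \<longleftrightarrow>
     (\<forall>x. inA n x \<longrightarrow> repA n d rho (starA n st x) = adj (repA n d rho x))"

definition equiv_rep :: "nat \<Rightarrow> nat \<Rightarrow> (nat \<Rightarrow> complex mat) \<Rightarrow> nat \<Rightarrow> (nat \<Rightarrow> complex mat) \<Rightarrow> bool" where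
  "equiv_rep n d1 rho1 d2 rho2 \<longleftrightarrow> d1 = d2 \<and>
     (\<exists>S \<in> carrier_mat d2 d1. invertible_mat S \<and> (\<forall>I<n. S * rho1 I = rho2 I * S))"

text \<open>phi a (a < r) is a complete family of pairwise inequivalent irreducible
  (*-)representations of A, i.e. a labelling of Irr(A) by {0..<r}; dims a is the dimension
  of the carrier space V_a.\<close>
definition complete_irreps :: "nat \<Rightarrow> (nat \<Rightarrow> nat \<Rightarrow> nat \<Rightarrow> complex) \<Rightarrow> (nat \<Rightarrow> complex) \<Rightarrow>
    (nat \<Rightarrow> nat \<Rightarrow> complex) \<Rightarrow> nat \<Rightarrow> (nat \<Rightarrow> nat) \<Rightarrow> (nat \<Rightarrow> nat \<Rightarrow> complex mat) \<Rightarrow> bool" where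
  "complete_irreps n mu u st r dims phi \<longleftrightarrow>
     (\<forall>a<r. irreducible_repA n mu u (dims a) (phi a) \<and> star_repA n st (dims a) (phi a))
   \<and> (\<forall>a<r. \<forall>b<r. a \<noteq> b \<longrightarrow> \<not> equiv_rep n (dims a) (phi a) (dims b) (phi b))
   \<and> (\<forall>d rho. irreducible_repA n mu u d rho \<longrightarrow> (\<exists>a<r. equiv_rep n d rho (dims a) (phi a)))"

definition tensor_rep :: "nat \<Rightarrow> (nat \<Rightarrow> nat \<Rightarrow> nat \<Rightarrow> complex) \<Rightarrow> nat \<Rightarrow> (nat \<Rightarrow> complex mat) \<Rightarrow>
    nat \<Rightarrow> (nat \<Rightarrow> complex mat) \<Rightarrow> nat \<Rightarrow> complex mat" where
  "tensor_rep n Lam da rhoa db rhob I =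
     msum (da * db) (da * db) (\<lambda>J. msum (da * db) (da * db)
        (\<lambda>K. Lam I J K \<cdot>\<^sub>m kron (rhoa J) (rhob K)) n) n"

text \<open>Fusion multiplicity N^c_ab: the multiplicity of the irreducible phi_c in
  (phi_a (x) phi_b) o Delta, i.e. the dimension of the intertwiner space Hom_A(phi_c, rho_ab).\<close>
definition fusion_mult :: "nat \<Rightarrow> (nat \<Rightarrow> nat \<Rightarrow> nat \<Rightarrow> complex) \<Rightarrow> (nat \<Rightarrow> nat) \<Rightarrow>
    (nat \<Rightarrow> nat \<Rightarrow> complex mat) \<Rightarrow> nat \<Rightarrow> nat \<Rightarrow> nat \<Rightarrow> nat" where
  "fusion_mult n Lam dims phi c a b =
     mat_space_dim (dims a * dims b) (dims c)
       {T. \<forall>I<n. T * phi c I = tensor_rep n Lam (dims a) (phi a) (dims b) (phi b) I * T}"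

definition fusion_matrix :: "nat \<Rightarrow> (nat \<Rightarrow> nat \<Rightarrow> nat \<Rightarrow> complex) \<Rightarrow> nat \<Rightarrow> (nat \<Rightarrow> nat) \<Rightarrow>
    (nat \<Rightarrow> nat \<Rightarrow> complex mat) \<Rightarrow> nat \<Rightarrow> complex mat" where
  "fusion_matrix n Lam r dims phi a =
     mat r r (\<lambda>(c,b). of_nat (fusion_mult n Lam dims phi c a b))"

definition qdim :: "nat \<Rightarrow> (nat \<Rightarrow> nat \<Rightarrow> nat \<Rightarrow> complex) \<Rightarrow> nat \<Rightarrow> (nat \<Rightarrow> nat) \<Rightarrow>
    (nat \<Rightarrow> nat \<Rightarrow> complex mat) \<Rightarrow> nat \<Rightarrow> real" where
  "qdim n Lam r dims phi a = spectral_radius (fusion_matrix n Lam r dims phi a)"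

definition FPdim :: "nat \<Rightarrow> (nat \<Rightarrow> nat \<Rightarrow> nat \<Rightarrow> complex) \<Rightarrow> nat \<Rightarrow> (nat \<Rightarrow> nat) \<Rightarrow>
    (nat \<Rightarrow> nat \<Rightarrow> complex mat) \<Rightarrow> real" where
  "FPdim n Lam r dims phi = (\<Sum>a<r. (qdim n Lam r dims phi a)\<^sup>2)"

definition mulDual :: "nat \<Rightarrow> (nat \<Rightarrow> nat \<Rightarrow> nat \<Rightarrow> complex) \<Rightarrow>
    (nat \<Rightarrow> complex) \<Rightarrow> (nat \<Rightarrow> complex) \<Rightarrow> (nat \<Rightarrow> complex)" where
  "mulDual n Lam f g = (\<lambda>K. if K < n then (\<Sum>I<n. \<Sum>J<n. f I * g J * Lam K I J) else 0)"

text \<open>psi I = psi(e^I); a faithful (not necessarily unital) representation of the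
  algebra A^* on a chi-dimensional space.\<close>
definition faithful_rep_dual :: "nat \<Rightarrow> (nat \<Rightarrow> nat \<Rightarrow> nat \<Rightarrow> complex) \<Rightarrow>
    nat \<Rightarrow> (nat \<Rightarrow> complex mat) \<Rightarrow> bool" where
  "faithful_rep_dual n Lam chi psi \<longleftrightarrow> is_rep_map n chi psi
     \<and> (\<forall>f g. inA n f \<and> inA n g \<longrightarrow>
           repA n chi psi (mulDual n Lam f g) = repA n chi psi f * repA n chi psi g)
     \<and> (\<forall>f. inA n f \<and> repA n chi psi f = 0\<^sub>m chi chi \<longrightarrow> f = zeroA)"

definition phys_dim :: "nat \<Rightarrow> (nat \<Rightarrow> nat) \<Rightarrow> nat" where
  "phys_dim r dims = (\<Sum>a<r. dims a)"

definition b_phi :: "nat \<Rightarrow> (nat \<Rightarrow> nat \<Rightarrow> nat \<Rightarrow> complex) \<Rightarrow> nat \<Rightarrow> (nat \<Rightarrow> nat) \<Rightarrow>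
    (nat \<Rightarrow> nat \<Rightarrow> complex mat) \<Rightarrow> nat \<Rightarrow> complex mat" where
  "b_phi n Lam r dims phi I = diag_block_mat
     (map (\<lambda>a. complex_of_real (qdim n Lam r dims phi a / FPdim n Lam r dims phi) \<cdot>\<^sub>m phi a I) [0..<r])"

definition MPO :: "nat \<Rightarrow> (nat \<Rightarrow> nat \<Rightarrow> nat \<Rightarrow> complex) \<Rightarrow> nat \<Rightarrow> (nat \<Rightarrow> nat) \<Rightarrow>
    (nat \<Rightarrow> nat \<Rightarrow> complex mat) \<Rightarrow> (nat \<Rightarrow> complex mat) \<Rightarrow> nat \<Rightarrow> nat \<Rightarrow> complex mat" where
  "MPO n Lam r dims phi psi \<alpha> \<beta> =
     msum (phys_dim r dims) (phys_dim r dims)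
       (\<lambda>I. (psi I $$ (\<alpha>, \<beta>)) \<cdot>\<^sub>m b_phi n Lam r dims phi I) n"

definition MPO2 :: "nat \<Rightarrow> (nat \<Rightarrow> nat \<Rightarrow> nat \<Rightarrow> complex) \<Rightarrow> nat \<Rightarrow> (nat \<Rightarrow> nat) \<Rightarrow>
    (nat \<Rightarrow> nat \<Rightarrow> complex mat) \<Rightarrow> nat \<Rightarrow> (nat \<Rightarrow> complex mat) \<Rightarrow> nat \<Rightarrow> nat \<Rightarrow> complex mat" where
  "MPO2 n Lam r dims phi chi psi \<alpha> \<beta> =
     msum (phys_dim r dims * phys_dim r dims) (phys_dim r dims * phys_dim r dims)
       (\<lambda>\<gamma>. kron (MPO n Lam r dims phi psi \<alpha> \<gamma>) (MPO n Lam r dims phi psi \<gamma> \<beta>)) chi"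

text \<open>A quantum channel (completely positive trace-preserving map) from din x din to
  dout x dout matrices, in operator-sum (Kraus) form.\<close>
definition quantum_channel :: "nat \<Rightarrow> nat \<Rightarrow> (complex mat \<Rightarrow> complex mat) \<Rightarrow> bool" where
  "quantum_channel din dout T \<longleftrightarrow>
     (\<exists>k Ks. (\<forall>i<k. Ks i \<in> carrier_mat dout din)
        \<and> msum din din (\<lambda>i. adj (Ks i) * Ks i) k = 1\<^sub>m din
        \<and> (\<forall>X \<in> carrier_mat din din. T X = msum dout dout (\<lambda>i. Ks i * X * adj (Ks i)) k))"

end

theory Submission
  imports Defs
begin

text \<open>
  Let \<open>x = \<Sum>I. \<psi>(e^I)\<^sub>\<alpha>\<^sub>\<beta> e_I\<close>. The one-site tensor at \<open>(\<alpha>,\<beta>)\<close> is \<open>b \<phi>(x)\<close> and, since \<open>\<psi>\<close> is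
  multiplicative, the two-site tensor is \<open>(b \<otimes> b) (\<phi> \<otimes> \<phi>) (\<Delta> x)\<close>. As \<open>\<Delta>\<close> is a (not necessarily
  unital) *-homomorphism, \<open>(\<phi>\<^sub>a \<otimes> \<phi>\<^sub>b) \<Delta>(x) = \<Sum>k. W\<^sub>k \<phi>\<^sub>c(x) W\<^sub>k*\<close> for orthonormal isometric intertwiners
  \<open>W\<^sub>k\<close>, of which \<open>N^c\<^sub>a\<^sub>b\<close> belong to the label \<open>c\<close>. So both tensors are block sums of the same matrices
  \<open>\<phi>\<^sub>c(x)\<close>, with weight \<open>d\<^sub>c / FPdim\<close> in the first and total weight
  \<open>\<Sum>a b. N^c\<^sub>a\<^sub>b d\<^sub>a d\<^sub>b / FPdim\<^sup>2\<close> in the second, and channels in both directions exist as soon as these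
  weights agree.

  The weights agree because \<open>\<Sum>b. N^c\<^sub>a\<^sub>b d\<^sub>b = d\<^sub>a d\<^sub>c\<close>. Coassociativity makes the fusion multiplicities
  associative, and transitivity makes \<open>\<Sum>a. N\<^sub>a\<close> entrywise positive. Its Perron vector is a common
  eigenvector of all right multiplications; the eigenvalues form a positive character \<open>\<rho>\<close>, that is
  \<open>\<rho>\<^sup>T N\<^sub>a = \<rho>\<^sub>a \<rho>\<^sup>T\<close>. With \<open>N\<^sub>a\<^sup>T = N\<^sub>a\<^sub>*\<close> also \<open>N\<^sub>a \<rho> = \<rho>\<^sub>a \<rho>\<close>, and positivity identifies
  \<open>\<rho>\<^sub>a\<close> with the spectral radius \<open>d\<^sub>a\<close>.
\<close>

text \<open>The coproduct need not send 1 to 1 (x) 1, so tensor products of representations may be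
  degenerate, and with no counit there is no trivial representation whose dimension 1 could
  normalise the \<open>d_a\<close>. Two things follow. The decomposition of
  \<open>(phi_a (x) phi_b) o Delta\<close> must be carried out below the projection representing 1,
  and the channel back to one site must be completed off that support. The normalisation of the
  eigenvalues has to come from associativity: the right multiplications compose by the fusion rule,
  so their eigenvalues on a common positive vector multiply like a character.

  The constant FPdim comes from the weight balance: summing \<open>d_a (d_a d_c) / FPdim^2\<close>
  over \<open>a\<close> gives \<open>d_c / FPdim\<close> exactly when FPdim is the sum of the
  \<open>d_a^2\<close>.

  The channels are built from the blocks alone. They therefore treat all families of block matrices
  at once, and one pair of channels serves all virtual indices.\<close>

section \<open>Finite sums of matrices and Kronecker products\<close>

text \<open>Counterpart of \<open>msum\<close> over an arbitrary index set, needed because the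
  blocks of iterated decompositions are indexed by dependent sums. Being entrywise, it asks nothing
  of the shapes of the summands and does not depend on an order of summation.\<close>

definition mat_sum :: "nat \<Rightarrow> nat \<Rightarrow> ('k \<Rightarrow> complex mat) \<Rightarrow> 'k set \<Rightarrow> complex mat" where
  "mat_sum r c f A = mat r c (\<lambda>(i,j). \<Sum>k\<in>A. f k $$ (i,j))"

lemma mat_sum_carrier[simp, intro]: "mat_sum r c f A \<in> carrier_mat r c"
  by (simp add: mat_sum_def)

lemma mat_sum_dim[simp]: "dim_row (mat_sum r c f A) = r" "dim_col (mat_sum r c f A) = c"
  by (simp_all add: mat_sum_def)

lemma mat_sum_index[simp]: "i < r \<Longrightarrow> j < c \<Longrightarrow> mat_sum r c f A $$ (i,j) = (\<Sum>k\<in>A. f k $$ (i,j))"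
  by (simp add: mat_sum_def)

lemma mat_sum_cong: "A = B \<Longrightarrow> (\<And>k. k \<in> B \<Longrightarrow> f k = g k) \<Longrightarrow> mat_sum r c f A = mat_sum r c g B"
  by (auto simp: mat_sum_def intro!: cong_mat sum.cong)

lemma msum_eq_mat_sum:
  assumes "\<And>i. i < k \<Longrightarrow> f i \<in> carrier_mat r c"
  shows "msum r c f k = mat_sum r c f {..<k}"
  using assms
proof (induction k)
  case (Suc k)
  have "f k \<in> carrier_mat r c" using Suc.prems by auto
  moreover have "msum r c f k = mat_sum r c f {..<k}" using Suc by simp
  ultimately show ?case by (intro eq_matI) auto
qed auto

lemma mat_sum_empty[simp]: "mat_sum r c f {} = 0\<^sub>m r c"
  by (intro eq_matI) auto

lemma mat_sum_zero: "(\<And>k. k \<in> A \<Longrightarrow> f k = 0\<^sub>m r c) \<Longrightarrow> mat_sum r c f A = 0\<^sub>m r c"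
  by (intro eq_matI) auto

lemma mat_sum_single:
  assumes "finite A" "k \<in> A" "f k \<in> carrier_mat r c"
    "\<And>l. l \<in> A \<Longrightarrow> l \<noteq> k \<Longrightarrow> f l = 0\<^sub>m r c"
  shows "mat_sum r c f A = f k"
proof (intro eq_matI)
  fix i j assume ij: "i < dim_row (f k)" "j < dim_col (f k)"
  have "(\<Sum>l\<in>A. f l $$ (i,j)) = (\<Sum>l\<in>A. if l = k then f k $$ (i,j) else 0)"
    using assms ij by (intro sum.cong) auto
  then show "mat_sum r c f A $$ (i,j) = f k $$ (i,j)" using assms ij by simp
qed (use assms in auto)

lemma mat_sum_reindex:
  "inj_on h A \<Longrightarrow> mat_sum r c f (h ` A) = mat_sum r c (\<lambda>k. f (h k)) A"
  by (intro eq_matI) (auto simp: sum.reindex)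

lemma mat_sum_bij_betw:
  "bij_betw h A B \<Longrightarrow> mat_sum r c f B = mat_sum r c (\<lambda>k. f (h k)) A"
  using mat_sum_reindex[of h A] by (auto simp: bij_betw_def)

lemma mat_sum_Sigma:
  assumes "finite A" "\<And>a. a \<in> A \<Longrightarrow> finite (B a)"
  shows "mat_sum r c (\<lambda>a. mat_sum r c (f a) (B a)) A = mat_sum r c (\<lambda>(a,b). f a b) (Sigma A B)"
proof (intro eq_matI)
  fix i j assume "i < dim_row (mat_sum r c (\<lambda>(a,b). f a b) (Sigma A B))"
    "j < dim_col (mat_sum r c (\<lambda>(a,b). f a b) (Sigma A B))"
  then have ij: "i < r" "j < c" by auto
  have "(\<Sum>a\<in>A. \<Sum>b\<in>B a. f a b $$ (i,j)) = (\<Sum>(a,b)\<in>Sigma A B. f a b $$ (i,j))"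
    using assms by (intro sum.Sigma) auto
  then show "mat_sum r c (\<lambda>a. mat_sum r c (f a) (B a)) A $$ (i,j)
      = mat_sum r c (\<lambda>(a,b). f a b) (Sigma A B) $$ (i,j)"
    using ij by (simp add: case_prod_unfold)
qed auto

lemma mat_sum_Un:
  assumes "finite A" "finite B" "A \<inter> B = {}"
  shows "mat_sum r c f (A \<union> B) = mat_sum r c f A + mat_sum r c f B"
  using assms by (intro eq_matI) (auto simp: sum.union_disjoint)

lemma mat_sum_swap:
  "mat_sum r c (\<lambda>a. mat_sum r c (f a) B) A = mat_sum r c (\<lambda>b. mat_sum r c (\<lambda>a. f a b) A) B"
  by (intro eq_matI) (auto intro: sum.swap)

lemma mat_sum_mult_right:
  assumes "\<And>k. k \<in> A \<Longrightarrow> f k \<in> carrier_mat r m" "B \<in> carrier_mat m c"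
  shows "mat_sum r m f A * B = mat_sum r c (\<lambda>k. f k * B) A"
proof (intro eq_matI)
  fix i j assume "i < dim_row (mat_sum r c (\<lambda>k. f k * B) A)" "j < dim_col (mat_sum r c (\<lambda>k. f k * B) A)"
  then have ij: "i < r" "j < c" by auto
  have "(mat_sum r m f A * B) $$ (i,j) = (\<Sum>l<m. (\<Sum>k\<in>A. f k $$ (i,l)) * B $$ (l,j))"
    using ij assms by (auto simp: scalar_prod_def atLeast0LessThan)
  also have "\<dots> = (\<Sum>k\<in>A. \<Sum>l<m. f k $$ (i,l) * B $$ (l,j))"
    unfolding sum_distrib_right by (rule sum.swap)
  also have "\<dots> = (\<Sum>k\<in>A. (f k * B) $$ (i,j))"
    using ij assms by (intro sum.cong) (auto simp: scalar_prod_def atLeast0LessThan dest!: assms(1))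
  finally show "(mat_sum r m f A * B) $$ (i,j) = mat_sum r c (\<lambda>k. f k * B) A $$ (i,j)"
    using ij by simp
qed (use assms in auto)

lemma mat_sum_mult_left:
  assumes "\<And>k. k \<in> A \<Longrightarrow> f k \<in> carrier_mat m c" "B \<in> carrier_mat r m"
  shows "B * mat_sum m c f A = mat_sum r c (\<lambda>k. B * f k) A"
proof (intro eq_matI)
  fix i j assume "i < dim_row (mat_sum r c (\<lambda>k. B * f k) A)" "j < dim_col (mat_sum r c (\<lambda>k. B * f k) A)"
  then have ij: "i < r" "j < c" by auto
  have "(B * mat_sum m c f A) $$ (i,j) = (\<Sum>l<m. B $$ (i,l) * (\<Sum>k\<in>A. f k $$ (l,j)))"
    using ij assms by (auto simp: scalar_prod_def atLeast0LessThan)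
  also have "\<dots> = (\<Sum>k\<in>A. \<Sum>l<m. B $$ (i,l) * f k $$ (l,j))"
    unfolding sum_distrib_left by (rule sum.swap)
  also have "\<dots> = (\<Sum>k\<in>A. (B * f k) $$ (i,j))"
    using ij assms by (intro sum.cong) (auto simp: scalar_prod_def atLeast0LessThan dest!: assms(1))
  finally show "(B * mat_sum m c f A) $$ (i,j) = mat_sum r c (\<lambda>k. B * f k) A $$ (i,j)"
    using ij by simp
qed (use assms in auto)

lemma mat_sum_smult:
  assumes "\<And>k. k \<in> A \<Longrightarrow> f k \<in> carrier_mat r c"
  shows "x \<cdot>\<^sub>m mat_sum r c f A = mat_sum r c (\<lambda>k. x \<cdot>\<^sub>m f k) A"
  by (intro eq_matI) (auto simp: sum_distrib_left dest!: assms intro!: sum.cong)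

lemma mat_sum_scalars:
  assumes "B \<in> carrier_mat r c"
  shows "mat_sum r c (\<lambda>k. f k \<cdot>\<^sub>m B) A = (\<Sum>k\<in>A. f k) \<cdot>\<^sub>m B"
  using assms by (intro eq_matI) (auto simp: sum_distrib_right)

section \<open>Adjoints and Kronecker products\<close>

lemma adj_dim[simp]: "dim_row (adj A) = dim_col A" "dim_col (adj A) = dim_row A"
  by (simp_all add: adj_def)

lemma adj_carrier[simp, intro]: "A \<in> carrier_mat r c \<Longrightarrow> adj A \<in> carrier_mat c r"
  by (auto simp: adj_def)

lemma adj_index[simp]: "i < dim_col A \<Longrightarrow> j < dim_row A \<Longrightarrow> adj A $$ (i,j) = cnj (A $$ (j,i))"
  by (simp add: adj_def)

lemma adj_adj[simp]: "adj (adj A) = A"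
  by (intro eq_matI) auto

lemma adj_one[simp]: "adj (1\<^sub>m d) = 1\<^sub>m d"
  by (intro eq_matI) auto

lemma adj_zero[simp]: "adj (0\<^sub>m r c) = 0\<^sub>m c r"
  by (intro eq_matI) auto

lemma adj_smult: "adj (x \<cdot>\<^sub>m A) = cnj x \<cdot>\<^sub>m adj A"
  by (intro eq_matI) auto

lemma adj_minus: "A \<in> carrier_mat r c \<Longrightarrow> B \<in> carrier_mat r c \<Longrightarrow> adj (A - B) = adj A - adj B"
  by (intro eq_matI) auto

lemma adj_mult:
  assumes "A \<in> carrier_mat a b" "B \<in> carrier_mat b c"
  shows "adj (A * B) = adj B * adj A"
  using assms by (intro eq_matI) (auto simp: scalar_prod_def mult.commute intro!: sum.cong)

lemma adj_mat_sum:
  assumes "\<And>k. k \<in> A \<Longrightarrow> f k \<in> carrier_mat r c"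
  shows "adj (mat_sum r c f A) = mat_sum c r (\<lambda>k. adj (f k)) A"
  by (intro eq_matI) (auto dest!: assms intro!: sum.cong)

lemma kron_dim[simp]: "dim_row (kron A B) = dim_row A * dim_row B" "dim_col (kron A B) = dim_col A * dim_col B"
  by (simp_all add: kron_def)

lemma kron_carrier[simp, intro]:
  "A \<in> carrier_mat a b \<Longrightarrow> B \<in> carrier_mat c d \<Longrightarrow> kron A B \<in> carrier_mat (a * c) (b * d)"
  by (auto simp: kron_def)

lemma kron_index:
  "i < dim_row A * dim_row B \<Longrightarrow> j < dim_col A * dim_col B \<Longrightarrow>
   kron A B $$ (i,j) = A $$ (i div dim_row B, j div dim_col B) * B $$ (i mod dim_row B, j mod dim_col B)"
  by (simp add: kron_def)

lemma div_mod_less: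
  assumes "i < a * (b::nat)"
  shows "i div b < a" "i mod b < b"
proof -
  have "b > 0" using assms by (cases b) auto
  then show "i div b < a" "i mod b < b" using assms by (auto simp: less_mult_imp_div_less)
qed

lemma sum_div_mod:
  fixes f :: "nat \<Rightarrow> nat \<Rightarrow> 'a::comm_monoid_add"
  shows "(\<Sum>k<a*b. f (k div b) (k mod b)) = (\<Sum>i<a. \<Sum>j<b. f i j)"
proof -
  have "(\<Sum>k<a*b. f (k div b) (k mod b)) = (\<Sum>i<a. \<Sum>k\<in>{i*b..<i*b+b}. f (k div b) (k mod b))"
    by (rule sum.nat_group[symmetric])
  also have "\<dots> = (\<Sum>i<a. \<Sum>j<b. f i j)"
  proof (rule sum.cong[OF refl])
    fix i
    show "(\<Sum>k\<in>{i*b..<i*b+b}. f (k div b) (k mod b)) = (\<Sum>j<b. f i j)"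
      by (rule sum.reindex_bij_witness[of _ "\<lambda>j. i*b+j" "\<lambda>k. k - i*b"])
         (auto simp: mult.commute div_nat_eqI mod_nat_eqI intro!: arg_cong2[where f=f] div_nat_eqI[symmetric]
            mod_nat_eqI[symmetric])
  qed
  finally show ?thesis .
qed

lemma kron_mult:
  assumes A: "A \<in> carrier_mat a b" and B: "B \<in> carrier_mat a' b'"
    and C: "C \<in> carrier_mat b c" and D: "D \<in> carrier_mat b' c'"
  shows "kron A B * kron C D = kron (A * C) (B * D)"
proof (intro eq_matI)
  fix i j assume "i < dim_row (kron (A * C) (B * D))" "j < dim_col (kron (A * C) (B * D))"
  then have ij: "i < a * a'" "j < c * c'" using assms by auto
  note i = div_mod_less[OF ij(1)] and j = div_mod_less[OF ij(2)]
  have "(kron A B * kron C D) $$ (i,j)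
     = (\<Sum>k<b*b'. A $$ (i div a', k div b') * B $$ (i mod a', k mod b') * (C $$ (k div b', j div c') * D $$ (k mod b', j mod c')))"
    using assms ij by (auto simp: scalar_prod_def atLeast0LessThan kron_index intro!: sum.cong)
  also have "\<dots> = (\<Sum>k<b. \<Sum>l<b'. A $$ (i div a', k) * B $$ (i mod a', l) * (C $$ (k, j div c') * D $$ (l, j mod c')))"
    by (rule sum_div_mod[where f = "\<lambda>k l. A $$ (i div a', k) * B $$ (i mod a', l) * (C $$ (k, j div c') * D $$ (l, j mod c'))"])
  also have "\<dots> = (\<Sum>k<b. A $$ (i div a', k) * C $$ (k, j div c')) * (\<Sum>l<b'. B $$ (i mod a', l) * D $$ (l, j mod c'))"
    by (simp add: sum_product mult.assoc mult.left_commute)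
  also have "\<dots> = kron (A * C) (B * D) $$ (i,j)"
    using assms ij i j by (auto simp: kron_index scalar_prod_def atLeast0LessThan)
  finally show "(kron A B * kron C D) $$ (i,j) = kron (A * C) (B * D) $$ (i,j)" .
qed (use assms in auto)

lemma adj_kron: "adj (kron A B) = kron (adj A) (adj B)"
  by (intro eq_matI)
     (simp_all add: kron_index div_mod_less[of _ "dim_row A"] div_mod_less[of _ "dim_col A"])

lemma kron_one: "kron (1\<^sub>m a) (1\<^sub>m b) = 1\<^sub>m (a * b)"
proof (intro eq_matI)
  fix i j assume "i < dim_row (1\<^sub>m (a*b) :: complex mat)" "j < dim_col (1\<^sub>m (a*b) :: complex mat)"
  then have ij: "i < a*b" "j < a*b" by auto
  note div_mod_less[OF ij(1)] div_mod_less[OF ij(2)]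
  moreover have "i = j \<longleftrightarrow> i div b = j div b \<and> i mod b = j mod b" by (metis div_mult_mod_eq)
  ultimately show "kron (1\<^sub>m a) (1\<^sub>m b) $$ (i,j) = 1\<^sub>m (a*b) $$ (i,j)"
    using ij by (auto simp: kron_index)
qed auto

lemma kron_zero_left[simp]: "kron (0\<^sub>m a b) B = 0\<^sub>m (a * dim_row B) (b * dim_col B)"
  by (intro eq_matI) (simp_all add: kron_index div_mod_less)

lemma kron_zero_right[simp]: "kron B (0\<^sub>m a b) = 0\<^sub>m (dim_row B * a) (dim_col B * b)"
  by (intro eq_matI) (simp_all add: kron_index div_mod_less[of _ "dim_row B"] div_mod_less[of _ "dim_col B"])

lemma kron_smult_left: "kron (x \<cdot>\<^sub>m A) B = x \<cdot>\<^sub>m kron A B"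
  by (intro eq_matI) (simp_all add: kron_index div_mod_less)

lemma kron_smult_right: "kron A (x \<cdot>\<^sub>m B) = x \<cdot>\<^sub>m kron A B"
  by (intro eq_matI) (simp_all add: kron_index div_mod_less[of _ "dim_row A"] div_mod_less[of _ "dim_col A"])

lemma kron_mat_sum_left:
  assumes "\<And>k. k \<in> F \<Longrightarrow> f k \<in> carrier_mat a b" and B: "B \<in> carrier_mat c d"
  shows "kron (mat_sum a b f F) B = mat_sum (a*c) (b*d) (\<lambda>k. kron (f k) B) F"
proof (intro eq_matI)
  fix i j assume "i < dim_row (mat_sum (a*c) (b*d) (\<lambda>k. kron (f k) B) F)"
    "j < dim_col (mat_sum (a*c) (b*d) (\<lambda>k. kron (f k) B) F)"
  then have ij: "i < a*c" "j < b*d" by auto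
  then show "kron (mat_sum a b f F) B $$ (i,j) = mat_sum (a*c) (b*d) (\<lambda>k. kron (f k) B) F $$ (i,j)"
    using B div_mod_less[OF ij(1)] div_mod_less[OF ij(2)]
    by (auto simp: kron_index sum_distrib_right dest!: assms(1) intro!: sum.cong)
qed (use B in auto)

lemma kron_mat_sum_right:
  assumes "\<And>k. k \<in> F \<Longrightarrow> f k \<in> carrier_mat a b" and B: "B \<in> carrier_mat c d"
  shows "kron B (mat_sum a b f F) = mat_sum (c*a) (d*b) (\<lambda>k. kron B (f k)) F"
proof (intro eq_matI)
  fix i j assume "i < dim_row (mat_sum (c*a) (d*b) (\<lambda>k. kron B (f k)) F)"
    "j < dim_col (mat_sum (c*a) (d*b) (\<lambda>k. kron B (f k)) F)"
  then have ij: "i < c*a" "j < d*b" by auto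
  then show "kron B (mat_sum a b f F) $$ (i,j) = mat_sum (c*a) (d*b) (\<lambda>k. kron B (f k)) F $$ (i,j)"
    using B div_mod_less[OF ij(1)] div_mod_less[OF ij(2)]
    by (auto simp: kron_index sum_distrib_left dest!: assms(1) intro!: sum.cong)
qed (use B in auto)

text \<open>Both bracketings list the index triples in the same lexicographic order. Hence
  associativity is an equality, and no permutation of coordinates enters the later coassociativity
  argument.\<close>

lemma kron_assoc: "kron (kron A B) C = kron A (kron B C)"
proof (intro eq_matI)
  fix i j assume "i < dim_row (kron A (kron B C))" "j < dim_col (kron A (kron B C))"
  then have ij: "i < dim_row A * dim_row B * dim_row C" "j < dim_col A * dim_col B * dim_col C"
    "i < dim_row A * (dim_row B * dim_row C)" "j < dim_col A * (dim_col B * dim_col C)"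
    by (auto simp: mult.assoc)
  note b = div_mod_less[OF ij(1)] div_mod_less[OF ij(2)] div_mod_less[OF ij(3)] div_mod_less[OF ij(4)]
  have *: "k mod (x * y) mod y = k mod y" "k div y div x = k div (x * y)"
    "k mod (x * y) div y = k div y mod x" for k x y :: nat
    by (cases "y = 0"; simp add: mod_mult2_eq div_mult2_eq mult.commute[of x y])+
  show "kron (kron A B) C $$ (i,j) = kron A (kron B C) $$ (i,j)"
    using b ij by (simp add: kron_index * mult.assoc)
qed (auto simp: mult.assoc)

text \<open>Padding with zero rows makes the matrix square. The transpose of the padded matrix kills
  the last unit vector, so its determinant vanishes and the padded matrix has a kernel vector
  too.\<close>

lemma wide_mat_kernel:
  fixes A :: "complex mat"
  assumes A: "A \<in> carrier_mat d m" and "d < m"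
  shows "\<exists>v \<in> carrier_vec m. v \<noteq> 0\<^sub>v m \<and> A *\<^sub>v v = 0\<^sub>v d"
proof -
  define B where "B = mat m m (\<lambda>(i,j). if i < d then A $$ (i,j) else 0)"
  have B: "B \<in> carrier_mat m m" by (simp add: B_def)
  have "transpose_mat B *\<^sub>v unit_vec m (m - 1) = 0\<^sub>v m"
    using \<open>d < m\<close> by (intro eq_vecI) (auto simp: B_def)
  moreover have "unit_vec m (m - 1) \<noteq> (0\<^sub>v m :: complex vec)" 
    using \<open>d < m\<close> by (metis diff_less index_unit_vec(2) index_zero_vec(1) less_zeroE neq0_conv one_neq_zero zero_less_one)
  ultimately have "det (transpose_mat B) = 0"
    using B by (subst det_0_iff_vec_prod_zero[of _ m]) (auto intro!: exI[of _ "unit_vec m (m - 1)"])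
  then have "det B = 0" using det_transpose[OF B] by simp
  then obtain v where v: "v \<in> carrier_vec m" "v \<noteq> 0\<^sub>v m" "B *\<^sub>v v = 0\<^sub>v m"
    using det_0_iff_vec_prod_zero[OF B] by auto
  have "A *\<^sub>v v = 0\<^sub>v d"
  proof (intro eq_vecI)
    fix i assume "i < dim_vec (0\<^sub>v d :: complex vec)"
    then have i: "i < d" by simp
    have "row A i = row B i" using i A \<open>d < m\<close> by (intro eq_vecI) (auto simp: B_def)
    then have "(A *\<^sub>v v) $ i = (B *\<^sub>v v) $ i" using i A B \<open>d < m\<close> by auto
    then show "(A *\<^sub>v v) $ i = 0\<^sub>v d $ i" using v i \<open>d < m\<close> by simp
  qed (use A in auto)
  then show ?thesis using v by blast
qed

lemma mat_minus_eq_zero: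
  fixes A :: "complex mat"
  assumes "A \<in> carrier_mat d k" "B \<in> carrier_mat d k" "A - B = 0\<^sub>m d k"
  shows "A = B"
proof (intro eq_matI)
  fix i j assume ij: "i < dim_row B" "j < dim_col B"
  then have "(A - B) $$ (i,j) = 0" unfolding assms(3) using assms(2) by simp
  then show "A $$ (i,j) = B $$ (i,j)" using ij by simp
qed (use assms in auto)

lemma smult_smult_mat: "x \<cdot>\<^sub>m (y \<cdot>\<^sub>m A) = (x * y) \<cdot>\<^sub>m (A :: complex mat)"
  by (intro eq_matI) (auto simp: mult.assoc)

lemma mat_sum_smult2:
  assumes c: "\<And>a b. a \<in> A \<Longrightarrow> b \<in> B \<Longrightarrow> f a b \<in> carrier_mat r c"
  shows "x \<cdot>\<^sub>m mat_sum r c (\<lambda>a. mat_sum r c (\<lambda>b. y a b \<cdot>\<^sub>m f a b) B) A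
       = mat_sum r c (\<lambda>a. mat_sum r c (\<lambda>b. (x * y a b) \<cdot>\<^sub>m f a b) B) A"
proof (intro eq_matI)
  have d: "dim_row (f a b) = r" "dim_col (f a b) = c" if "a \<in> A" "b \<in> B" for a b using c[OF that] by auto
  fix i j assume "i < dim_row (mat_sum r c (\<lambda>a. mat_sum r c (\<lambda>b. (x * y a b) \<cdot>\<^sub>m f a b) B) A)"
    "j < dim_col (mat_sum r c (\<lambda>a. mat_sum r c (\<lambda>b. (x * y a b) \<cdot>\<^sub>m f a b) B) A)"
  then show "(x \<cdot>\<^sub>m mat_sum r c (\<lambda>a. mat_sum r c (\<lambda>b. y a b \<cdot>\<^sub>m f a b) B) A) $$ (i,j)
       = mat_sum r c (\<lambda>a. mat_sum r c (\<lambda>b. (x * y a b) \<cdot>\<^sub>m f a b) B) A $$ (i,j)"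
    by (simp add: d sum_distrib_left mult.assoc)
qed auto

text \<open>Isometries into one space with mutually orthogonal ranges. The ranges need not span the
  space; this leaves room for representations that do not preserve the unit.\<close>

definition orthonormal_family :: "nat \<Rightarrow> 'k set \<Rightarrow> ('k \<Rightarrow> nat) \<Rightarrow> ('k \<Rightarrow> complex mat) \<Rightarrow> bool" where
  "orthonormal_family D F e Y \<longleftrightarrow> finite F \<and> (\<forall>k\<in>F. Y k \<in> carrier_mat D (e k) \<and> adj (Y k) * Y k = 1\<^sub>m (e k))
     \<and> (\<forall>k\<in>F. \<forall>l\<in>F. k \<noteq> l \<longrightarrow> adj (Y k) * Y l = 0\<^sub>m (e k) (e l))"

lemma orthonormal_familyD:
  assumes "orthonormal_family D F e Y"
  shows "finite F" "\<And>k. k \<in> F \<Longrightarrow> Y k \<in> carrier_mat D (e k)"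
    "\<And>k. k \<in> F \<Longrightarrow> adj (Y k) * Y k = 1\<^sub>m (e k)"
    "\<And>k l. k \<in> F \<Longrightarrow> l \<in> F \<Longrightarrow> k \<noteq> l \<Longrightarrow> adj (Y k) * Y l = 0\<^sub>m (e k) (e l)"
  using assms by (auto simp: orthonormal_family_def)

lemma conj_carrier:
  "Y \<in> carrier_mat D e \<Longrightarrow> g \<in> carrier_mat e e \<Longrightarrow> Y * g * adj Y \<in> carrier_mat D D"
  by (auto intro!: mult_carrier_mat[of _ D e])

lemma orthonormal_family_kron:
  assumes "orthonormal_family d F e V" "orthonormal_family d' G e' W"
  shows "orthonormal_family (d * d') (F \<times> G) (\<lambda>p. e (fst p) * e' (snd p)) (\<lambda>p. kron (V (fst p)) (W (snd p)))"
proof -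
  note V = orthonormal_familyD[OF assms(1)] and W = orthonormal_familyD[OF assms(2)]
  have p: "adj (kron (V a) (W b)) * kron (V a') (W b') = kron (adj (V a) * V a') (adj (W b) * W b')"
    if "a \<in> F" "b \<in> G" "a' \<in> F" "b' \<in> G" for a b a' b'
    unfolding adj_kron using that V(2) W(2) by (intro kron_mult) auto
  have z: "kron (adj (V a) * V a') (adj (W b) * W b') = 0\<^sub>m (e a * e' b) (e a' * e' b')"
    if "a \<in> F" "b \<in> G" "a' \<in> F" "b' \<in> G" "(a,b) \<noteq> (a',b')" for a b a' b'
  proof (cases "a = a'")
    case True
    then have "b \<noteq> b'" using that by simp
    then show ?thesis using V(3)[of a] W(4)[of b b'] that True by simp
  next
    case False
    have "dim_row (adj (W b) * W b') = e' b" "dim_col (adj (W b) * W b') = e' b'" using W(2)[of b] W(2)[of b'] that by auto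
    then show ?thesis using V(4)[of a a'] False that by simp
  qed
  show ?thesis unfolding orthonormal_family_def
    using V W p z by (auto simp: kron_one)
qed

text \<open>Refines each range further. In the product of two composites the middle factor
  \<open>adj (V k) * V k'\<close> is either 1 or 0, which reduces the claim to the inner
  families.\<close>

lemma orthonormal_family_compose:
  assumes V: "orthonormal_family d F e V" and W: "\<And>k. k \<in> F \<Longrightarrow> orthonormal_family (e k) (G k) (e' k) (W k)"
  shows "orthonormal_family d (Sigma F G) (\<lambda>(k,l). e' k l) (\<lambda>(k,l). V k * W k l)"
proof -
  note VD = orthonormal_familyD[OF V] and WD = orthonormal_familyD[OF W]
  have c: "V k * W k l \<in> carrier_mat d (e' k l)" if "k \<in> F" "l \<in> G k" for k l
    using VD(2)[OF that(1)] WD(2)[OF that] by (rule mult_carrier_mat)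
  have prod: "adj (V k * W k l) * (V k' * W k' l') = adj (W k l) * (adj (V k) * V k' * W k' l')"
    if "k \<in> F" "l \<in> G k" "k' \<in> F" "l' \<in> G k'" for k l k' l'
  proof -
    note Wa = adj_carrier[OF WD(2)[OF that(1,2)]] and Va = adj_carrier[OF VD(2)[OF that(1)]]
    have "adj (V k * W k l) * (V k' * W k' l') = adj (W k l) * (adj (V k) * (V k' * W k' l'))"
      unfolding adj_mult[OF VD(2)[OF that(1)] WD(2)[OF that(1,2)]]
      using Wa Va c[OF that(3,4)] by (rule assoc_mult_mat)
    also have "adj (V k) * (V k' * W k' l') = adj (V k) * V k' * W k' l'"
      using assoc_mult_mat[OF Va VD(2)[OF that(3)] WD(2)[OF that(3,4)]] by simp
    finally show ?thesis .
  qed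
  have same: "adj (V k * W k l) * (V k * W k l') = adj (W k l) * W k l'" if "k \<in> F" "l \<in> G k" "l' \<in> G k" for k l l'
    unfolding prod[OF that(1,2) that(1,3)] VD(3)[OF that(1)] left_mult_one_mat[OF WD(2)[OF that(1,3)]] ..
  have diff: "adj (V k * W k l) * (V k' * W k' l') = 0\<^sub>m (e' k l) (e' k' l')"
    if "k \<in> F" "l \<in> G k" "k' \<in> F" "l' \<in> G k'" "k \<noteq> k'" for k l k' l'
    unfolding prod[OF that(1-4)] VD(4)[OF that(1,3,5)] left_mult_zero_mat[OF WD(2)[OF that(3,4)]]
    using adj_carrier[OF WD(2)[OF that(1,2)]] by (rule right_mult_zero_mat)
  have orth: "adj (V k * W k l) * (V k' * W k' l') = 0\<^sub>m (e' k l) (e' k' l')"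
    if "k \<in> F" "l \<in> G k" "k' \<in> F" "l' \<in> G k'" "(k,l) \<noteq> (k',l')" for k l k' l'
    using that diff[OF that(1-4)] same[of k l l'] WD(4)[of k l l'] by (cases "k = k'") auto
  show ?thesis unfolding orthonormal_family_def
    using VD(1) WD(1) c same WD(3) orth by auto
qed

lemma conj_mat_sum:
  assumes V: "V \<in> carrier_mat d e" and g: "\<And>s. s \<in> A \<Longrightarrow> g s \<in> carrier_mat e e"
  shows "mat_sum d d (\<lambda>s. x s \<cdot>\<^sub>m (V * g s * adj V)) A = V * mat_sum e e (\<lambda>s. x s \<cdot>\<^sub>m g s) A * adj V"
proof -
  have "V * mat_sum e e (\<lambda>s. x s \<cdot>\<^sub>m g s) A = mat_sum d e (\<lambda>s. V * (x s \<cdot>\<^sub>m g s)) A"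
    by (rule mat_sum_mult_left[OF smult_carrier_mat[OF g] V])
  moreover have "mat_sum d e (\<lambda>s. V * (x s \<cdot>\<^sub>m g s)) A * adj V = mat_sum d d (\<lambda>s. V * (x s \<cdot>\<^sub>m g s) * adj V) A"
    by (rule mat_sum_mult_right[OF mult_carrier_mat[OF V smult_carrier_mat[OF g]] adj_carrier[OF V]])
  moreover have "V * (x s \<cdot>\<^sub>m g s) * adj V = x s \<cdot>\<^sub>m (V * g s * adj V)" if s: "s \<in> A" for s
    using mult_smult_distrib[OF V g[OF s], of "x s"]
      mult_smult_assoc_mat[OF mult_carrier_mat[OF V g[OF s]] adj_carrier[OF V], of "x s"] by simp
  ultimately show ?thesis by (auto intro!: mat_sum_cong)
qed

section \<open>Perron vectors of fusion rings\<close>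

text \<open>One nonzero entry of \<open>w\<close> reaches every coordinate. This gain from weak to
  strict positivity is what makes the Perron arguments below work.\<close>

lemma positive_matrix_mult_pos:
  fixes L :: "nat \<Rightarrow> nat \<Rightarrow> real"
  assumes "\<And>i j. i < r \<Longrightarrow> j < r \<Longrightarrow> L i j > 0" "\<And>j. j < r \<Longrightarrow> w j \<ge> 0" "j0 < r" "w j0 \<noteq> 0" "i < r"
  shows "(\<Sum>j<r. L i j * w j) > 0"
proof (rule sum_pos2[of _ j0])
  show "0 < L i j0 * w j0" using assms by (simp add: order_less_le)
qed (use assms in \<open>auto simp: less_imp_le\<close>)

text \<open>A matrix with positive entries is monotone, so \<open>L y >= q y\<close> can be
  iterated. The matrix is stated over the complex numbers because spectra and bounds on powers are
  available there.\<close>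

lemma mult_mat_vec_power_lower_bound:
  fixes L :: "nat \<Rightarrow> nat \<Rightarrow> real"
  assumes L: "\<And>i j. i < r \<Longrightarrow> j < r \<Longrightarrow> L i j > 0"
    and y: "\<And>i. i < r \<Longrightarrow> y i > 0" and "q \<ge> 0"
    and ge: "\<And>i. i < r \<Longrightarrow> (\<Sum>j<r. L i j * y j) \<ge> q * y i"
  shows "\<exists>z. (mat r r (\<lambda>(i,j). complex_of_real (L i j)) ^\<^sub>m k) *\<^sub>v vec r (\<lambda>i. complex_of_real (y i))
             = vec r (\<lambda>i. complex_of_real (z i)) \<and> (\<forall>i<r. z i \<ge> q ^ k * y i)"
proof (induction k)
  case 0
  show ?case by (intro exI[of _ y]) auto
next
  case (Suc k)
  let ?A = "mat r r (\<lambda>(i,j). complex_of_real (L i j))"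
  let ?y = "vec r (\<lambda>i. complex_of_real (y i))"
  have A: "?A \<in> carrier_mat r r" by simp
  define y' where "y' = (\<lambda>i. \<Sum>j<r. L i j * y j)"
  obtain z where z: "?A ^\<^sub>m k *\<^sub>v ?y = vec r (\<lambda>i. complex_of_real (z i))" "\<forall>i<r. z i \<ge> q ^ k * y i"
    using Suc.IH by blast
  \<comment> \<open>Matrix powers multiply on the right, while the induction applies the new factor
    on the left.\<close>
  have "?A ^\<^sub>m k * ?A = ?A * ?A ^\<^sub>m k"
    by (induction k) (auto simp: assoc_mult_mat[of _ r r _ r _ r] left_mult_one_mat[OF A] right_mult_one_mat[OF A])
  then have "?A ^\<^sub>m Suc k = ?A * ?A ^\<^sub>m k" by simp
  then have "?A ^\<^sub>m Suc k *\<^sub>v ?y = ?A *\<^sub>v (?A ^\<^sub>m k *\<^sub>v ?y)"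
    using A by (simp add: assoc_mult_mat_vec[of _ r r _ r])
  also have "\<dots> = vec r (\<lambda>i. complex_of_real (\<Sum>j<r. L i j * z j))"
    unfolding z by (intro eq_vecI) (auto simp: scalar_prod_def atLeast0LessThan)
  finally have "?A ^\<^sub>m Suc k *\<^sub>v ?y = vec r (\<lambda>i. complex_of_real (\<Sum>j<r. L i j * z j))" .
  moreover have "(\<Sum>j<r. L i j * z j) \<ge> q ^ Suc k * y i" if "i < r" for i
  proof -
    have "q ^ Suc k * y i \<le> q ^ k * (\<Sum>j<r. L i j * y j)"
      using mult_left_mono[OF ge[OF that], of "q ^ k"] \<open>q \<ge> 0\<close> by (simp add: mult.assoc mult.left_commute)
    also have "\<dots> = (\<Sum>j<r. L i j * (q ^ k * y j))" by (simp add: sum_distrib_left mult.left_commute)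
    also have "\<dots> \<le> (\<Sum>j<r. L i j * z j)"
      using z(2) L[OF that] by (intro sum_mono mult_left_mono) (auto simp: less_imp_le)
    finally show ?thesis .
  qed
  ultimately show ?case by (intro exI[of _ "\<lambda>i. \<Sum>j<r. L i j * z j"]) auto
qed

lemma eigenvalue_norm_le_spectral_radius:
  assumes "A \<in> carrier_mat r r" "r > 0" "eigenvalue A \<mu>"
  shows "norm \<mu> \<le> spectral_radius A"
  using spectral_radius_mem_max(2)[OF assms(1,2)] assms(3) by (auto simp: spectrum_def)

text \<open>The lower half of the Collatz-Wielandt characterisation. After dividing by a number
  strictly between the spectral radius and \<open>q\<close>, the powers of the matrix would stay
  bounded although they stretch \<open>y\<close> at an exponential rate.\<close>

lemma spectral_radius_ge_of_superinvariant:
  fixes L :: "nat \<Rightarrow> nat \<Rightarrow> real"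
  assumes L: "\<And>i j. i < r \<Longrightarrow> j < r \<Longrightarrow> L i j > 0" and "r > 0"
    and y: "\<And>i. i < r \<Longrightarrow> y i > 0"
    and ge: "\<And>i. i < r \<Longrightarrow> (\<Sum>j<r. L i j * y j) \<ge> q * y i"
  shows "q \<le> spectral_radius (mat r r (\<lambda>(i,j). complex_of_real (L i j)))" (is "_ \<le> spectral_radius ?A")
proof (rule ccontr)
  assume "\<not> ?thesis"
  then obtain p where p: "spectral_radius ?A < p" "p < q" using dense[of "spectral_radius ?A" q] by auto
  have A: "?A \<in> carrier_mat r r" by simp
  have "spectral_radius ?A \<ge> 0" using spectral_radius_mem_max(1)[OF A \<open>r > 0\<close>] by auto
  then have p0: "p > 0" using p by simp
  define K where "K = (\<lambda>i j. L i j / p)"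
  let ?B = "mat r r (\<lambda>(i,j). complex_of_real (K i j))"
  have B: "?B \<in> carrier_mat r r" by simp
  have AB: "?A = complex_of_real p \<cdot>\<^sub>m ?B" using p0 by (intro eq_matI) (auto simp: K_def)
  have "spectral_radius ?B < 1"
  proof -
    obtain \<mu> where \<mu>: "norm \<mu> = spectral_radius ?B" "eigenvalue ?B \<mu>"
      using spectral_radius_mem_max(1)[OF B \<open>r > 0\<close>] by (auto simp: spectrum_def)
    then obtain v where v: "v \<in> carrier_vec r" "v \<noteq> 0\<^sub>v r" "?B *\<^sub>v v = \<mu> \<cdot>\<^sub>v v"
      by (auto simp: eigenvalue_def eigenvector_def)
    have "?A *\<^sub>v v = complex_of_real p \<cdot>\<^sub>v (?B *\<^sub>v v)" unfolding AB
      using v(1) by (intro eq_vecI) (auto simp: smult_scalar_prod_distrib[of _ r])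
    then have "?A *\<^sub>v v = (complex_of_real p * \<mu>) \<cdot>\<^sub>v v"
      using v by (simp add: smult_smult_assoc)
    then have "eigenvalue ?A (complex_of_real p * \<mu>)"
      using v by (auto simp: eigenvalue_def eigenvector_def)
    then have "p * norm \<mu> \<le> spectral_radius ?A"
      using eigenvalue_norm_le_spectral_radius[OF A \<open>r > 0\<close>] p0 by (fastforce simp: norm_mult)
    then have "p * norm \<mu> < p * 1" using p by simp
    then show ?thesis using p0 \<mu> mult_less_cancel_left_pos by fastforce
  qed
  \<comment> \<open>A spectral radius below 1 gives one bound \<open>c\<close> on the entries of all
    powers of \<open>?B\<close>.\<close>
  then obtain c where c: "\<And>k. norm_bound (?B ^\<^sub>m k) c"
    using spectral_radius_jnf_norm_bound_less_1_upper_triangular[OF B] by blast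
  define s where "s = q / p"
  have s1: "s > 1" using p p0 by (simp add: s_def)
  have K: "\<And>i j. i < r \<Longrightarrow> j < r \<Longrightarrow> K i j > 0" using L p0 by (simp add: K_def)
  have "(\<Sum>j<r. K i j * y j) = (\<Sum>j<r. L i j * y j) / p" for i
    by (simp add: K_def sum_divide_distrib)
  then have geK: "\<And>i. i < r \<Longrightarrow> (\<Sum>j<r. K i j * y j) \<ge> s * y i"
    using ge p0 by (simp add: s_def divide_right_mono)
  have "s ^ k * y 0 \<le> c * (\<Sum>j<r. y j)" for k
  proof -
    let ?y = "vec r (\<lambda>i. complex_of_real (y i))"
    obtain z where z: "?B ^\<^sub>m k *\<^sub>v ?y = vec r (\<lambda>i. complex_of_real (z i))" "\<forall>i<r. z i \<ge> s ^ k * y i"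
      using mult_mat_vec_power_lower_bound[of r K y s k, OF K y _ geK] s1 by auto
    have Bk: "?B ^\<^sub>m k \<in> carrier_mat r r" by (simp add: B)
    have "complex_of_real (z 0) = (?B ^\<^sub>m k *\<^sub>v ?y) $ 0" using z \<open>r > 0\<close> by simp
    also have "\<dots> = (\<Sum>j<r. (?B ^\<^sub>m k) $$ (0,j) * complex_of_real (y j))"
      using \<open>r > 0\<close> Bk by (auto simp: scalar_prod_def atLeast0LessThan)
    finally have "norm (complex_of_real (z 0)) \<le> (\<Sum>j<r. norm ((?B ^\<^sub>m k) $$ (0,j) * complex_of_real (y j)))"
      by (simp add: norm_sum)
    also have "\<dots> \<le> (\<Sum>j<r. c * y j)"
    proof (rule sum_mono)
      fix j assume j: "j \<in> {..<r}"
      have "norm ((?B ^\<^sub>m k) $$ (0,j)) \<le> c" using c[of k] Bk j \<open>r > 0\<close> by (auto simp: norm_bound_def)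
      then show "norm ((?B ^\<^sub>m k) $$ (0,j) * complex_of_real (y j)) \<le> c * y j"
        using y[of j] j by (simp add: norm_mult)
    qed
    finally have "z 0 \<le> c * (\<Sum>j<r. y j)" by (simp add: sum_distrib_left)
    then show ?thesis using z(2) \<open>r > 0\<close> by force
  qed
  moreover obtain k where "s ^ k > c * (\<Sum>j<r. y j) / y 0" using real_arch_pow[OF s1] by blast
  ultimately show False using y[OF \<open>r > 0\<close>] by (simp add: pos_divide_less_eq leD)
qed

text \<open>Triangle inequality in one row of the eigenvalue equation: entrywise absolute values
  turn an eigenvector into a subinvariant vector.\<close>

lemma eigenvector_norm_le:
  fixes N :: "nat \<Rightarrow> nat \<Rightarrow> real"
  assumes N: "\<And>j. j < r \<Longrightarrow> N i j \<ge> 0" and x: "x \<in> carrier_vec r" and i: "i < r"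
    and ev: "mat r r (\<lambda>(i,j). complex_of_real (N i j)) *\<^sub>v x = \<mu> \<cdot>\<^sub>v x" (is "?A *\<^sub>v x = _")
  shows "norm \<mu> * norm (x $ i) \<le> (\<Sum>j<r. N i j * norm (x $ j))"
proof -
  have "\<mu> * x $ i = (?A *\<^sub>v x) $ i" unfolding ev using i x by simp
  also have "\<dots> = (\<Sum>j<r. complex_of_real (N i j) * x $ j)"
    using i x by (auto simp: scalar_prod_def atLeast0LessThan)
  finally have "norm (\<mu> * x $ i) \<le> (\<Sum>j<r. norm (complex_of_real (N i j) * x $ j))"
    by (simp add: norm_sum)
  also have "\<dots> = (\<Sum>j<r. N i j * norm (x $ j))"
    using N by (intro sum.cong) (auto simp: norm_mult)
  finally show ?thesis by (simp add: norm_mult)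
qed

text \<open>Existence part of Perron's theorem. For an eigenvector \<open>x\<close> of largest
  modulus, \<open>w = |x|\<close> satisfies \<open>l w <= L w\<close>. If this were strict in one
  coordinate, a further application of \<open>L\<close> would make it strict in all of them, and the
  Collatz-Wielandt bound would exceed the spectral radius \<open>l\<close>.\<close>

lemma positive_matrix_eigenvector:
  fixes L :: "nat \<Rightarrow> nat \<Rightarrow> real"
  assumes L: "\<And>i j. i < r \<Longrightarrow> j < r \<Longrightarrow> L i j > 0" and "r > 0"
  shows "\<exists>l v. (\<forall>i<r. v i > 0) \<and> (\<forall>i<r. (\<Sum>j<r. L i j * v j) = l * v i)"
proof -
  let ?A = "mat r r (\<lambda>(i,j). complex_of_real (L i j))"
  have A: "?A \<in> carrier_mat r r" by simp
  define l where "l = spectral_radius ?A"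
  obtain \<mu> where \<mu>: "norm \<mu> = l" "eigenvalue ?A \<mu>"
    using spectral_radius_mem_max(1)[OF A \<open>r > 0\<close>] by (auto simp: spectrum_def l_def)
  then obtain x where x: "x \<in> carrier_vec r" "x \<noteq> 0\<^sub>v r" "?A *\<^sub>v x = \<mu> \<cdot>\<^sub>v x"
    by (auto simp: eigenvalue_def eigenvector_def)
  define w where "w = (\<lambda>i. norm (x $ i))"
  obtain j0 where j0: "j0 < r" "w j0 \<noteq> 0" using x(1,2) by (auto simp: w_def vec_eq_iff)
  have w0: "\<And>j. w j \<ge> 0" by (simp add: w_def)
  define y where "y = (\<lambda>i. \<Sum>j<r. L i j * w j)"
  have y0: "\<And>i. i < r \<Longrightarrow> y i > 0" unfolding y_def using positive_matrix_mult_pos[of r L w, OF L] w0 j0 by blast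
  have yw: "l * w i \<le> y i" if "i < r" for i
    using eigenvector_norm_le[OF _ x(1) that x(3)] L[OF that] by (simp add: y_def w_def \<mu> less_imp_le)
  have "y i = l * w i" if "i < r" for i
  proof (rule ccontr)
    assume ne: "y i \<noteq> l * w i"
    \<comment> \<open>The best constant with \<open>L y >= q y\<close>; it suffices to show that it
      exceeds \<open>l\<close>.\<close>
    define q where "q = Min ((\<lambda>i. (\<Sum>j<r. L i j * y j) / y i) ` {..<r})"
    have ge: "(\<Sum>j<r. L i j * y j) \<ge> q * y i" if "i < r" for i
    proof -
      have "q \<le> (\<Sum>j<r. L i j * y j) / y i" unfolding q_def using that by (intro Min_le) auto
      then show ?thesis using y0[OF that] by (simp add: pos_le_divide_eq)
    qed
    have "q \<in> (\<lambda>i. (\<Sum>j<r. L i j * y j) / y i) ` {..<r}" unfolding q_def using \<open>r > 0\<close> by (intro Min_in) auto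
    then obtain i' where i': "i' < r" "q = (\<Sum>j<r. L i' j * y j) / y i'" by auto
    \<comment> \<open>The vector \<open>y - l w\<close> is nonnegative and, by assumption, nonzero
      at \<open>i\<close>, so \<open>L\<close> makes it strictly positive at the coordinate
      \<open>i'\<close> where the minimum is attained.\<close>
    have "(\<Sum>j<r. L i' j * (y j - l * w j)) > 0"
      using positive_matrix_mult_pos[of r L "\<lambda>j. y j - l * w j" i i', OF L] yw that ne i' by auto
    also have "(\<Sum>j<r. L i' j * (y j - l * w j)) = (\<Sum>j<r. L i' j * y j) - l * y i'"
      by (simp add: y_def sum_subtractf right_diff_distrib sum_distrib_left mult.left_commute)
    finally have "q > l" using i' y0[OF i'(1)] by (simp add: pos_less_divide_eq)
    then show False using spectral_radius_ge_of_superinvariant[of r L y q, OF L \<open>r > 0\<close> y0 ge] by (simp add: l_def)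
  qed
  note eq = this
  have "w i > 0" if "i < r" for i
    using eq[OF that] y0[OF that] w0[of i] by (cases "w i = 0") auto
  then show ?thesis using eq unfolding y_def by blast
qed

text \<open>With \<open>t\<close> the largest ratio of \<open>w\<close> to \<open>v\<close>, the
  vector \<open>t v - w\<close> is a nonnegative eigenvector for \<open>l\<close> that vanishes
  somewhere. If it were nonzero, \<open>L\<close> would make it positive there as well.\<close>

lemma positive_matrix_eigenvector_unique:
  fixes L :: "nat \<Rightarrow> nat \<Rightarrow> real"
  assumes L: "\<And>i j. i < r \<Longrightarrow> j < r \<Longrightarrow> L i j > 0" and "r > 0"
    and v: "\<And>i. i < r \<Longrightarrow> v i > 0" "\<And>i. i < r \<Longrightarrow> (\<Sum>j<r. L i j * v j) = l * v i"
    and w: "\<And>i. i < r \<Longrightarrow> (\<Sum>j<r. L i j * w j) = l * w i"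
  shows "\<exists>t. \<forall>i<r. w i = t * v i"
proof -
  define t where "t = Max ((\<lambda>i. w i / v i) ` {..<r})"
  have "t \<in> (\<lambda>i. w i / v i) ` {..<r}" unfolding t_def using \<open>r > 0\<close> by (intro Max_in) auto
  then obtain i where i: "i < r" "t * v i = w i" using v(1) by fastforce
  have le: "w j \<le> t * v j" if "j < r" for j
  proof -
    have "w j / v j \<le> t" unfolding t_def using that by (intro Max_ge) auto
    then show ?thesis using v(1)[OF that] by (simp add: pos_divide_le_eq)
  qed
  have "w j = t * v j" if "j < r" for j
  proof (rule ccontr)
    assume "w j \<noteq> t * v j"
    then have "(\<Sum>j<r. L i j * (t * v j - w j)) > 0"
      using positive_matrix_mult_pos[of r L "\<lambda>j. t * v j - w j" j i, OF L] le that i by auto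
    also have "(\<Sum>j<r. L i j * (t * v j - w j)) = t * (\<Sum>j<r. L i j * v j) - (\<Sum>j<r. L i j * w j)"
      by (simp add: sum_subtractf right_diff_distrib sum_distrib_left mult.left_commute)
    also have "\<dots> = l * (t * v i - w i)" using v(2)[OF i(1)] w[OF i(1)] by (simp add: algebra_simps)
    finally show False using i by simp
  qed
  then show ?thesis by blast
qed

text \<open>The right eigenvector shows that \<open>q\<close> is an eigenvalue. Pairing the absolute
  values of any other eigenvector with the positive left eigenvector bounds its eigenvalue by
  \<open>q\<close>. Nonnegative entries suffice for this, as a single fusion matrix may well contain
  zeros.\<close>

lemma spectral_radius_eq_of_positive_eigenvectors:
  fixes N :: "nat \<Rightarrow> nat \<Rightarrow> real"
  assumes N: "\<And>i j. i < r \<Longrightarrow> j < r \<Longrightarrow> N i j \<ge> 0" and "r > 0" and p: "\<And>i. i < r \<Longrightarrow> p i > 0"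
    and right: "\<And>i. i < r \<Longrightarrow> (\<Sum>j<r. N i j * p j) = q * p i"
    and left: "\<And>j. j < r \<Longrightarrow> (\<Sum>i<r. p i * N i j) = q * p j"
  shows "spectral_radius (mat r r (\<lambda>(i,j). complex_of_real (N i j))) = q" (is "spectral_radius ?A = q")
proof -
  have A: "?A \<in> carrier_mat r r" by simp
  let ?p = "vec r (\<lambda>i. complex_of_real (p i))"
  have "?A *\<^sub>v ?p = complex_of_real q \<cdot>\<^sub>v ?p"
    by (intro eq_vecI) (auto simp: scalar_prod_def atLeast0LessThan right simp flip: of_real_mult of_real_sum)
  moreover have "?p \<noteq> 0\<^sub>v r" using p[OF \<open>r > 0\<close>] \<open>r > 0\<close> 
    by (metis index_vec index_zero_vec(1) less_irrefl of_real_eq_0_iff)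
  ultimately have "eigenvalue ?A (complex_of_real q)"
    unfolding eigenvalue_def eigenvector_def by (intro exI[of _ ?p]) simp
  from eigenvalue_norm_le_spectral_radius[OF A \<open>r > 0\<close> this] have ge: "q \<le> spectral_radius ?A" by simp
  obtain \<mu> where \<mu>: "norm \<mu> = spectral_radius ?A" "eigenvalue ?A \<mu>"
    using spectral_radius_mem_max(1)[OF A \<open>r > 0\<close>] by (auto simp: spectrum_def)
  then obtain x where x: "x \<in> carrier_vec r" "x \<noteq> 0\<^sub>v r" "?A *\<^sub>v x = \<mu> \<cdot>\<^sub>v x"
    by (auto simp: eigenvalue_def eigenvector_def)
  define w where "w = (\<lambda>i. norm (x $ i))"
  obtain j0 where j0: "j0 < r" "w j0 \<noteq> 0" using x(1,2) by (auto simp: w_def vec_eq_iff)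
  have w0: "\<And>j. w j \<ge> 0" by (simp add: w_def)
  have le: "norm \<mu> * w i \<le> (\<Sum>j<r. N i j * w j)" if "i < r" for i
    using eigenvector_norm_le[OF _ x(1) that x(3)] N[OF that] by (simp add: w_def)
  define s where "s = (\<Sum>i<r. p i * w i)"
  have s: "s > 0" unfolding s_def
    using j0 w0 p by (intro sum_pos2[of _ j0]) (auto simp: order_less_le)
  have "norm \<mu> * s = (\<Sum>i<r. p i * (norm \<mu> * w i))" by (simp add: s_def sum_distrib_left mult.left_commute)
  also have "\<dots> \<le> (\<Sum>i<r. p i * (\<Sum>j<r. N i j * w j))"
    using le p by (intro sum_mono mult_left_mono) (auto simp: less_imp_le)
  also have "\<dots> = (\<Sum>j<r. (\<Sum>i<r. p i * N i j) * w j)"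
    unfolding sum_distrib_left sum_distrib_right by (subst sum.swap) (simp add: mult.assoc)
  also have "\<dots> = q * s" by (simp add: left s_def sum_distrib_left mult.assoc)
  finally have "norm \<mu> \<le> q" using s by simp
  then show ?thesis using ge \<mu> by simp
qed

text \<open>The right multiplications commute with the entrywise positive sum of all left
  multiplications, so its Perron vector is an eigenvector of each of them. The eigenvalues
  form a positive character, hence a positive left eigenvector of every left multiplication.\<close>

lemma fusion_spectral_radius:
  fixes N :: "nat \<Rightarrow> nat \<Rightarrow> nat \<Rightarrow> nat" and r :: nat
  defines "D \<equiv> \<lambda>a. spectral_radius (mat r r (\<lambda>(c,b). of_nat (N c a b)))"
  assumes "r > 0"
    and assoc: "\<And>a b c d. a < r \<Longrightarrow> b < r \<Longrightarrow> c < r \<Longrightarrow> d < r \<Longrightarrow>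
        (\<Sum>e<r. N e a b * N d e c) = (\<Sum>f<r. N d a f * N f b c)"
    and pos: "\<And>a b. a < r \<Longrightarrow> b < r \<Longrightarrow> \<exists>d<r. N b d a > 0"
    and dual: "\<And>a. a < r \<Longrightarrow> \<exists>a'<r. \<forall>b<r. \<forall>c<r. N c a' b = N b a c"
  shows "\<forall>a<r. D a > 0" and "\<forall>a<r. \<forall>c<r. (\<Sum>b<r. real (N c a b) * D b) = D a * D c"
proof -
  define L where "L = (\<lambda>c b. \<Sum>a<r. real (N c a b))"
  have assocR: "(\<Sum>e<r. real (N e a b) * real (N d e c)) = (\<Sum>f<r. real (N d a f) * real (N f b c))"
    if "a < r" "b < r" "c < r" "d < r" for a b c d
    using arg_cong[OF assoc[OF that], of real] by simp
  have L: "L c b > 0" if c: "c < r" and b: "b < r" for c b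
  proof -
    obtain d where "d < r" "N c d b > 0" using pos[OF b c] by blast
    then show ?thesis unfolding L_def by (intro sum_pos2[of _ d]) auto
  qed
  obtain l v where v: "\<And>i. i < r \<Longrightarrow> v i > 0" "\<And>i. i < r \<Longrightarrow> (\<Sum>j<r. L i j * v j) = l * v i"
    using positive_matrix_eigenvector[of r L, OF L \<open>r > 0\<close>] by blast
  have ev: "\<exists>t. \<forall>c<r. (\<Sum>a<r. real (N c a b) * v a) = t * v c" if b: "b < r" for b
  proof (rule positive_matrix_eigenvector_unique[of r L v l, OF L \<open>r > 0\<close> v])
    fix i assume i: "i < r"
    \<comment> \<open>The map \<open>v |-> (\<Sum>a<r. N c a b * v a)\<close> is right
      multiplication by \<open>b\<close>. The line using \<open>assocR\<close> is where it passes
      through the left multiplications; the other lines reorder sums.\<close>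
    have "(\<Sum>j<r. L i j * (\<Sum>a<r. real (N j a b) * v a))
      = (\<Sum>j<r. \<Sum>a<r. \<Sum>d<r. real (N i d j) * real (N j a b) * v a)"
      unfolding L_def sum_distrib_left sum_distrib_right
      by (simp add: mult.assoc)
    also have "\<dots> = (\<Sum>a<r. \<Sum>d<r. \<Sum>j<r. real (N i d j) * real (N j a b) * v a)"
      by (subst sum.swap, rule sum.cong[OF refl], rule sum.swap)
    also have "\<dots> = (\<Sum>a<r. \<Sum>d<r. (\<Sum>e<r. real (N e d a) * real (N i e b)) * v a)"
      using i b assocR by (simp add: sum_distrib_right)
    also have "\<dots> = (\<Sum>a<r. \<Sum>d<r. \<Sum>e<r. real (N e d a) * real (N i e b) * v a)"
      by (simp add: sum_distrib_right)
    also have "\<dots> = (\<Sum>a<r. \<Sum>e<r. \<Sum>d<r. real (N e d a) * real (N i e b) * v a)"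
      by (rule sum.cong[OF refl], rule sum.swap)
    also have "\<dots> = (\<Sum>e<r. \<Sum>a<r. \<Sum>d<r. real (N e d a) * real (N i e b) * v a)"
      by (rule sum.swap)
    also have "\<dots> = (\<Sum>e<r. real (N i e b) * (\<Sum>a<r. L e a * v a))"
      unfolding L_def sum_distrib_left sum_distrib_right by (simp add: mult_ac)
    also have "\<dots> = l * (\<Sum>e<r. real (N i e b) * v e)"
      using v(2) by (simp add: sum_distrib_left mult.left_commute)
    finally show "(\<Sum>j<r. L i j * (\<Sum>a<r. real (N j a b) * v a)) = l * (\<Sum>a<r. real (N i a b) * v a)" .
  qed
  from ev obtain p where p: "\<And>b c. b < r \<Longrightarrow> c < r \<Longrightarrow> (\<Sum>a<r. real (N c a b) * v a) = p b * v c"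
    by metis
  have p0: "p b > 0" if b: "b < r" for b
  proof -
    \<comment> \<open>Coordinate 0 serves only as a place to compare the two sides; any label would
      do.\<close>
    obtain d where d: "d < r" "N 0 d b > 0" using pos[OF b \<open>r > 0\<close>] by blast
    have "(\<Sum>a<r. real (N 0 a b) * v a) > 0"
      using d v(1) by (intro sum_pos2[of _ d]) (auto simp: less_imp_le)
    then show ?thesis using p[OF b \<open>r > 0\<close>] v(1)[OF \<open>r > 0\<close>] by (simp add: zero_less_mult_iff)
  qed
  have left: "(\<Sum>e<r. p e * real (N e a b)) = p a * p b" if a: "a < r" and b: "b < r" for a b
  proof -
    \<comment> \<open>Right multiplication by \<open>a\<close> followed by that by \<open>b\<close>
      is right multiplication by the product of \<open>a\<close> and \<open>b\<close>. Applied to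
      the common eigenvector and read at coordinate 0, this says that \<open>p\<close> is a
      character.\<close>
    have "(\<Sum>e<r. p e * real (N e a b)) * v 0 = (\<Sum>e<r. real (N e a b) * (\<Sum>x<r. real (N 0 x e) * v x))"
      using p[OF _ \<open>r > 0\<close>] by (simp add: sum_distrib_left sum_distrib_right mult_ac)
    also have "\<dots> = (\<Sum>x<r. (\<Sum>e<r. real (N 0 x e) * real (N e a b)) * v x)"
      unfolding sum_distrib_left sum_distrib_right by (subst sum.swap) (simp add: mult_ac)
    also have "\<dots> = (\<Sum>x<r. (\<Sum>e<r. real (N e x a) * real (N 0 e b)) * v x)"
      using a b \<open>r > 0\<close> assocR by simp
    also have "\<dots> = (\<Sum>e<r. real (N 0 e b) * (\<Sum>x<r. real (N e x a) * v x))"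
      unfolding sum_distrib_left sum_distrib_right by (subst sum.swap) (simp add: mult_ac)
    also have "\<dots> = p a * (\<Sum>e<r. real (N 0 e b) * v e)"
      using p[OF a] by (simp add: sum_distrib_left mult_ac)
    also have "\<dots> = p a * p b * v 0" using p[OF b \<open>r > 0\<close>] by simp
    finally show ?thesis using v(1)[OF \<open>r > 0\<close>] by simp
  qed
  have right: "(\<Sum>b<r. real (N c a b) * p b) = p a * p c" if a: "a < r" and c: "c < r" for a c
  proof -
    obtain a' where a': "a' < r" "\<And>b c. b < r \<Longrightarrow> c < r \<Longrightarrow> N c a' b = N b a c" using dual[OF a] by blast
    have r': "(\<Sum>b<r. real (N c a b) * p b) = p a' * p c" if c: "c < r" for c
      using left[OF a'(1) c] a'(2)[OF c] by (simp add: mult.commute)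
    define s where "s = (\<Sum>c<r. p c * p c)"
    have s: "s > 0" unfolding s_def using p0 \<open>r > 0\<close> by (intro sum_pos) auto
    \<comment> \<open>The number \<open>p^T N_a p\<close> is computed once with \<open>p\<close> as
      right eigenvector for \<open>p a'\<close>, once as left eigenvector for
      \<open>p a\<close>.\<close>
    have "p a' * s = (\<Sum>c<r. p c * (\<Sum>b<r. real (N c a b) * p b))"
      using r' by (simp add: s_def sum_distrib_left mult.left_commute)
    also have "\<dots> = (\<Sum>b<r. (\<Sum>c<r. p c * real (N c a b)) * p b)"
      unfolding sum_distrib_left sum_distrib_right by (subst sum.swap) (simp add: mult_ac)
    also have "\<dots> = p a * s" using left[OF a] by (simp add: s_def sum_distrib_left mult.assoc)
    finally show ?thesis using s r'[OF c] by simp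
  qed
  have D: "D a = p a" if a: "a < r" for a
    using spectral_radius_eq_of_positive_eigenvectors[of r "\<lambda>c b. real (N c a b)" p "p a",
        OF _ \<open>r > 0\<close> p0 right[OF a] left[OF a]] by (simp add: D_def)
  show "\<forall>a<r. D a > 0" using D p0 by simp
  show "\<forall>a<r. \<forall>c<r. (\<Sum>b<r. real (N c a b) * D b) = D a * D c" using D right by simp
qed

section \<open>Schur's lemma\<close>

text \<open>Subspaces are represented below as ranges of such matrices, so that dimensions become
  column counts and restricting an operator becomes factoring through columns.\<close>

definition inj_mat :: "complex mat \<Rightarrow> bool" where
  "inj_mat B \<longleftrightarrow> (\<forall>v \<in> carrier_vec (dim_col B). B *\<^sub>v v = 0\<^sub>v (dim_row B) \<longrightarrow> v = 0\<^sub>v (dim_col B))"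

lemma inj_matD:
  "inj_mat B \<Longrightarrow> B \<in> carrier_mat d k \<Longrightarrow> v \<in> carrier_vec k \<Longrightarrow> B *\<^sub>v v = 0\<^sub>v d \<Longrightarrow> v = 0\<^sub>v k"
  by (auto simp: inj_mat_def)

lemma inj_mat_dim_le: "inj_mat B \<Longrightarrow> B \<in> carrier_mat d k \<Longrightarrow> k \<le> d"
  using wide_mat_kernel[of B d k] inj_matD[of B d k] by (meson not_le)

lemma inj_mat_mult:
  assumes "inj_mat A" "inj_mat B" "A \<in> carrier_mat a b" "B \<in> carrier_mat b c"
  shows "inj_mat (A * B)"
  unfolding inj_mat_def
proof (intro ballI impI)
  fix v assume v: "v \<in> carrier_vec (dim_col (A * B))" "A * B *\<^sub>v v = 0\<^sub>v (dim_row (A * B))"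
  then have "A *\<^sub>v (B *\<^sub>v v) = 0\<^sub>v a" using assms by (simp add: assoc_mult_mat_vec[of _ a b _ c])
  then have "B *\<^sub>v v = 0\<^sub>v b" using v assms by (intro inj_matD[OF assms(1,3)]) auto
  then have "v = 0\<^sub>v c" using v assms(4) by (intro inj_matD[OF assms(2,4)]) auto
  then show "v = 0\<^sub>v (dim_col (A * B))" using assms(4) by simp
qed

lemma inj_mat_if_left_inverse:
  assumes "A \<in> carrier_mat c d" "B \<in> carrier_mat d c" "A * B = 1\<^sub>m c"
  shows "inj_mat B"
  unfolding inj_mat_def
proof (intro ballI impI)
  fix v assume v: "v \<in> carrier_vec (dim_col B)" "B *\<^sub>v v = 0\<^sub>v (dim_row B)"
  then have "A * B *\<^sub>v v = A *\<^sub>v 0\<^sub>v d"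
    using assms(1,2) assoc_mult_mat_vec[of A c d B c v] by auto
  also have "\<dots> = 0\<^sub>v c" using assms by (intro eq_vecI) auto
  finally show "v = 0\<^sub>v (dim_col B)" using v assms by simp
qed

lemma mat_eqI_mult_vec:
  fixes A :: "complex mat"
  assumes "A \<in> carrier_mat d k" "B \<in> carrier_mat d k" "\<And>v. v \<in> carrier_vec k \<Longrightarrow> A *\<^sub>v v = B *\<^sub>v v"
  shows "A = B"
proof (intro eq_matI)
  fix i j assume ij: "i < dim_row B" "j < dim_col B"
  have "(A *\<^sub>v unit_vec k j) $ i = (B *\<^sub>v unit_vec k j) $ i" using assms(3) by simp
  then show "A $$ (i,j) = B $$ (i,j)" using assms(1,2) ij by simp
qed (use assms in auto)

lemma inj_mat_cancel:
  assumes "inj_mat V" "V \<in> carrier_mat d k" "X \<in> carrier_mat k m" "Y \<in> carrier_mat k m" "V * X = V * Y"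
  shows "X = Y"
proof (rule mat_eqI_mult_vec[OF assms(3,4)])
  fix v :: "complex vec" assume v: "v \<in> carrier_vec m"
  have "V *\<^sub>v (X *\<^sub>v v) = V *\<^sub>v (Y *\<^sub>v v)"
    using assoc_mult_mat_vec[OF assms(2,3) v] assoc_mult_mat_vec[OF assms(2,4) v] assms(5) by simp
  then have "V *\<^sub>v (X *\<^sub>v v - Y *\<^sub>v v) = 0\<^sub>v d"
    using assms(2-4) v mult_minus_distrib_mat_vec[OF assms(2), of "X *\<^sub>v v" "Y *\<^sub>v v"]
    by (simp add: minus_cancel_vec[of _ d])
  then have "X *\<^sub>v v - Y *\<^sub>v v = 0\<^sub>v k" using assms v by (intro inj_matD[OF assms(1,2)]) auto
  then have eq: "(X *\<^sub>v v - Y *\<^sub>v v) $ i = 0" if "i < k" for i using that by simp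
  show "X *\<^sub>v v = Y *\<^sub>v v"
  proof (rule eq_vecI)
    fix i assume "i < dim_vec (Y *\<^sub>v v)"
    then show "(X *\<^sub>v v) $ i = (Y *\<^sub>v v) $ i" using eq[of i] assms v by auto
  qed (use assms in auto)
qed

lemma square_inj_mat_inverse:
  assumes "inj_mat B" "B \<in> carrier_mat k k"
  shows "\<exists>C \<in> carrier_mat k k. B * C = 1\<^sub>m k \<and> C * B = 1\<^sub>m k"
proof -
  have "det B \<noteq> 0" using det_0_iff_vec_prod_zero[OF assms(2)] inj_matD[OF assms] by blast
  from det_non_zero_imp_unit[OF assms(2) this] show ?thesis
    unfolding Units_def ring_mat_def by auto
qed

text \<open>Takes an injective matrix with range in \<open>W\<close> and as many columns as
  possible, a number bounded by \<open>d\<close>. A vector of \<open>W\<close> outside its range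
  could be appended as a further column.\<close>

lemma subspace_vec_basis:
  assumes W: "subspace_vec d W"
  shows "\<exists>j B. B \<in> carrier_mat d j \<and> inj_mat B \<and> (\<forall>v\<in>carrier_vec j. B *\<^sub>v v \<in> W)
              \<and> (\<forall>w\<in>W. \<exists>v\<in>carrier_vec j. B *\<^sub>v v = w)"
proof -
  define P where "P = (\<lambda>j. \<exists>B. B \<in> carrier_mat d j \<and> inj_mat B \<and> (\<forall>v\<in>carrier_vec j. B *\<^sub>v v \<in> W))"
  have sub: "W \<subseteq> carrier_vec d" "0\<^sub>v d \<in> W" "\<And>v w. v \<in> W \<Longrightarrow> w \<in> W \<Longrightarrow> v + w \<in> W"
    "\<And>c v. v \<in> W \<Longrightarrow> c \<cdot>\<^sub>v v \<in> W"
    using W by (auto simp: subspace_vec_def)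
  have "(0\<^sub>m d 0 :: complex mat) *\<^sub>v v = 0\<^sub>v d" if "v \<in> carrier_vec 0" for v
    using that by (intro eq_vecI) (auto simp: scalar_prod_def)
  moreover have "inj_mat (0\<^sub>m d 0)" by (auto simp: inj_mat_def)
  ultimately have P0: "P 0" unfolding P_def using sub(2) by (intro exI[of _ "0\<^sub>m d 0"]) auto
  have bd: "\<forall>j. P j \<longrightarrow> j \<le> d" using inj_mat_dim_le by (auto simp: P_def)
  obtain j where j: "P j" "\<And>k. P k \<Longrightarrow> k \<le> j"
    using ex_has_greatest_nat[of P 0 "\<lambda>x. x" "Suc d"] P0 bd by (auto simp: less_Suc_eq_le)
  then obtain B where B: "B \<in> carrier_mat d j" "inj_mat B" "\<And>v. v \<in> carrier_vec j \<Longrightarrow> B *\<^sub>v v \<in> W"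
    by (auto simp: P_def)
  have "\<exists>v\<in>carrier_vec j. B *\<^sub>v v = w" if w: "w \<in> W" for w
  proof (rule ccontr)
    assume not: "\<not> ?thesis"
    have wd: "w \<in> carrier_vec d" using w sub by auto
    define B' where "B' = mat d (Suc j) (\<lambda>(i,k). if k < j then B $$ (i,k) else w $ i)"
    have B': "B' \<in> carrier_mat d (Suc j)" by (simp add: B'_def)
    have eq: "B' *\<^sub>v v = B *\<^sub>v vec j (\<lambda>k. v $ k) + (v $ j) \<cdot>\<^sub>v w" if "v \<in> carrier_vec (Suc j)" for v
      using that B(1) wd
      by (intro eq_vecI) (auto simp: B'_def scalar_prod_def intro!: sum.cong)
    have "inj_mat B'" unfolding inj_mat_def
    proof (intro ballI impI)
      fix v assume "v \<in> carrier_vec (dim_col B')" and v0: "B' *\<^sub>v v = 0\<^sub>v (dim_row B')"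
      then have v: "v \<in> carrier_vec (Suc j)" using B' by simp
      let ?v = "vec j (\<lambda>k. v $ k)"
      have z: "B *\<^sub>v ?v + (v $ j) \<cdot>\<^sub>v w = 0\<^sub>v d" using eq[OF v] v0 B' by simp
      have vj: "v $ j = 0"
      proof (rule ccontr)
        assume nz: "v $ j \<noteq> 0"
        \<comment> \<open>A dependency with nonzero last coefficient can be solved for
          \<open>w\<close>, putting it in the range of \<open>B\<close> after all.\<close>
        have "B *\<^sub>v ((- 1 / v $ j) \<cdot>\<^sub>v ?v) = w"
        proof (rule eq_vecI)
          fix i assume i: "i < dim_vec w"
          have "(B *\<^sub>v ?v + (v $ j) \<cdot>\<^sub>v w) $ i = 0" using z i wd by simp
          then have "(B *\<^sub>v ?v) $ i = - (v $ j * w $ i)" using i wd B(1) by (simp add: eq_neg_iff_add_eq_0)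
          moreover have "B *\<^sub>v ((- 1 / v $ j) \<cdot>\<^sub>v ?v) = (- 1 / v $ j) \<cdot>\<^sub>v (B *\<^sub>v ?v)"
            using B(1) by (intro mult_mat_vec[of _ d j]) auto
          ultimately show "(B *\<^sub>v ((- 1 / v $ j) \<cdot>\<^sub>v ?v)) $ i = w $ i" using nz i wd B(1) by simp
        qed (use B wd in auto)
        then show False using not by (metis smult_carrier_vec vec_carrier)
      qed
      then have "(v $ j) \<cdot>\<^sub>v w = 0\<^sub>v d" using wd by (intro eq_vecI) auto
      then have "B *\<^sub>v ?v = 0\<^sub>v d" using z B(1) right_zero_vec[of "B *\<^sub>v ?v" d] by auto
      then have v0: "?v = 0\<^sub>v j" by (intro inj_matD[OF B(2,1)]) auto
      have "v $ k = 0" if "k < j" for k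
      proof -
        have "?v $ k = 0" unfolding v0 using that by simp
        then show ?thesis using that by simp
      qed
      then have "v $ k = 0" if "k < Suc j" for k using that vj by (cases "k = j") auto
      then show "v = 0\<^sub>v (dim_col B')" using v B' by (intro eq_vecI) auto
    qed
    moreover have "B' *\<^sub>v v \<in> W" if "v \<in> carrier_vec (Suc j)" for v
      unfolding eq[OF that] using sub B(3) w by auto
    ultimately have "P (Suc j)" using B' by (auto simp: P_def)
    then show False using j(2) by fastforce
  qed
  then show ?thesis using B by blast
qed

text \<open>Gives the restriction of an operator to an invariant subspace: with
  \<open>C = rho I * B\<close>, the factor \<open>X\<close> is the restricted operator in the
  coordinates given by \<open>B\<close>.\<close>

lemma factor_through_columns:
  fixes B :: "complex mat"
  assumes "B \<in> carrier_mat d j" "C \<in> carrier_mat d m"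
    and "\<And>v. v \<in> carrier_vec m \<Longrightarrow> \<exists>w\<in>carrier_vec j. B *\<^sub>v w = C *\<^sub>v v"
  shows "\<exists>X\<in>carrier_mat j m. C = B * X"
proof -
  have "\<exists>w\<in>carrier_vec j. B *\<^sub>v w = col C k" if "k < m" for k
  proof -
    have "C *\<^sub>v unit_vec m k = col C k" using assms(2) that by (intro eq_vecI) auto
    then show ?thesis using assms(3)[of "unit_vec m k"] by simp
  qed
  then obtain f where f: "\<And>k. k < m \<Longrightarrow> f k \<in> carrier_vec j \<and> B *\<^sub>v f k = col C k" by metis
  let ?X = "mat j m (\<lambda>(i,k). f k $ i)"
  have "C = B * ?X"
  proof (intro eq_matI)
    fix i k assume "i < dim_row (B * ?X)" "k < dim_col (B * ?X)"
    then have ik: "i < d" "k < m" using assms by auto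
    have "col ?X k = f k" using f[OF ik(2)] ik by (intro eq_vecI) auto
    then have "(B * ?X) $$ (i,k) = (B *\<^sub>v f k) $ i" using ik assms by simp
    also have "\<dots> = C $$ (i,k)" using f ik assms by simp
    finally show "C $$ (i,k) = (B * ?X) $$ (i,k)" by simp
  qed (use assms in auto)
  then show ?thesis by (intro bexI[of _ ?X]) auto
qed

section \<open>Representations in coordinates and their intertwiners\<close>

definition basisA :: "nat \<Rightarrow> nat \<Rightarrow> complex" where
  "basisA I = (\<lambda>J. if J = I then 1 else 0)"

lemma inA_basisA[simp]: "I < n \<Longrightarrow> inA n (basisA I)"
  by (auto simp: inA_def basisA_def)

lemma inA_starA[simp]: "inA n (starA n st x)"
  by (auto simp: inA_def starA_def)

lemma repA_mat_sum:
  "is_rep_map n d rho \<Longrightarrow> repA n d rho x = mat_sum d d (\<lambda>I. x I \<cdot>\<^sub>m rho I) {..<n}"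
  unfolding repA_def is_rep_map_def by (intro msum_eq_mat_sum) auto

lemma repA_carrier[simp]: "is_rep_map n d rho \<Longrightarrow> repA n d rho x \<in> carrier_mat d d"
  by (simp add: repA_mat_sum)

lemma repA_basisA:
  assumes "is_rep_map n d rho" "I < n"
  shows "repA n d rho (basisA I) = rho I"
proof -
  have "rho I \<in> carrier_mat d d" and c: "\<And>J. J < n \<Longrightarrow> rho J \<in> carrier_mat d d"
    using assms by (auto simp: is_rep_map_def)
  then have "mat_sum d d (\<lambda>J. basisA I J \<cdot>\<^sub>m rho J) {..<n} = basisA I I \<cdot>\<^sub>m rho I"
    using assms(2) by (intro mat_sum_single) (auto simp: basisA_def intro!: eq_matI dest!: c)
  also have "\<dots> = rho I" by (intro eq_matI) (auto simp: basisA_def)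
  finally show ?thesis using assms by (simp add: repA_mat_sum)
qed

definition intertwiner :: "nat \<Rightarrow> nat \<Rightarrow> (nat \<Rightarrow> complex mat) \<Rightarrow> nat \<Rightarrow> (nat \<Rightarrow> complex mat) \<Rightarrow> complex mat \<Rightarrow> bool" where
  "intertwiner n d rho d' sigma T \<longleftrightarrow> T \<in> carrier_mat d' d \<and> (\<forall>I<n. T * rho I = sigma I * T)"

lemma intertwiner_repA:
  assumes "intertwiner n d rho d' sigma T" "is_rep_map n d rho" "is_rep_map n d' sigma"
  shows "T * repA n d rho x = repA n d' sigma x * T"
proof -
  have T: "T \<in> carrier_mat d' d" and eq: "\<And>I. I < n \<Longrightarrow> T * rho I = sigma I * T"
    using assms(1) by (auto simp: intertwiner_def)
  have c: "\<And>I. I < n \<Longrightarrow> rho I \<in> carrier_mat d d" "\<And>I. I < n \<Longrightarrow> sigma I \<in> carrier_mat d' d'"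
    using assms by (auto simp: is_rep_map_def)
  have "T * repA n d rho x = mat_sum d' d (\<lambda>I. T * (x I \<cdot>\<^sub>m rho I)) {..<n}"
    unfolding repA_mat_sum[OF assms(2)] using T c by (intro mat_sum_mult_left) auto
  also have "\<dots> = mat_sum d' d (\<lambda>I. (x I \<cdot>\<^sub>m sigma I) * T) {..<n}"
  proof (rule mat_sum_cong[OF refl])
    fix I assume "I \<in> {..<n}"
    then have I: "I < n" by simp
    show "T * (x I \<cdot>\<^sub>m rho I) = x I \<cdot>\<^sub>m sigma I * T"
      using mult_smult_distrib[OF T c(1)[OF I]] mult_smult_assoc_mat[OF c(2)[OF I] T] eq[OF I] by simp
  qed
  also have "\<dots> = repA n d' sigma x * T"
    unfolding repA_mat_sum[OF assms(3)] using T c by (intro mat_sum_mult_right[symmetric]) auto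
  finally show ?thesis .
qed

lemma intertwiner_mult:
  assumes "intertwiner n d rho d' sigma T" "intertwiner n d' sigma d'' tau S"
    "is_rep_map n d rho" "is_rep_map n d' sigma" "is_rep_map n d'' tau"
  shows "intertwiner n d rho d'' tau (S * T)"
proof -
  have c: "\<And>I. I < n \<Longrightarrow> rho I \<in> carrier_mat d d" "\<And>I. I < n \<Longrightarrow> sigma I \<in> carrier_mat d' d'"
     "\<And>I. I < n \<Longrightarrow> tau I \<in> carrier_mat d'' d''" "T \<in> carrier_mat d' d" "S \<in> carrier_mat d'' d'"
    using assms by (auto simp: is_rep_map_def intertwiner_def)
  have "S * T * rho I = tau I * (S * T)" if "I < n" for I
  proof -
    have "S * T * rho I = S * (T * rho I)" using c that by (simp add: assoc_mult_mat[of _ d'' d' _ d _ d])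
    also have "\<dots> = S * (sigma I * T)" using assms that by (simp add: intertwiner_def)
    also have "\<dots> = S * sigma I * T" using c that by (intro assoc_mult_mat[symmetric]) auto
    also have "\<dots> = tau I * S * T" using assms that by (simp add: intertwiner_def)
    also have "\<dots> = tau I * (S * T)" using c that by (intro assoc_mult_mat) auto
    finally show ?thesis .
  qed
  then show ?thesis using c by (simp add: intertwiner_def)
qed

lemma intertwiner_smult:
  assumes "intertwiner n d rho d' sigma T" "is_rep_map n d rho" "is_rep_map n d' sigma"
  shows "intertwiner n d rho d' sigma (x \<cdot>\<^sub>m T)"
  using assms mult_smult_distrib[of _ d' d' T d x] mult_smult_assoc_mat[of T d' d _ d x]
  by (auto simp: intertwiner_def is_rep_map_def)

text \<open>The kernel of an intertwiner is invariant under \<open>rho\<close>, hence zero or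
  everything, and the latter would make \<open>T\<close> vanish.\<close>

lemma intertwiner_irreducible_inj:
  assumes irr: "irreducible_repA n mu u d rho" and sigma: "is_rep_map n d' sigma"
    and T: "intertwiner n d rho d' sigma T" and nz: "T \<noteq> 0\<^sub>m d' d"
  shows "inj_mat T"
proof -
  have Tc: "T \<in> carrier_mat d' d" and eq: "\<And>I. I < n \<Longrightarrow> T * rho I = sigma I * T"
    using T by (auto simp: intertwiner_def)
  have c: "\<And>I. I < n \<Longrightarrow> rho I \<in> carrier_mat d d" "\<And>I. I < n \<Longrightarrow> sigma I \<in> carrier_mat d' d'"
    using irr sigma by (auto simp: is_rep_map_def irreducible_repA_def is_repA_def)
  define W where "W = {v \<in> carrier_vec d. T *\<^sub>v v = 0\<^sub>v d'}"
  have sub: "subspace_vec d W"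
    using Tc by (auto simp: subspace_vec_def W_def mult_add_distrib_mat_vec[of _ d' d] mult_mat_vec[of _ d' d])
  have inv: "\<forall>I<n. \<forall>w\<in>W. rho I *\<^sub>v w \<in> W"
  proof (intro allI impI ballI)
    fix I w assume I: "I < n" and w: "w \<in> W"
    have "T *\<^sub>v (rho I *\<^sub>v w) = (T * rho I) *\<^sub>v w" using I w Tc c by (auto simp: W_def assoc_mult_mat_vec[of _ d' d _ d])
    also have "\<dots> = sigma I *\<^sub>v (T *\<^sub>v w)" using I w Tc c eq by (auto simp: W_def assoc_mult_mat_vec[of _ d' d' _ d])
    also have "\<dots> = 0\<^sub>v d'" using c(2)[OF I] w by (auto simp: W_def)
    finally show "rho I *\<^sub>v w \<in> W" using c(1)[OF I] w by (auto simp: W_def)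
  qed
  have "W = {0\<^sub>v d} \<or> W = carrier_vec d" using irr sub inv unfolding irreducible_repA_def by blast
  moreover have "W \<noteq> carrier_vec d"
  proof
    assume *: "W = carrier_vec d"
    have "T *\<^sub>v v = 0\<^sub>m d' d *\<^sub>v v" if v: "v \<in> carrier_vec d" for v
    proof -
      have "v \<in> W" using * v by simp
      then have "T *\<^sub>v v = 0\<^sub>v d'" by (simp add: W_def)
      moreover have "0\<^sub>m d' d *\<^sub>v v = 0\<^sub>v d'" using v by (intro eq_vecI) auto
      ultimately show ?thesis by simp
    qed
    then have "T = 0\<^sub>m d' d" using Tc by (intro mat_eqI_mult_vec[of _ d' d]) auto
    then show False using nz by simp
  qed
  ultimately have "W = {0\<^sub>v d}" by blast
  then show ?thesis using Tc unfolding inj_mat_def W_def by auto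
qed

text \<open>The scalar is the squared norm of a nonzero column of \<open>T\<close>. It is used to
  rescale an intertwiner to an isometry.\<close>

lemma adj_mult_self_scalar_pos:
  assumes "T \<in> carrier_mat d k" "adj T * T = x \<cdot>\<^sub>m 1\<^sub>m k" "T \<noteq> 0\<^sub>m d k"
  shows "\<exists>y>0. x = complex_of_real y"
proof -
  obtain i j where ij: "i < d" "j < k" "T $$ (i,j) \<noteq> 0"
    using assms(1,3) by (auto simp: mat_eq_iff)
  have "x = (adj T * T) $$ (j,j)" using assms ij by simp
  also have "\<dots> = (\<Sum>l<d. cnj (T $$ (l,j)) * T $$ (l,j))"
    using assms(1) ij by (auto simp: scalar_prod_def atLeast0LessThan)
  also have "\<dots> = complex_of_real (\<Sum>l<d. (norm (T $$ (l,j)))\<^sup>2)"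
    by (simp add: mult.commute flip: complex_norm_square)
  finally have "x = complex_of_real (\<Sum>l<d. (norm (T $$ (l,j)))\<^sup>2)" .
  moreover have "(\<Sum>l<d. (norm (T $$ (l,j)))\<^sup>2) > 0" using ij by (intro sum_pos2[of _ i]) auto
  ultimately show ?thesis by blast
qed

section \<open>Schur's lemma for the irreducible *-representations\<close>

locale star_irreps =
  fixes n :: nat and mu :: "nat \<Rightarrow> nat \<Rightarrow> nat \<Rightarrow> complex" and u :: "nat \<Rightarrow> complex"
    and Lam :: "nat \<Rightarrow> nat \<Rightarrow> nat \<Rightarrow> complex" and st :: "nat \<Rightarrow> nat \<Rightarrow> complex"
    and r :: nat and dims :: "nat \<Rightarrow> nat" and phi :: "nat \<Rightarrow> nat \<Rightarrow> complex mat"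
  assumes alg: "C_star_pre_bialgebra n mu u Lam st"
    and irr: "complete_irreps n mu u st r dims phi"
begin

lemma inA_u: "inA n u"
  and unit: "inA n x \<Longrightarrow> mulA n mu u x = x" "inA n x \<Longrightarrow> mulA n mu x u = x"
  and star_star: "inA n x \<Longrightarrow> starA n st (starA n st x) = x"
  using alg unfolding C_star_pre_bialgebra_def by blast+

lemma phi_irr: "a < r \<Longrightarrow> irreducible_repA n mu u (dims a) (phi a)"
  and phi_star: "a < r \<Longrightarrow> star_repA n st (dims a) (phi a)"
  and phi_ineq: "a < r \<Longrightarrow> b < r \<Longrightarrow> equiv_rep n (dims a) (phi a) (dims b) (phi b) \<Longrightarrow> a = b"
  and phi_complete: "irreducible_repA n mu u d rho \<Longrightarrow> \<exists>a<r. equiv_rep n d rho (dims a) (phi a)"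
  using irr unfolding complete_irreps_def by blast+

lemma phi_rep_map: "a < r \<Longrightarrow> is_rep_map n (dims a) (phi a)"
  using phi_irr unfolding irreducible_repA_def is_repA_def by blast

lemma phi_carrier: "a < r \<Longrightarrow> I < n \<Longrightarrow> phi a I \<in> carrier_mat (dims a) (dims a)"
  using phi_rep_map by (auto simp: is_rep_map_def)

lemma dims_pos: "a < r \<Longrightarrow> dims a > 0"
  using phi_irr unfolding irreducible_repA_def by blast

lemma phi_unit: "a < r \<Longrightarrow> repA n (dims a) (phi a) u = 1\<^sub>m (dims a)"
  using phi_irr unfolding irreducible_repA_def is_repA_def by blast

text \<open>Every basis element is the star of some \<open>y\<close>. Taking adjoints in the
  intertwining relation for \<open>y\<close> gives the relation for the basis element, with the two
  representations exchanged.\<close>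

lemma intertwiner_adj:
  assumes T: "intertwiner n d rho d' sigma T"
    and rep: "is_rep_map n d rho" "is_rep_map n d' sigma"
    and star: "star_repA n st d rho" "star_repA n st d' sigma"
  shows "intertwiner n d' sigma d rho (adj T)"
proof -
  have Tc: "T \<in> carrier_mat d' d" using T by (simp add: intertwiner_def)
  have "adj T * sigma I = rho I * adj T" if I: "I < n" for I
  proof -
    define y where "y = starA n st (basisA I)"
    have y: "inA n y" "starA n st y = basisA I" using I star_star by (simp_all add: y_def)
    have s: "sigma I = adj (repA n d' sigma y)" "rho I = adj (repA n d rho y)"
      using star[unfolded star_repA_def, rule_format, OF y(1)] repA_basisA[OF _ I] rep
      unfolding y(2) by auto
    have "adj T * sigma I = adj (repA n d' sigma y * T)"
      unfolding s using Tc rep by (intro adj_mult[symmetric, of _ d' d' _ d]) auto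
    also have "\<dots> = adj (T * repA n d rho y)" using intertwiner_repA[OF T rep] by simp
    also have "\<dots> = rho I * adj T" unfolding s using Tc rep by (intro adj_mult[of _ d' d _ d]) auto
    finally show ?thesis .
  qed
  then show ?thesis using Tc by (simp add: intertwiner_def)
qed

text \<open>Both \<open>X\<close> and its adjoint are injective by irreducibility, so the dimensions
  agree, \<open>X\<close> is invertible and the two representations are equivalent.\<close>

lemma schur_nonzero:
  assumes a: "a < r" and b: "b < r"
    and X: "intertwiner n (dims a) (phi a) (dims b) (phi b) X" and nz: "X \<noteq> 0\<^sub>m (dims b) (dims a)"
  shows "a = b"
proof -
  have Xc: "X \<in> carrier_mat (dims b) (dims a)" using X by (simp add: intertwiner_def)
  have X': "intertwiner n (dims b) (phi b) (dims a) (phi a) (adj X)"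
    using X a b by (intro intertwiner_adj phi_rep_map phi_star)
  have nz': "adj X \<noteq> 0\<^sub>m (dims a) (dims b)" using nz adj_adj[of X] adj_zero by metis
  have i: "inj_mat X" using intertwiner_irreducible_inj[OF phi_irr[OF a] phi_rep_map[OF b] X nz] .
  have "inj_mat (adj X)" using intertwiner_irreducible_inj[OF phi_irr[OF b] phi_rep_map[OF a] X' nz'] .
  then have "dims b \<le> dims a" using inj_mat_dim_le Xc adj_carrier by blast
  moreover have "dims a \<le> dims b" using inj_mat_dim_le i Xc by blast
  ultimately have d: "dims a = dims b" by simp
  obtain C where "C \<in> carrier_mat (dims b) (dims b)" "X * C = 1\<^sub>m (dims b)" "C * X = 1\<^sub>m (dims b)"
    using square_inj_mat_inverse[OF i] Xc d by auto
  then have "invertible_mat X" using Xc d unfolding invertible_mat_def inverts_mat_def by auto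
  then have "equiv_rep n (dims a) (phi a) (dims b) (phi b)"
    using X Xc d unfolding equiv_rep_def intertwiner_def by auto
  then show ?thesis using phi_ineq a b by blast
qed

text \<open>Subtracting an eigenvalue leaves an intertwiner that is not injective and therefore
  zero.\<close>

lemma schur_scalar:
  assumes a: "a < r" and X: "intertwiner n (dims a) (phi a) (dims a) (phi a) X"
  shows "\<exists>x. X = x \<cdot>\<^sub>m 1\<^sub>m (dims a)"
proof -
  let ?d = "dims a"
  have Xc: "X \<in> carrier_mat ?d ?d" using X by (simp add: intertwiner_def)
  obtain x where "eigenvalue X x" using spectrum_non_empty[OF Xc] dims_pos[OF a] by (auto simp: spectrum_def)
  then obtain v where v: "v \<in> carrier_vec ?d" "v \<noteq> 0\<^sub>v ?d" "X *\<^sub>v v = x \<cdot>\<^sub>v v"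
    using Xc by (auto simp: eigenvalue_def eigenvector_def)
  define Y where "Y = X - x \<cdot>\<^sub>m 1\<^sub>m ?d"
  have Yc: "Y \<in> carrier_mat ?d ?d" using Xc by (auto simp: Y_def)
  have "Y * phi a I = phi a I * Y" if "I < n" for I
  proof -
    note p = phi_carrier[OF a that]
    have "Y * phi a I = X * phi a I - x \<cdot>\<^sub>m phi a I" unfolding Y_def
      using Xc p by (simp add: minus_mult_distrib_mat[of _ ?d ?d] mult_smult_assoc_mat[of _ ?d ?d])
    also have "\<dots> = phi a I * Y" unfolding Y_def
      using Xc p X that mult_smult_distrib[OF p, of "1\<^sub>m ?d" ?d x]
      by (simp add: intertwiner_def mult_minus_distrib_mat[of _ ?d ?d])
    finally show ?thesis .
  qed
  then have Y: "intertwiner n ?d (phi a) ?d (phi a) Y" using Yc by (simp add: intertwiner_def)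
  have "Y *\<^sub>v v = X *\<^sub>v v - (x \<cdot>\<^sub>m 1\<^sub>m ?d) *\<^sub>v v" unfolding Y_def
    using v Xc by (intro minus_mult_distrib_mat_vec) auto
  also have "(x \<cdot>\<^sub>m 1\<^sub>m ?d) *\<^sub>v v = x \<cdot>\<^sub>v v"
    using v(1) by (intro eq_vecI) (auto simp: smult_scalar_prod_distrib[of _ ?d])
  also have "X *\<^sub>v v - x \<cdot>\<^sub>v v = 0\<^sub>v ?d" unfolding v(3) using v(1) by simp
  finally have "Y *\<^sub>v v = 0\<^sub>v ?d" .
  then have "\<not> inj_mat Y" using v Yc inj_matD by blast
  then have "Y = 0\<^sub>m ?d ?d"
    using intertwiner_irreducible_inj[OF phi_irr[OF a] phi_rep_map[OF a] Y] by blast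
  then have eq: "Y $$ (i,j) = 0" if "i < ?d" "j < ?d" for i j using that by simp
  have "X = x \<cdot>\<^sub>m 1\<^sub>m ?d"
  proof (intro eq_matI)
    fix i j assume "i < dim_row (x \<cdot>\<^sub>m 1\<^sub>m ?d)" "j < dim_col (x \<cdot>\<^sub>m 1\<^sub>m ?d)"
    then show "X $$ (i,j) = (x \<cdot>\<^sub>m 1\<^sub>m ?d) $$ (i,j)" using eq[of i j] Xc by (simp add: Y_def)
  qed (use Xc in auto)
  then show ?thesis by blast
qed

section \<open>Orthonormal families of intertwiners\<close>

text \<open>Deliberately silent about the image of \<open>u\<close>: the coproduct need not be
  unital, so for a tensor product \<open>repA n d rho u\<close> is a projection that may differ from
  the identity.\<close>

definition star_rep :: "nat \<Rightarrow> (nat \<Rightarrow> complex mat) \<Rightarrow> bool" where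
  "star_rep d rho \<longleftrightarrow> is_rep_map n d rho \<and> star_repA n st d rho
     \<and> (\<forall>x y. inA n x \<and> inA n y \<longrightarrow> repA n d rho (mulA n mu x y) = repA n d rho x * repA n d rho y)"

lemma phi_star_rep: "a < r \<Longrightarrow> star_rep (dims a) (phi a)"
  using phi_irr[of a] phi_star[of a] unfolding star_rep_def irreducible_repA_def is_repA_def by simp

lemma rep_unit_mult:
  assumes "star_rep d rho" "I < n"
  shows "repA n d rho u * rho I = rho I" "rho I * repA n d rho u = rho I"
proof -
  have rep: "is_rep_map n d rho"
    and m: "\<And>x y. inA n x \<Longrightarrow> inA n y \<Longrightarrow> repA n d rho (mulA n mu x y) = repA n d rho x * repA n d rho y"
    using assms by (auto simp: star_rep_def)
  show "repA n d rho u * rho I = rho I" "rho I * repA n d rho u = rho I"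
    using m[of u "basisA I"] m[of "basisA I" u] repA_basisA[OF rep assms(2)] unit[of "basisA I"] inA_u assms(2)
    by auto
qed

text \<open>Inside the range of the idempotent \<open>E\<close> an invariant subspace of least
  positive dimension carries an irreducible representation. Completeness of the list identifies it
  with some \<open>phi c\<close>. The condition \<open>repA n d rho u * E = E\<close> keeps the
  range of \<open>E\<close> within the support, where the restriction is unital.\<close>

lemma nonzero_intertwiner_exists:
  assumes rho: "star_rep d rho"
    and E: "E \<in> carrier_mat d d" "E \<noteq> 0\<^sub>m d d" "E * E = E" "\<And>I. I < n \<Longrightarrow> E * rho I = rho I * E"
      "repA n d rho u * E = E"
  shows "\<exists>c<r. \<exists>T. intertwiner n (dims c) (phi c) d rho T \<and> T \<noteq> 0\<^sub>m d (dims c) \<and> E * T = T"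
proof -
  have rep: "is_rep_map n d rho"
    and m: "\<And>x y. inA n x \<Longrightarrow> inA n y \<Longrightarrow> repA n d rho (mulA n mu x y) = repA n d rho x * repA n d rho y"
    using rho by (auto simp: star_rep_def)
  have rc: "\<And>I. I < n \<Longrightarrow> rho I \<in> carrier_mat d d" using rep by (auto simp: is_rep_map_def)
  \<comment> \<open>Dimensions of the nonzero invariant subspaces of the range of \<open>E\<close>,
    each given by an injective \<open>V\<close> together with the restricted operators
    \<open>sigma\<close>.\<close>
  define Q where "Q = (\<lambda>k. k > 0 \<and> (\<exists>V sigma. V \<in> carrier_mat d k \<and> inj_mat V \<and> E * V = V
      \<and> is_rep_map n k sigma \<and> intertwiner n k sigma d rho V))"
  have "\<exists>k. Q k"
  proof -
    define W where "W = {v \<in> carrier_vec d. E *\<^sub>v v = v}"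
    have "subspace_vec d W"
      using E(1) by (auto simp: subspace_vec_def W_def mult_add_distrib_mat_vec[of _ d d] mult_mat_vec[of _ d d])
    then obtain k B where B: "B \<in> carrier_mat d k" "inj_mat B" "\<And>v. v \<in> carrier_vec k \<Longrightarrow> B *\<^sub>v v \<in> W"
       "\<And>w. w \<in> W \<Longrightarrow> \<exists>v\<in>carrier_vec k. B *\<^sub>v v = w"
      using subspace_vec_basis by metis
    have EB: "E * B = B"
    proof (rule mat_eqI_mult_vec[of _ d k])
      fix v :: "complex vec" assume v: "v \<in> carrier_vec k"
      show "E * B *\<^sub>v v = B *\<^sub>v v" using B(3)[OF v] assoc_mult_mat_vec[OF E(1) B(1) v] by (simp add: W_def)
    qed (use E B in auto)
    have "k > 0"
    proof (rule ccontr)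
      assume "\<not> k > 0"
      then have k: "k = 0" by simp
      have "E *\<^sub>v v = 0\<^sub>m d d *\<^sub>v v" if v: "v \<in> carrier_vec d" for v
      proof -
        have "E *\<^sub>v v \<in> W" using assoc_mult_mat_vec[OF E(1) E(1) v] E(1,3) v by (simp add: W_def)
        then obtain w where w: "w \<in> carrier_vec 0" "B *\<^sub>v w = E *\<^sub>v v" using B(4) k by auto
        have "B *\<^sub>v w = 0\<^sub>v d" using w(1) B(1) k by (intro eq_vecI) (auto simp: scalar_prod_def)
        moreover have "0\<^sub>m d d *\<^sub>v v = 0\<^sub>v d" using v by (intro eq_vecI) auto
        ultimately show ?thesis using w by simp
      qed
      then have "E = 0\<^sub>m d d" using E by (intro mat_eqI_mult_vec[of _ d d]) auto
      then show False using E by simp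
    qed
    have "\<exists>X\<in>carrier_mat k k. rho I * B = B * X" if I: "I < n" for I
    proof (rule factor_through_columns[OF B(1)])
      fix v :: "complex vec" assume v: "v \<in> carrier_vec k"
      have "E * (rho I * B) = E * rho I * B" using E(1) rc[OF I] B(1) by simp
      also have "\<dots> = rho I * E * B" using E(4)[OF I] by simp
      also have "\<dots> = rho I * (E * B)" using E(1) rc[OF I] B(1) by (intro assoc_mult_mat) auto
      finally have "E * (rho I * B) = rho I * B" using EB by simp
      then have "E *\<^sub>v (rho I * B *\<^sub>v v) = rho I * B *\<^sub>v v"
        using assoc_mult_mat_vec[OF E(1), of "rho I * B" k v] rc[OF I] B(1) v by simp
      then show "\<exists>w\<in>carrier_vec k. B *\<^sub>v w = rho I * B *\<^sub>v v"
        using rc[OF I] B(1) v by (intro B(4)) (auto simp: W_def)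
    qed (use rc[OF I] B in auto)
    then obtain sigma where "\<And>I. I < n \<Longrightarrow> sigma I \<in> carrier_mat k k \<and> rho I * B = B * sigma I" by metis
    then have "Q k" unfolding Q_def using \<open>k > 0\<close> B EB
      by (auto simp: is_rep_map_def intertwiner_def intro!: exI[of _ B] exI[of _ sigma])
    then show ?thesis ..
  qed
  \<comment> \<open>Minimality of \<open>k\<close> is what will give irreducibility.\<close>
  define k where "k = (LEAST k. Q k)"
  have "Q k" and min: "\<And>j. Q j \<Longrightarrow> k \<le> j"
    using \<open>\<exists>k. Q k\<close> unfolding k_def by (auto intro: LeastI Least_le)
  then obtain V sigma where k: "k > 0" and V: "V \<in> carrier_mat d k" "inj_mat V" "E * V = V"
    and sr: "is_rep_map n k sigma" and VI: "intertwiner n k sigma d rho V"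
    by (auto simp: Q_def)
  have sc: "\<And>I. I < n \<Longrightarrow> sigma I \<in> carrier_mat k k" using sr by (auto simp: is_rep_map_def)
  have rx: "repA n d rho x \<in> carrier_mat d d" and sx: "repA n k sigma x \<in> carrier_mat k k" for x
    using rep sr by auto
  have Vx: "V * repA n k sigma x = repA n d rho x * V" for x by (rule intertwiner_repA[OF VI sr rep])
  have "is_repA n mu u k sigma" unfolding is_repA_def
  proof (intro conjI sr allI impI)
    fix x y assume xy: "inA n x \<and> inA n y"
    have "V * repA n k sigma (mulA n mu x y) = repA n d rho x * repA n d rho y * V"
      using m xy Vx by simp
    also have "\<dots> = repA n d rho x * (repA n d rho y * V)" by (rule assoc_mult_mat[OF rx rx V(1)])
    also have "\<dots> = repA n d rho x * (V * repA n k sigma y)" using Vx by simp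
    also have "\<dots> = (repA n d rho x * V) * repA n k sigma y"
      by (rule assoc_mult_mat[OF rx V(1) sx, symmetric])
    also have "\<dots> = V * repA n k sigma x * repA n k sigma y" using Vx by simp
    also have "\<dots> = V * (repA n k sigma x * repA n k sigma y)"
      by (rule assoc_mult_mat[OF V(1) sx sx])
    finally show "repA n k sigma (mulA n mu x y) = repA n k sigma x * repA n k sigma y"
      by (rule inj_mat_cancel[OF V(2,1) sx mult_carrier_mat[OF sx sx]])
  next
    \<comment> \<open>The image of 1 fixes the range of \<open>E\<close>, hence that of
      \<open>V\<close>, so cancelling \<open>V\<close> leaves the identity.\<close>
    have "V * repA n k sigma u = repA n d rho u * (E * V)" using Vx V by simp
    also have "\<dots> = repA n d rho u * E * V" by (rule assoc_mult_mat[OF rx E(1) V(1), symmetric])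
    also have "\<dots> = V * 1\<^sub>m k" using E V by simp
    finally show "repA n k sigma u = 1\<^sub>m k" by (rule inj_mat_cancel[OF V(2,1) sx one_carrier_mat])
  qed
  moreover have "W = {0\<^sub>v k} \<or> W = carrier_vec k"
    if sub: "subspace_vec k W" and inv: "\<forall>I<n. \<forall>w\<in>W. sigma I *\<^sub>v w \<in> W" for W
  proof (rule disjCI)
    assume ne: "W \<noteq> carrier_vec k"
    obtain j B where B: "B \<in> carrier_mat k j" "inj_mat B" "\<And>v. v \<in> carrier_vec j \<Longrightarrow> B *\<^sub>v v \<in> W"
       "\<And>w. w \<in> W \<Longrightarrow> \<exists>v\<in>carrier_vec j. B *\<^sub>v v = w"
      using subspace_vec_basis[OF sub] by metis
    have Wsub: "W \<subseteq> carrier_vec k" "0\<^sub>v k \<in> W" using sub by (auto simp: subspace_vec_def)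
    have "j \<noteq> k"
    proof
      assume j: "j = k"
      then obtain C where C: "C \<in> carrier_mat k k" "B * C = 1\<^sub>m k"
        using square_inj_mat_inverse[OF B(2)] B(1) by auto
      have "w \<in> W" if w: "w \<in> carrier_vec k" for w
      proof -
        have "B *\<^sub>v (C *\<^sub>v w) = w" using assoc_mult_mat_vec[of B k k C k w] B(1) C w j by simp
        moreover have "B *\<^sub>v (C *\<^sub>v w) \<in> W" using C w j by (intro B(3)) auto
        ultimately show ?thesis by simp
      qed
      then show False using ne Wsub by auto
    qed
    then have jk: "j < k" using inj_mat_dim_le[OF B(2,1)] by simp
    have "\<exists>X\<in>carrier_mat j j. sigma I * B = B * X" if I: "I < n" for I
    proof (rule factor_through_columns[OF B(1)])
      fix v :: "complex vec" assume v: "v \<in> carrier_vec j"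
      have "sigma I * B *\<^sub>v v = sigma I *\<^sub>v (B *\<^sub>v v)" using sc[OF I] B(1) v by (intro assoc_mult_mat_vec)
      also have "\<dots> \<in> W" using inv I B(3)[OF v] by blast
      finally show "\<exists>w\<in>carrier_vec j. B *\<^sub>v w = sigma I * B *\<^sub>v v" by (rule B(4))
    qed (use sc[OF I] B in auto)
    then obtain tau where tau: "\<And>I. I < n \<Longrightarrow> tau I \<in> carrier_mat j j \<and> sigma I * B = B * tau I" by metis
    have tr: "is_rep_map n j tau" and ti: "intertwiner n j tau k sigma B"
      using tau B(1) by (auto simp: is_rep_map_def intertwiner_def)
    have "intertwiner n j tau d rho (V * B)" using ti VI tr sr rep by (rule intertwiner_mult)
    moreover have "E * (V * B) = V * B" using assoc_mult_mat[OF E(1) V(1) B(1)] V(3) by simp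
    moreover have "inj_mat (V * B)" using V B by (intro inj_mat_mult)
    \<comment> \<open>A proper invariant subspace of the restriction is itself an invariant subspace
      of the range of \<open>E\<close>; by minimality it can only be zero.\<close>
    ultimately have "Q j" if "j > 0" unfolding Q_def using that tr V(1) B(1)
      by (intro conjI exI[of _ "V * B"] exI[of _ tau]) auto
    then have "j = 0" using min jk by force
    show "W = {0\<^sub>v k}"
    proof (intro equalityI subsetI)
      fix w assume "w \<in> W"
      then obtain v where "v \<in> carrier_vec 0" "B *\<^sub>v v = w" using B(4) \<open>j = 0\<close> by auto
      then have "w = 0\<^sub>v k" using B(1) \<open>j = 0\<close> by (auto intro!: eq_vecI simp: scalar_prod_def)
      then show "w \<in> {0\<^sub>v k}" by simp
    qed (use Wsub in auto)
  qed
  ultimately have "irreducible_repA n mu u k sigma" using k unfolding irreducible_repA_def by blast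
  then obtain c where c: "c < r" "equiv_rep n k sigma (dims c) (phi c)" using phi_complete by blast
  then obtain S where S: "k = dims c" "S \<in> carrier_mat k k" "invertible_mat S"
      "\<And>I. I < n \<Longrightarrow> S * sigma I = phi c I * S"
    by (auto simp: equiv_rep_def)
  \<comment> \<open>The inverse of the equivalence \<open>S\<close> leads from \<open>phi c\<close>
    to \<open>sigma\<close>, so that \<open>V * R\<close> starts at the listed
    representative.\<close>
  obtain R where "inverts_mat S R" "inverts_mat R S" using S(3) unfolding invertible_mat_def by blast
  then have R: "R \<in> carrier_mat k k" "S * R = 1\<^sub>m k" "R * S = 1\<^sub>m k"
    using S(2) unfolding inverts_mat_def
    by (metis carrier_matD(1) carrier_matD(2) carrier_matI index_mult_mat(2,3) index_one_mat(2,3))+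
  have RI: "R * phi c I = sigma I * R" if I: "I < n" for I
  proof -
    have p: "phi c I \<in> carrier_mat k k" using phi_carrier c(1) I S(1) by simp
    have "R * phi c I = R * (phi c I * (S * R))" using R p by simp
    also have "\<dots> = R * (phi c I * S * R)" using R(1) S(2) p by (simp add: assoc_mult_mat[of _ k k _ k _ k])
    also have "\<dots> = R * (S * sigma I * R)" using S(4)[OF I] by simp
    also have "\<dots> = R * S * (sigma I * R)" using R(1) S(2) sc[OF I] by (simp add: assoc_mult_mat[of _ k k _ k _ k])
    also have "\<dots> = sigma I * R" using R sc[OF I] by simp
    finally show ?thesis .
  qed
  then have ri: "intertwiner n (dims c) (phi c) k sigma R" using R S(1) by (simp add: intertwiner_def)
  define T where "T = V * R"
  have "intertwiner n (dims c) (phi c) d rho T"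
    unfolding T_def using ri VI phi_rep_map[OF c(1)] sr rep by (rule intertwiner_mult)
  moreover have "E * T = T" unfolding T_def using assoc_mult_mat[OF E(1) V(1) R(1)] V(3) by simp
  moreover have "T \<noteq> 0\<^sub>m d (dims c)"
  proof
    assume "T = 0\<^sub>m d (dims c)"
    then have "V * R = V * 0\<^sub>m k k" using S(1) V(1) by (simp add: T_def)
    then have "R = 0\<^sub>m k k" by (rule inj_mat_cancel[OF V(2,1) R(1) zero_carrier_mat])
    then have "(1\<^sub>m k :: complex mat) = 0\<^sub>m k k" using R(2) S(2) by simp
    then have "(1\<^sub>m k :: complex mat) $$ (0,0) = 0\<^sub>m k k $$ (0,0)" by simp
    then show False using k by simp
  qed
  ultimately show ?thesis using c(1) by blast
qed

text \<open>The labels \<open>cc k\<close> record the irreducible summands of \<open>rho\<close> (with multiplicity); \<open>rho\<close> need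
  not be unital, so the ranges of the isometries \<open>W k\<close> only span the support of \<open>rho\<close>.\<close>

definition orthonormal_intertwiners :: "nat \<Rightarrow> (nat \<Rightarrow> complex mat) \<Rightarrow> 'k set \<Rightarrow> ('k \<Rightarrow> nat) \<Rightarrow> ('k \<Rightarrow> complex mat) \<Rightarrow> bool" where
  "orthonormal_intertwiners d rho F cc W \<longleftrightarrow> finite F
     \<and> (\<forall>k\<in>F. cc k < r \<and> intertwiner n (dims (cc k)) (phi (cc k)) d rho (W k)
              \<and> adj (W k) * W k = 1\<^sub>m (dims (cc k)))
     \<and> (\<forall>k\<in>F. \<forall>l\<in>F. k \<noteq> l \<longrightarrow> adj (W k) * W l = 0\<^sub>m (dims (cc k)) (dims (cc l)))"

definition decomposes :: "nat \<Rightarrow> (nat \<Rightarrow> complex mat) \<Rightarrow> 'k set \<Rightarrow> ('k \<Rightarrow> nat) \<Rightarrow> ('k \<Rightarrow> complex mat) \<Rightarrow> bool" where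
  "decomposes d rho F cc W \<longleftrightarrow> orthonormal_intertwiners d rho F cc W
     \<and> (\<forall>I<n. rho I = mat_sum d d (\<lambda>k. W k * phi (cc k) I * adj (W k)) F)"

lemma orthonormal_intertwinersD:
  assumes "orthonormal_intertwiners d rho F cc W" "k \<in> F"
  shows "cc k < r" "W k \<in> carrier_mat d (dims (cc k))" "intertwiner n (dims (cc k)) (phi (cc k)) d rho (W k)"
    "adj (W k) * W k = 1\<^sub>m (dims (cc k))" "\<And>l. l \<in> F \<Longrightarrow> k \<noteq> l \<Longrightarrow> adj (W k) * W l = 0\<^sub>m (dims (cc k)) (dims (cc l))"
  using assms by (auto simp: orthonormal_intertwiners_def intertwiner_def)

text \<open>The first columns of the \<open>W k\<close> are orthonormal vectors in dimension
  \<open>d\<close>; they exist since irreducible representations have positive dimension. The bound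
  lets a largest family be chosen.\<close>

lemma orthonormal_intertwiners_card_le:
  assumes F: "orthonormal_intertwiners d rho {..<m} cc W"
  shows "m \<le> d"
proof -
  note D = orthonormal_intertwinersD[OF F]
  define B where "B = mat d m (\<lambda>(i,k). W k $$ (i,0))"
  have B: "B \<in> carrier_mat d m" by (simp add: B_def)
  have "adj B * B = 1\<^sub>m m"
  proof (intro eq_matI)
    fix k l assume "k < dim_row (1\<^sub>m m)" "l < dim_col (1\<^sub>m m)"
    then have kl: "k \<in> {..<m}" "l \<in> {..<m}" by auto
    have p: "dims (cc k) > 0" "dims (cc l) > 0" using dims_pos D(1) kl by auto
    have "(adj B * B) $$ (k,l) = (adj (W k) * W l) $$ (0,0)"
      using kl p D(2)[OF kl(1)] D(2)[OF kl(2)] by (auto simp: B_def scalar_prod_def)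
    also have "\<dots> = 1\<^sub>m m $$ (k,l)" using D(4)[OF kl(1)] D(5)[OF kl(1) kl(2)] p kl by (cases "k = l") auto
    finally show "(adj B * B) $$ (k,l) = 1\<^sub>m m $$ (k,l)" .
  qed (use B in auto)
  then have "inj_mat B" using B by (intro inj_mat_if_left_inverse[of "adj B" m d B]) auto
  then show ?thesis using inj_mat_dim_le B by blast
qed

text \<open>A largest orthonormal family exhausts the support. Otherwise the projection onto the
  rest of the support contains the range of a nonzero intertwiner, and rescaling that one extends
  the family.\<close>

lemma decomposition_exists:
  assumes rho: "star_rep d rho"
  shows "\<exists>m cc W. decomposes d rho {..<m::nat} cc W"
proof -
  have rep: "is_rep_map n d rho" and star: "star_repA n st d rho" using rho by (auto simp: star_rep_def)
  have rc: "\<And>I. I < n \<Longrightarrow> rho I \<in> carrier_mat d d" using rep by (auto simp: is_rep_map_def)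
  define P where "P = (\<lambda>m. \<exists>cc W. orthonormal_intertwiners d rho {..<m::nat} cc W)"
  have "P 0" by (auto simp: P_def orthonormal_intertwiners_def)
  moreover have "\<forall>m. P m \<longrightarrow> m < Suc d" using orthonormal_intertwiners_card_le by (auto simp: P_def less_Suc_eq_le)
  ultimately obtain m where "P m" and max: "\<And>k. P k \<Longrightarrow> k \<le> m"
    using ex_has_greatest_nat[of P 0 "\<lambda>x. x" "Suc d"] by auto
  then obtain cc W where F: "orthonormal_intertwiners d rho {..<m} cc W" by (auto simp: P_def)
  note D = orthonormal_intertwinersD[OF F]
  \<comment> \<open>The projection onto the support of \<open>rho\<close>; it takes the place that
    the identity has for a unital representation.\<close>
  define U where "U = repA n d rho u"
  have Uc: "U \<in> carrier_mat d d" using rep by (simp add: U_def)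
  define Pi where "Pi = mat_sum d d (\<lambda>k. W k * adj (W k)) {..<m}"
  have Pic: "Pi \<in> carrier_mat d d" by (simp add: Pi_def)
  have WWc: "W k * adj (W k) \<in> carrier_mat d d" if "k < m" for k
    using D(2)[of k] that by (intro mult_carrier_mat[of _ _ "dims (cc k)"]) auto
  have adjI: "intertwiner n d rho (dims (cc k)) (phi (cc k)) (adj (W k))" if "k < m" for k
    using D(1,3)[of k] that by (intro intertwiner_adj) (auto simp: phi_rep_map phi_star rep star)
  have UW: "U * W k = W k" if "k < m" for k
    using intertwiner_repA[OF D(3)[of k] phi_rep_map rep, of u] phi_unit[of "cc k"] D(1,2)[of k] that
    by (simp add: U_def)
  have WU: "adj (W k) * U = adj (W k)" if "k < m" for k
    using intertwiner_repA[OF adjI[OF that] rep phi_rep_map, of u] phi_unit[of "cc k"] D(1,2)[of k] that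
    by (simp add: U_def)
  have WPi: "adj (W k) * Pi = adj (W k)" if k: "k < m" for k
  proof -
    have "adj (W k) * Pi = mat_sum (dims (cc k)) d (\<lambda>l. adj (W k) * (W l * adj (W l))) {..<m}"
      unfolding Pi_def using D(2) WWc k by (intro mat_sum_mult_left) auto
    also have "\<dots> = adj (W k) * (W k * adj (W k))"
    proof (rule mat_sum_single)
      fix l assume l: "l \<in> {..<m}" "l \<noteq> k"
      have "adj (W k) * (W l * adj (W l)) = adj (W k) * W l * adj (W l)"
        using D(2)[of k] D(2)[of l] k l by (intro assoc_mult_mat[symmetric]) auto
      then show "adj (W k) * (W l * adj (W l)) = 0\<^sub>m (dims (cc k)) d"
        using D(5)[of k l] D(2)[of l] k l by (simp add: left_mult_zero_mat[of _ "dims (cc l)" d])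
    qed (use mult_carrier_mat[OF adj_carrier[OF D(2)[of k]] WWc[OF k]] k in auto)
    also have "\<dots> = adj (W k) * W k * adj (W k)"
      using D(2)[of k] k by (intro assoc_mult_mat[symmetric]) auto
    also have "\<dots> = adj (W k)" using D(4)[of k] D(2)[of k] k by (simp add: left_mult_one_mat[of _ _ d])
    finally show ?thesis .
  qed
  have WWr: "W k * adj (W k) * rho I = rho I * (W k * adj (W k))" if "k < m" "I < n" for k I
    using intertwiner_mult[OF adjI[OF that(1)] D(3)[of k] rep phi_rep_map rep] D(1)[of k] that
    by (auto simp: intertwiner_def)
  have Pir: "Pi * rho I = rho I * Pi" if I: "I < n" for I
  proof -
    have "Pi * rho I = mat_sum d d (\<lambda>k. W k * adj (W k) * rho I) {..<m}"
      unfolding Pi_def using WWc rc[OF I] by (intro mat_sum_mult_right) auto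
    also have "\<dots> = mat_sum d d (\<lambda>k. rho I * (W k * adj (W k))) {..<m}"
      using WWr I by (intro mat_sum_cong) auto
    also have "\<dots> = rho I * Pi" unfolding Pi_def using WWc rc[OF I]
      by (intro mat_sum_mult_left[symmetric]) auto
    finally show ?thesis .
  qed
  have UPi: "U * Pi = Pi"
  proof -
    have "U * Pi = mat_sum d d (\<lambda>k. U * (W k * adj (W k))) {..<m}"
      unfolding Pi_def using WWc Uc by (intro mat_sum_mult_left) auto
    also have "\<dots> = Pi" unfolding Pi_def
    proof (rule mat_sum_cong[OF refl])
      fix k assume k: "k \<in> {..<m}"
      show "U * (W k * adj (W k)) = W k * adj (W k)"
        using assoc_mult_mat[OF Uc D(2)[OF k] adj_carrier[OF D(2)[OF k]]] UW k by simp
    qed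
    finally show ?thesis .
  qed
  have PiX: "Pi * X = mat_sum d d (\<lambda>k. W k * (adj (W k) * X)) {..<m}" if X: "X \<in> carrier_mat d d" for X
  proof -
    have "Pi * X = mat_sum d d (\<lambda>k. W k * adj (W k) * X) {..<m}"
      unfolding Pi_def using WWc X by (intro mat_sum_mult_right) auto
    also have "\<dots> = mat_sum d d (\<lambda>k. W k * (adj (W k) * X)) {..<m}"
    proof (rule mat_sum_cong[OF refl])
      fix k assume k: "k \<in> {..<m}"
      show "W k * adj (W k) * X = W k * (adj (W k) * X)"
        using D(2)[OF k] X by (intro assoc_mult_mat) auto
    qed
    finally show ?thesis .
  qed
  have PiU: "Pi * U = Pi" and PiPi: "Pi * Pi = Pi"
    using PiX[OF Uc] PiX[OF Pic] WU WPi unfolding Pi_def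
    by (auto intro!: mat_sum_cong)
  have Ur: "U * rho I = rho I" "rho I * U = rho I" if "I < n" for I
    using rep_unit_mult[OF rho that] by (simp_all add: U_def)
  have UU: "U * U = U"
    using rho inA_u unit[OF inA_u] unfolding star_rep_def U_def by metis
  \<comment> \<open>The part of the support not yet covered: an idempotent that commutes with
    \<open>rho\<close> and is killed by every \<open>adj (W k)\<close>.\<close>
  define E where "E = U - Pi"
  have Ec: "E \<in> carrier_mat d d" using Uc Pic unfolding E_def by (intro minus_carrier_mat)
  have UE: "U * E = E" unfolding E_def
    using Uc Pic UU UPi by (simp add: mult_minus_distrib_mat[of _ d d])
  have PiE: "Pi * E = 0\<^sub>m d d" unfolding E_def
    using Uc Pic PiU PiPi mult_minus_distrib_mat[OF Pic Uc Pic] by simp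
  have EE: "E * E = E"
    using minus_mult_distrib_mat[OF Uc Pic Ec] UE PiE Ec unfolding E_def[symmetric] by (auto intro!: eq_matI)
  have Er: "E * rho I = rho I * E" if "I < n" for I
    unfolding E_def using Ur[OF that] Pir[OF that] minus_mult_distrib_mat[OF Uc Pic rc[OF that]]
      mult_minus_distrib_mat[OF rc[OF that] Uc Pic] by simp
  have "E = 0\<^sub>m d d"
  proof (rule ccontr)
    assume "E \<noteq> 0\<^sub>m d d"
    then obtain c T where c: "c < r" and T: "intertwiner n (dims c) (phi c) d rho T"
        "T \<noteq> 0\<^sub>m d (dims c)" "E * T = T"
      using nonzero_intertwiner_exists[OF rho Ec _ EE Er] UE unfolding U_def by blast
    have Tc: "T \<in> carrier_mat d (dims c)" using T by (simp add: intertwiner_def)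
    have "intertwiner n (dims c) (phi c) (dims c) (phi c) (adj T * T)"
      using intertwiner_mult[OF T(1) intertwiner_adj[OF T(1)]] phi_rep_map[OF c] rep star phi_star[OF c] by blast
    then obtain x where x: "adj T * T = x \<cdot>\<^sub>m 1\<^sub>m (dims c)" using schur_scalar[OF c] by blast
    then obtain y where y: "y > 0" "x = complex_of_real y"
      using adj_mult_self_scalar_pos[OF Tc] T(2) by blast
    \<comment> \<open>By Schur's lemma \<open>adj T * T\<close> is the positive scalar
      \<open>y\<close>, so dividing \<open>T\<close> by its square root yields an isometry.\<close>
    define z where "z = complex_of_real (1 / sqrt y)"
    have z: "cnj z * z * x = 1"
      using y by (simp add: z_def flip: of_real_mult)
    define V where "V = z \<cdot>\<^sub>m T"
    have Vc: "V \<in> carrier_mat d (dims c)" using Tc by (simp add: V_def)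
    have VI: "intertwiner n (dims c) (phi c) d rho V"
      unfolding V_def using T(1) phi_rep_map[OF c] rep by (rule intertwiner_smult)
    have VV: "adj V * V = 1\<^sub>m (dims c)"
    proof -
      have "adj V * V = (cnj z * z) \<cdot>\<^sub>m (adj T * T)"
        unfolding V_def adj_smult using mult_smult_assoc_mat[of "adj T" "dims c" d "z \<cdot>\<^sub>m T" "dims c" "cnj z"]
          mult_smult_distrib[of "adj T" "dims c" d T "dims c" z] Tc
        by (auto intro!: eq_matI)
      also have "\<dots> = (cnj z * z * x) \<cdot>\<^sub>m 1\<^sub>m (dims c)" unfolding x by (intro eq_matI) auto
      also have "\<dots> = 1\<^sub>m (dims c)" unfolding z by (intro eq_matI) auto
      finally show ?thesis .
    qed
    have WV: "adj (W k) * V = 0\<^sub>m (dims (cc k)) (dims c)" if k: "k < m" for k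
    proof -
      have Wc: "adj (W k) \<in> carrier_mat (dims (cc k)) d" using D(2)[of k] k by auto
      have "adj (W k) * E = 0\<^sub>m (dims (cc k)) d"
        unfolding E_def using mult_minus_distrib_mat[OF Wc Uc Pic] WU[OF k] WPi[OF k] Wc by simp
      then have "adj (W k) * (E * T) = 0\<^sub>m (dims (cc k)) (dims c)"
        using assoc_mult_mat[OF Wc Ec Tc] Tc by simp
      then show ?thesis unfolding V_def T(3) using mult_smult_distrib[OF Wc Tc, of z] by auto
    qed
    have VW: "adj V * W k = 0\<^sub>m (dims c) (dims (cc k))" if k: "k < m" for k
    proof -
      have "adj V * W k = adj (adj (W k) * V)"
        using adj_mult[of "adj (W k)" "dims (cc k)" d V "dims c"] D(2)[of k] k Vc by simp
      then show ?thesis using WV[OF k] by simp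
    qed
    have "orthonormal_intertwiners d rho {..<Suc m} (cc(m := c)) (W(m := V))"
      unfolding orthonormal_intertwiners_def
      using D c VI VV WV VW by (auto simp: less_Suc_eq)
    then have "P (Suc m)" by (auto simp: P_def)
    then show False using max by fastforce
  qed
  \<comment> \<open>Once the ranges exhaust the support,
    \<open>rho I = U * rho I = Pi * rho I\<close>, and moving \<open>adj (W k)\<close> across
    \<open>rho I\<close> produces the blocks.\<close>
  then have UPi: "U = Pi" using mat_minus_eq_zero[OF Uc Pic] unfolding E_def by simp
  have "rho I = mat_sum d d (\<lambda>k. W k * phi (cc k) I * adj (W k)) {..<m}" if I: "I < n" for I
  proof -
    have "rho I = Pi * rho I" using Ur[OF I] UPi by simp
    also have "\<dots> = mat_sum d d (\<lambda>k. W k * (adj (W k) * rho I)) {..<m}" using PiX[OF rc[OF I]] .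
    also have "\<dots> = mat_sum d d (\<lambda>k. W k * phi (cc k) I * adj (W k)) {..<m}"
    proof (rule mat_sum_cong[OF refl])
      fix k assume k: "k \<in> {..<m}"
      have "adj (W k) * rho I = phi (cc k) I * adj (W k)" using adjI[of k] k I by (simp add: intertwiner_def)
      then show "W k * (adj (W k) * rho I) = W k * phi (cc k) I * adj (W k)"
        using assoc_mult_mat[OF D(2)[OF k] phi_carrier[OF D(1)[OF k] I] adj_carrier[OF D(2)[OF k]]] by simp
    qed
    finally show ?thesis .
  qed
  then show ?thesis using F unfolding decomposes_def by blast
qed

text \<open>Intertwining comes for free: multiplying the block sum by \<open>W l\<close> on the
  right, orthogonality leaves just the term with index \<open>l\<close>.\<close>

lemma decomposesI:
  assumes orthonormal: "orthonormal_family d F (\<lambda>k. dims (cc k)) W"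
    and cc: "\<And>k. k \<in> F \<Longrightarrow> cc k < r"
    and rho: "\<And>I. I < n \<Longrightarrow> rho I = mat_sum d d (\<lambda>k. W k * phi (cc k) I * adj (W k)) F"
  shows "decomposes d rho F cc W"
proof -
  note fin = orthonormal_familyD(1)[OF orthonormal] and W = orthonormal_familyD(2)[OF orthonormal]
    and iso = orthonormal_familyD(3)[OF orthonormal] and orth = orthonormal_familyD(4)[OF orthonormal]
  have "W l * phi (cc l) I = rho I * W l" if l: "l \<in> F" and I: "I < n" for l I
  proof -
    have c: "W k * phi (cc k) I \<in> carrier_mat d (dims (cc k))" if "k \<in> F" for k
      using W[OF that] phi_carrier[OF cc[OF that] I] by (rule mult_carrier_mat)
    have eq: "W k * phi (cc k) I * adj (W k) * W l = W k * phi (cc k) I * (adj (W k) * W l)" if "k \<in> F" for k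
      using c[OF that] adj_carrier[OF W[OF that]] W[OF l] by (rule assoc_mult_mat)
    have "rho I * W l = mat_sum d (dims (cc l)) (\<lambda>k. W k * phi (cc k) I * adj (W k) * W l) F"
      unfolding rho[OF I] using mult_carrier_mat[OF c adj_carrier[OF W]] W[OF l]
      by (intro mat_sum_mult_right) auto
    also have "\<dots> = W l * phi (cc l) I * adj (W l) * W l"
    proof (rule mat_sum_single[OF fin l])
      fix k assume k: "k \<in> F" "k \<noteq> l"
      show "W k * phi (cc k) I * adj (W k) * W l = 0\<^sub>m d (dims (cc l))"
        unfolding eq[OF k(1)] orth[OF k(1) l k(2)] using c[OF k(1)] by (rule right_mult_zero_mat)
    qed (use mult_carrier_mat[OF mult_carrier_mat[OF c[OF l] adj_carrier[OF W[OF l]]] W[OF l]] in auto)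
    also have "\<dots> = W l * phi (cc l) I" unfolding eq[OF l] iso[OF l] using c[OF l] by (rule right_mult_one_mat)
    finally show ?thesis by simp
  qed
  then show ?thesis unfolding decomposes_def orthonormal_intertwiners_def intertwiner_def
    using fin cc W iso orth rho by blast
qed

lemma decomposesD:
  assumes "decomposes d rho F cc W"
  shows "finite F" "\<And>k. k \<in> F \<Longrightarrow> cc k < r" "\<And>k. k \<in> F \<Longrightarrow> W k \<in> carrier_mat d (dims (cc k))"
    "\<And>k. k \<in> F \<Longrightarrow> intertwiner n (dims (cc k)) (phi (cc k)) d rho (W k)"
    "\<And>k. k \<in> F \<Longrightarrow> adj (W k) * W k = 1\<^sub>m (dims (cc k))"
    "\<And>k l. k \<in> F \<Longrightarrow> l \<in> F \<Longrightarrow> k \<noteq> l \<Longrightarrow> adj (W k) * W l = 0\<^sub>m (dims (cc k)) (dims (cc l))"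
    "\<And>I. I < n \<Longrightarrow> rho I = mat_sum d d (\<lambda>k. W k * phi (cc k) I * adj (W k)) F"
  using assms unfolding decomposes_def orthonormal_intertwiners_def by (auto simp: intertwiner_def)

lemma decomposes_orthonormal: "decomposes d rho F cc W \<Longrightarrow> orthonormal_family d F (\<lambda>k. dims (cc k)) W"
  unfolding decomposes_def orthonormal_intertwiners_def orthonormal_family_def by (auto simp: intertwiner_def)

text \<open>The trivial decomposition with one block, so that an irreducible factor can be fed into
  the decomposition of a tensor product.\<close>

lemma phi_decomposes:
  assumes "c < r"
  shows "decomposes (dims c) (phi c) {0::nat} (\<lambda>_. c) (\<lambda>_. 1\<^sub>m (dims c))"
proof (rule decomposesI)
  fix I assume "I < n"
  note p = phi_carrier[OF assms this]
  have "mat_sum (dims c) (dims c) (\<lambda>k. 1\<^sub>m (dims c) * phi c I * adj (1\<^sub>m (dims c))) {0::nat}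
      = 1\<^sub>m (dims c) * phi c I * adj (1\<^sub>m (dims c))"
    using p by (intro mat_sum_single) auto
  then show "phi c I = mat_sum (dims c) (dims c) (\<lambda>k. 1\<^sub>m (dims c) * phi c I * adj (1\<^sub>m (dims c))) {0::nat}"
    using p by simp
qed (use assms in \<open>auto simp: orthonormal_family_def\<close>)

text \<open>Read off the block sum itself, by multiplying with \<open>adj (W l)\<close> on the
  left.\<close>

lemma decomposes_adj_intertwiner:
  assumes dec: "decomposes d rho F cc W" and l: "l \<in> F"
  shows "intertwiner n d rho (dims (cc l)) (phi (cc l)) (adj (W l))"
proof -
  note D = decomposesD[OF dec]
  have "adj (W l) * rho I = phi (cc l) I * adj (W l)" if I: "I < n" for I
  proof -
    have c: "phi (cc k) I * adj (W k) \<in> carrier_mat (dims (cc k)) d" if "k \<in> F" for k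
      using phi_carrier[OF D(2)[OF that] I] adj_carrier[OF D(3)[OF that]] by (rule mult_carrier_mat)
    have eq1: "W k * phi (cc k) I * adj (W k) = W k * (phi (cc k) I * adj (W k))" if "k \<in> F" for k
      using D(3)[OF that] phi_carrier[OF D(2)[OF that] I] adj_carrier[OF D(3)[OF that]] by (rule assoc_mult_mat)
    have eq: "adj (W l) * (W k * phi (cc k) I * adj (W k)) = adj (W l) * W k * (phi (cc k) I * adj (W k))"
      if "k \<in> F" for k
      unfolding eq1[OF that] using assoc_mult_mat[OF adj_carrier[OF D(3)[OF l]] D(3)[OF that] c[OF that]] by simp
    have "adj (W l) * rho I = mat_sum (dims (cc l)) d (\<lambda>k. adj (W l) * (W k * phi (cc k) I * adj (W k))) F"
      unfolding D(7)[OF I] using mult_carrier_mat[OF D(3) c] D(3)[OF l] eq1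
      by (intro mat_sum_mult_left) auto
    also have "\<dots> = adj (W l) * (W l * phi (cc l) I * adj (W l))"
    proof (rule mat_sum_single[OF D(1) l])
      fix k assume k: "k \<in> F" "k \<noteq> l"
      show "adj (W l) * (W k * phi (cc k) I * adj (W k)) = 0\<^sub>m (dims (cc l)) d"
        unfolding eq[OF k(1)] D(6)[OF l k(1) k(2)[symmetric]] using c[OF k(1)] by (rule left_mult_zero_mat)
    next
      show "adj (W l) * (W l * phi (cc l) I * adj (W l)) \<in> carrier_mat (dims (cc l)) d"
        unfolding eq[OF l] D(5)[OF l] left_mult_one_mat[OF c[OF l]] by (rule c[OF l])
    qed
    also have "\<dots> = phi (cc l) I * adj (W l)" unfolding eq[OF l] D(5)[OF l] using c[OF l] by (rule left_mult_one_mat)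
    finally show ?thesis .
  qed
  then show ?thesis using D(3)[OF l] by (simp add: intertwiner_def)
qed

lemma decomposes_repA:
  assumes dec: "decomposes d rho F cc W" and rep: "is_rep_map n d rho"
  shows "repA n d rho x = mat_sum d d (\<lambda>k. W k * repA n (dims (cc k)) (phi (cc k)) x * adj (W k)) F"
proof -
  note D = decomposesD[OF dec]
  have pc: "phi (cc k) I \<in> carrier_mat (dims (cc k)) (dims (cc k))" if "k \<in> F" "I < n" for k I
    using phi_carrier[OF D(2)[OF that(1)] that(2)] .
  have "repA n d rho x = mat_sum d d (\<lambda>I. mat_sum d d (\<lambda>k. x I \<cdot>\<^sub>m (W k * phi (cc k) I * adj (W k))) F) {..<n}"
    unfolding repA_mat_sum[OF rep]
    by (intro mat_sum_cong refl) (auto simp: D(7) intro!: mat_sum_smult conj_carrier[OF D(3) pc])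
  also have "\<dots> = mat_sum d d (\<lambda>k. mat_sum d d (\<lambda>I. x I \<cdot>\<^sub>m (W k * phi (cc k) I * adj (W k))) {..<n}) F"
    by (rule mat_sum_swap)
  also have "\<dots> = mat_sum d d (\<lambda>k. W k * repA n (dims (cc k)) (phi (cc k)) x * adj (W k)) F"
  proof (rule mat_sum_cong[OF refl])
    fix k assume k: "k \<in> F"
    show "mat_sum d d (\<lambda>I. x I \<cdot>\<^sub>m (W k * phi (cc k) I * adj (W k))) {..<n}
        = W k * repA n (dims (cc k)) (phi (cc k)) x * adj (W k)"
      unfolding repA_mat_sum[OF phi_rep_map[OF D(2)[OF k]]]
      using pc[OF k] by (intro conj_mat_sum[OF D(3)[OF k]]) auto
  qed
  finally show ?thesis .
qed

section \<open>Spaces of intertwiners and multiplicities\<close>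

lemma decomposes_unit:
  assumes dec: "decomposes d rho F cc W" and rep: "is_rep_map n d rho"
  shows "repA n d rho u = mat_sum d d (\<lambda>k. W k * adj (W k)) F"
  unfolding decomposes_repA[OF assms]
  using decomposesD(2,3)[OF dec] phi_unit by (intro mat_sum_cong) (auto simp: right_mult_one_mat[of _ d])

text \<open>The range of \<open>T\<close> lies in the support, so \<open>T\<close> is the sum of the
  \<open>W k * (adj (W k) * T)\<close>. Each bracket intertwines two irreducible representations and
  is zero or scalar by Schur's lemma.\<close>

lemma intertwiner_in_span:
  assumes dec: "decomposes d rho F cc W" and rep: "is_rep_map n d rho" and c: "c < r"
    and T: "intertwiner n (dims c) (phi c) d rho T"
  shows "\<exists>t. T = mat_sum d (dims c) (\<lambda>k. t k \<cdot>\<^sub>m W k) {k\<in>F. cc k = c}"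
proof -
  note D = decomposesD[OF dec]
  have Tc: "T \<in> carrier_mat d (dims c)" using T by (simp add: intertwiner_def)
  have I: "intertwiner n (dims c) (phi c) (dims (cc k)) (phi (cc k)) (adj (W k) * T)" if k: "k \<in> F" for k
    using T decomposes_adj_intertwiner[OF dec k] phi_rep_map[OF c] rep phi_rep_map[OF D(2)[OF k]]
    by (rule intertwiner_mult)
  have "\<exists>t. adj (W k) * T = t \<cdot>\<^sub>m 1\<^sub>m (dims c)" if "k \<in> F" "cc k = c" for k
    using I[OF that(1)] that(2) c schur_scalar by auto
  then obtain t where t: "\<And>k. k \<in> F \<Longrightarrow> cc k = c \<Longrightarrow> adj (W k) * T = t k \<cdot>\<^sub>m 1\<^sub>m (dims c)" by metis
  have z: "adj (W k) * T = 0\<^sub>m (dims (cc k)) (dims c)" if "k \<in> F" "cc k \<noteq> c" for k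
    using schur_nonzero[OF c D(2)[OF that(1)] I[OF that(1)]] that(2) by auto
  have WT: "W k * adj (W k) * T = W k * (adj (W k) * T)" if "k \<in> F" for k
    using D(3)[OF that] adj_carrier[OF D(3)[OF that]] Tc by (rule assoc_mult_mat)
  have "T = T * repA n (dims c) (phi c) u" using phi_unit[OF c] Tc by simp
  also have "\<dots> = repA n d rho u * T" by (rule intertwiner_repA[OF T phi_rep_map[OF c] rep])
  also have "\<dots> = mat_sum d (dims c) (\<lambda>k. W k * adj (W k) * T) F"
    unfolding decomposes_unit[OF dec rep] using Tc mult_carrier_mat[OF D(3) adj_carrier[OF D(3)]]
    by (intro mat_sum_mult_right) auto
  also have "\<dots> = mat_sum d (dims c) (\<lambda>k. if cc k = c then t k \<cdot>\<^sub>m W k else 0\<^sub>m d (dims c)) F"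
  proof (rule mat_sum_cong[OF refl])
    fix k assume k: "k \<in> F"
    show "W k * adj (W k) * T = (if cc k = c then t k \<cdot>\<^sub>m W k else 0\<^sub>m d (dims c))"
    proof (cases "cc k = c")
      case True
      then have Wc: "W k \<in> carrier_mat d (dims c)" using D(3)[OF k] by simp
      show ?thesis using WT[OF k] t[OF k True] True mult_smult_distrib[OF Wc, of "1\<^sub>m (dims c)" "dims c" "t k"] Wc
        by simp
    qed (use WT[OF k] z[OF k] D(3)[OF k] in simp)
  qed
  also have "\<dots> = mat_sum d (dims c) (\<lambda>k. t k \<cdot>\<^sub>m W k) {k\<in>F. cc k = c}"
  proof (intro eq_matI)
    fix i j assume "i < dim_row (mat_sum d (dims c) (\<lambda>k. t k \<cdot>\<^sub>m W k) {k\<in>F. cc k = c})"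
       "j < dim_col (mat_sum d (dims c) (\<lambda>k. t k \<cdot>\<^sub>m W k) {k\<in>F. cc k = c})"
    then have ij: "i < d" "j < dims c" by auto
    have "(\<Sum>k\<in>F. (if cc k = c then t k \<cdot>\<^sub>m W k else 0\<^sub>m d (dims c)) $$ (i,j))
       = (\<Sum>k\<in>F. if cc k = c then (t k \<cdot>\<^sub>m W k) $$ (i,j) else 0)"
      using ij by (intro sum.cong) auto
    also have "\<dots> = (\<Sum>k\<in>{k\<in>F. cc k = c}. (t k \<cdot>\<^sub>m W k) $$ (i,j))"
      using D(1) by (intro sum.inter_filter[symmetric])
    finally show "mat_sum d (dims c) (\<lambda>k. if cc k = c then t k \<cdot>\<^sub>m W k else 0\<^sub>m d (dims c)) F $$ (i,j)
        = mat_sum d (dims c) (\<lambda>k. t k \<cdot>\<^sub>m W k) {k\<in>F. cc k = c} $$ (i,j)" using ij by simp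
  qed auto
  finally show ?thesis by blast
qed

text \<open>The \<open>W k\<close> with label \<open>c\<close> form a basis of the intertwiner
  space. Thus every decomposition computes the same multiplicity, and fusion numbers can be obtained
  by counting blocks.\<close>

lemma multiplicity_eq_card:
  assumes dec: "decomposes d rho F cc W" and rep: "is_rep_map n d rho" and c: "c < r"
  shows "mat_space_dim d (dims c) {T. \<forall>I<n. T * phi c I = rho I * T} = card {k\<in>F. cc k = c}"
proof -
  note D = decomposesD[OF dec]
  let ?S = "{T. \<forall>I<n. T * phi c I = rho I * T}"
  define G where "G = {k\<in>F. cc k = c}"
  define g where "g = card G"
  have finG: "finite G" using D(1) by (simp add: G_def)
  obtain h where h: "bij_betw h {..<g} G" using ex_bij_betw_nat_finite[OF finG] by (auto simp: g_def atLeast0LessThan)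
  have hG: "h i \<in> F" "cc (h i) = c" if "i < g" for i using h that by (auto simp: bij_betw_def G_def)
  have inj: "h i = h j \<longleftrightarrow> i = j" if "i < g" "j < g" for i j
    using h that by (auto simp: bij_betw_def inj_on_def)
  show ?thesis unfolding mat_space_dim_def G_def[symmetric] g_def[symmetric]
  proof (rule Greatest_equality)
    let ?Ts = "map (\<lambda>i. W (h i)) [0..<g]"
    have Wc: "W (h i) \<in> carrier_mat d (dims c)" if "i < g" for i using D(3)[OF hG(1)] hG(2) that by auto
    have "set ?Ts \<subseteq> ?S \<inter> carrier_mat d (dims c)"
      using Wc hG D(4) by (fastforce simp: intertwiner_def)
    moreover have "mat_lin_indep d (dims c) ?Ts" unfolding mat_lin_indep_def
    proof (intro allI impI)
      fix coef i assume eq: "msum d (dims c) (\<lambda>i. coef i \<cdot>\<^sub>m ?Ts ! i) (length ?Ts) = 0\<^sub>m d (dims c)"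
        and "i < length ?Ts"
      then have i: "i < g" by simp
      have "msum d (dims c) (\<lambda>i. coef i \<cdot>\<^sub>m ?Ts ! i) (length ?Ts) = mat_sum d (dims c) (\<lambda>i. coef i \<cdot>\<^sub>m ?Ts ! i) {..<length ?Ts}"
        using Wc by (intro msum_eq_mat_sum) auto
      also have "\<dots> = mat_sum d (dims c) (\<lambda>i. coef i \<cdot>\<^sub>m W (h i)) {..<g}" by (intro mat_sum_cong) auto
      finally have z: "mat_sum d (dims c) (\<lambda>i. coef i \<cdot>\<^sub>m W (h i)) {..<g} = 0\<^sub>m d (dims c)" using eq by simp
      \<comment> \<open>Multiplying by \<open>adj (W (h i))\<close> isolates the coefficient
        \<open>coef i\<close>, times an identity matrix of positive size.\<close>
      have sm: "adj (W (h i)) * (coef l \<cdot>\<^sub>m W (h l)) = coef l \<cdot>\<^sub>m (adj (W (h i)) * W (h l))" if "l < g" for l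
        using adj_carrier[OF Wc[OF i]] Wc[OF that] by (rule mult_smult_distrib)
      have "0\<^sub>m (dims c) (dims c) = adj (W (h i)) * mat_sum d (dims c) (\<lambda>i. coef i \<cdot>\<^sub>m W (h i)) {..<g}"
        unfolding z using Wc[OF i] by (intro right_mult_zero_mat[symmetric]) auto
      also have "\<dots> = mat_sum (dims c) (dims c) (\<lambda>l. adj (W (h i)) * (coef l \<cdot>\<^sub>m W (h l))) {..<g}"
        using Wc i by (intro mat_sum_mult_left) auto
      also have "\<dots> = adj (W (h i)) * (coef i \<cdot>\<^sub>m W (h i))"
      proof (rule mat_sum_single)
        fix l assume l: "l \<in> {..<g}" "l \<noteq> i"
        then show "adj (W (h i)) * (coef l \<cdot>\<^sub>m W (h l)) = 0\<^sub>m (dims c) (dims c)"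
          using sm[of l] D(6)[of "h i" "h l"] hG i inj[of i l] by auto
      qed (use i sm D(5)[OF hG(1)] hG(2) in auto)
      also have "\<dots> = coef i \<cdot>\<^sub>m 1\<^sub>m (dims c)" using sm[OF i] D(5)[OF hG(1)[OF i]] hG(2)[OF i] by simp
      finally have "(0\<^sub>m (dims c) (dims c) :: complex mat) $$ (0,0) = (coef i \<cdot>\<^sub>m 1\<^sub>m (dims c)) $$ (0,0)" by simp
      then show "coef i = 0" using dims_pos[OF c] by simp
    qed
    ultimately show "\<exists>Ts. length Ts = g \<and> set Ts \<subseteq> ?S \<inter> carrier_mat d (dims c) \<and> mat_lin_indep d (dims c) Ts"
      by (intro exI[of _ ?Ts]) auto
  next
    fix m assume "\<exists>Ts. length Ts = m \<and> set Ts \<subseteq> ?S \<inter> carrier_mat d (dims c) \<and> mat_lin_indep d (dims c) Ts"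
    then obtain Ts where Ts: "length Ts = m" "set Ts \<subseteq> ?S \<inter> carrier_mat d (dims c)" "mat_lin_indep d (dims c) Ts"
      by blast
    have "intertwiner n (dims c) (phi c) d rho (Ts ! j)" if "j < m" for j
      using subsetD[OF Ts(2) nth_mem[of j Ts]] Ts(1) that by (auto simp: intertwiner_def)
    then have "\<exists>t. Ts ! j = mat_sum d (dims c) (\<lambda>k. t k \<cdot>\<^sub>m W k) G" if "j < m" for j
      using intertwiner_in_span[OF dec rep c] that unfolding G_def by blast
    then obtain t where t: "\<And>j. j < m \<Longrightarrow> Ts ! j = mat_sum d (dims c) (\<lambda>k. t j k \<cdot>\<^sub>m W k) G" by metis
    have GW: "k \<in> G \<Longrightarrow> W k \<in> carrier_mat d (dims c)" for k using D(3) by (auto simp: G_def)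
    show "m \<le> g"
    proof (rule ccontr)
      assume "\<not> m \<le> g"
      \<comment> \<open>The coefficients of the \<open>m\<close> intertwiners over the
        \<open>g\<close> spanning ones. With \<open>m > g\<close> a kernel vector of this wide
        matrix is a linear dependency.\<close>
      define A where "A = mat g m (\<lambda>(i,j). t j (h i))"
      obtain v where v: "v \<in> carrier_vec m" "v \<noteq> 0\<^sub>v m" "A *\<^sub>v v = 0\<^sub>v g"
        using wide_mat_kernel[of A g m] \<open>\<not> m \<le> g\<close> by (auto simp: A_def)
      have vz: "(\<Sum>j<m. v $ j * t j k) = 0" if k: "k \<in> G" for k
      proof -
        obtain i where i: "i < g" "k = h i" using h k by (auto simp: bij_betw_def)
        have "(A *\<^sub>v v) $ i = (\<Sum>j<m. t j (h i) * v $ j)"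
          using i v(1) by (auto simp: A_def scalar_prod_def atLeast0LessThan)
        then show ?thesis using v(3) i by (simp add: mult.commute)
      qed
      have "msum d (dims c) (\<lambda>j. v $ j \<cdot>\<^sub>m Ts ! j) (length Ts) = mat_sum d (dims c) (\<lambda>j. v $ j \<cdot>\<^sub>m Ts ! j) {..<m}"
        unfolding Ts(1) by (intro msum_eq_mat_sum) (auto simp: t)
      also have "\<dots> = mat_sum d (dims c) (\<lambda>j. mat_sum d (dims c) (\<lambda>k. (v $ j * t j k) \<cdot>\<^sub>m W k) G) {..<m}"
        using GW by (intro mat_sum_cong eq_matI) (auto simp: t sum_distrib_left mult.assoc dest!: GW intro!: sum.cong)
      also have "\<dots> = mat_sum d (dims c) (\<lambda>k. mat_sum d (dims c) (\<lambda>j. (v $ j * t j k) \<cdot>\<^sub>m W k) {..<m}) G"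
        by (rule mat_sum_swap)
      also have "\<dots> = 0\<^sub>m d (dims c)"
      proof (rule mat_sum_zero)
        fix k assume k: "k \<in> G"
        show "mat_sum d (dims c) (\<lambda>j. (v $ j * t j k) \<cdot>\<^sub>m W k) {..<m} = 0\<^sub>m d (dims c)"
          unfolding mat_sum_scalars[OF GW[OF k]] vz[OF k] using GW[OF k] by (intro eq_matI) auto
      qed
      finally have "\<forall>i<length Ts. v $ i = 0" using Ts(3) unfolding mat_lin_indep_def by blast
      then have "v = 0\<^sub>v m" using v(1) Ts(1) by (intro eq_vecI) auto
      then show False using v(2) by simp
    qed
  qed
qed

end

section \<open>Tensor products of representations\<close>

lemma tensor_rep_mat_sum:
  assumes "is_rep_map n da rhoa" "is_rep_map n db rhob"
  shows "tensor_rep n Lam da rhoa db rhob I = mat_sum (da*db) (da*db)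
     (\<lambda>J. mat_sum (da*db) (da*db) (\<lambda>K. Lam I J K \<cdot>\<^sub>m kron (rhoa J) (rhob K)) {..<n}) {..<n}"
proof -
  have c: "kron (rhoa J) (rhob K) \<in> carrier_mat (da*db) (da*db)" if "J < n" "K < n" for J K
    using assms that by (intro kron_carrier) (auto simp: is_rep_map_def)
  have "msum (da*db) (da*db) (\<lambda>K. Lam I J K \<cdot>\<^sub>m kron (rhoa J) (rhob K)) n
      = mat_sum (da*db) (da*db) (\<lambda>K. Lam I J K \<cdot>\<^sub>m kron (rhoa J) (rhob K)) {..<n}" if "J < n" for J
    using c that by (intro msum_eq_mat_sum) auto
  then show ?thesis unfolding tensor_rep_def
    by (subst msum_eq_mat_sum) (auto intro!: mat_sum_cong)
qed

lemma tensor_rep_carrier: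
  assumes "is_rep_map n da rhoa" "is_rep_map n db rhob"
  shows "is_rep_map n (da*db) (tensor_rep n Lam da rhoa db rhob)"
  unfolding is_rep_map_def tensor_rep_mat_sum[OF assms] by auto

text \<open>Separates the representation of A (x) A from the coproduct. Product and star are checked
  here on all of A (x) A and then pulled back along \<open>DeltaA\<close>.\<close>

definition tensor_map :: "nat \<Rightarrow> nat \<Rightarrow> (nat \<Rightarrow> complex mat) \<Rightarrow> nat \<Rightarrow> (nat \<Rightarrow> complex mat) \<Rightarrow>
    (nat \<Rightarrow> nat \<Rightarrow> complex) \<Rightarrow> complex mat" where
  "tensor_map n da rhoa db rhob X = mat_sum (da*db) (da*db)
     (\<lambda>(J,K). X J K \<cdot>\<^sub>m kron (rhoa J) (rhob K)) ({..<n} \<times> {..<n})"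

lemma tensor_map_index:
  assumes "is_rep_map n da rhoa" "is_rep_map n db rhob" "i < da*db" "j < da*db"
  shows "tensor_map n da rhoa db rhob X $$ (i,j) =
    (\<Sum>J<n. \<Sum>K<n. X J K * (rhoa J $$ (i div db, j div db) * rhob K $$ (i mod db, j mod db)))"
proof -
  have c: "dim_row (rhoa J) = da" "dim_col (rhoa J) = da" "dim_row (rhob J) = db" "dim_col (rhob J) = db"
    if "J < n" for J
    using assms that by (auto simp: is_rep_map_def)
  show ?thesis unfolding tensor_map_def using assms(3,4)
    by (auto simp: sum.cartesian_product c kron_index intro!: sum.cong)
qed

lemma tensor_rep_eq_tensor_map:
  assumes "is_rep_map n da rhoa" "is_rep_map n db rhob"
  shows "tensor_rep n Lam da rhoa db rhob I = tensor_map n da rhoa db rhob (Lam I)"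
  unfolding tensor_rep_mat_sum[OF assms] tensor_map_def by (intro mat_sum_Sigma) auto

lemma kron_block_sum:
  assumes fin: "finite F" "finite F'"
    and V: "\<And>k. k \<in> F \<Longrightarrow> V k \<in> carrier_mat d (e k)" and V': "\<And>k. k \<in> F' \<Longrightarrow> V' k \<in> carrier_mat d' (e' k)"
    and g: "\<And>k. k \<in> F \<Longrightarrow> g k \<in> carrier_mat (e k) (e k)" and g': "\<And>k. k \<in> F' \<Longrightarrow> g' k \<in> carrier_mat (e' k) (e' k)"
  shows "kron (mat_sum d d (\<lambda>k. w k \<cdot>\<^sub>m (V k * g k * adj (V k))) F) (mat_sum d' d' (\<lambda>k. w' k \<cdot>\<^sub>m (V' k * g' k * adj (V' k))) F')
     = mat_sum (d*d') (d*d') (\<lambda>p. (w (fst p) * w' (snd p)) \<cdot>\<^sub>m (kron (V (fst p)) (V' (snd p))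
         * kron (g (fst p)) (g' (snd p)) * adj (kron (V (fst p)) (V' (snd p))))) (F \<times> F')"
proof -
  let ?A = "\<lambda>k. w k \<cdot>\<^sub>m (V k * g k * adj (V k))" and ?A' = "\<lambda>k. w' k \<cdot>\<^sub>m (V' k * g' k * adj (V' k))"
  have c: "?A k \<in> carrier_mat d d" if "k \<in> F" for k using conj_carrier[OF V[OF that] g[OF that]] by simp
  have c': "?A' k \<in> carrier_mat d' d'" if "k \<in> F'" for k using conj_carrier[OF V'[OF that] g'[OF that]] by simp
  have k: "kron (?A a) (?A' b) = (w a * w' b) \<cdot>\<^sub>m (kron (V a) (V' b) * kron (g a) (g' b) * adj (kron (V a) (V' b)))"
    if "a \<in> F" "b \<in> F'" for a b
  proof -
    note v = V[OF that(1)] V'[OF that(2)] and p = g[OF that(1)] g'[OF that(2)]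
    have "kron (V a * g a * adj (V a)) (V' b * g' b * adj (V' b)) = kron (V a * g a) (V' b * g' b) * adj (kron (V a) (V' b))"
      unfolding adj_kron
      using kron_mult[OF mult_carrier_mat[OF v(1) p(1)] mult_carrier_mat[OF v(2) p(2)] adj_carrier[OF v(1)] adj_carrier[OF v(2)]] by simp
    also have "kron (V a * g a) (V' b * g' b) = kron (V a) (V' b) * kron (g a) (g' b)"
      using kron_mult[OF v p] by simp
    finally show ?thesis by (simp add: kron_smult_left kron_smult_right smult_smult_mat mult.commute)
  qed
  have "kron (mat_sum d d ?A F) (mat_sum d' d' ?A' F') = mat_sum (d*d') (d*d') (\<lambda>a. kron (?A a) (mat_sum d' d' ?A' F')) F"
    using c by (intro kron_mat_sum_left) auto
  also have "\<dots> = mat_sum (d*d') (d*d') (\<lambda>a. mat_sum (d*d') (d*d') (\<lambda>b. kron (?A a) (?A' b)) F') F"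
    using c c' by (intro mat_sum_cong refl kron_mat_sum_right) auto
  also have "\<dots> = mat_sum (d*d') (d*d') (\<lambda>(a,b). kron (?A a) (?A' b)) (F \<times> F')"
    using fin by (intro mat_sum_Sigma) auto
  finally show ?thesis using k by (auto intro!: mat_sum_cong)
qed

text \<open>The tensor product distributes over block sums. Weights are included so that it covers
  the unweighted tensor product of decompositions as well as the two-site tensor, where every block
  carries its coefficient from \<open>b\<close>.\<close>

lemma tensor_map_block_sum:
  assumes fin: "finite F" "finite F'"
    and V: "\<And>k. k \<in> F \<Longrightarrow> V k \<in> carrier_mat d (e k)" and V': "\<And>k. k \<in> F' \<Longrightarrow> V' k \<in> carrier_mat d' (e' k)"
    and sigma: "\<And>k. k \<in> F \<Longrightarrow> is_rep_map n (e k) (sigma k)" and sigma': "\<And>k. k \<in> F' \<Longrightarrow> is_rep_map n (e' k) (sigma' k)"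
    and rho: "\<And>I. I < n \<Longrightarrow> rho I = mat_sum d d (\<lambda>k. w k \<cdot>\<^sub>m (V k * sigma k I * adj (V k))) F"
    and rho': "\<And>I. I < n \<Longrightarrow> rho' I = mat_sum d' d' (\<lambda>k. w' k \<cdot>\<^sub>m (V' k * sigma' k I * adj (V' k))) F'"
  shows "tensor_map n d rho d' rho' X = mat_sum (d*d') (d*d') (\<lambda>p. (w (fst p) * w' (snd p)) \<cdot>\<^sub>m
      (kron (V (fst p)) (V' (snd p)) * tensor_map n (e (fst p)) (sigma (fst p)) (e' (snd p)) (sigma' (snd p)) X
         * adj (kron (V (fst p)) (V' (snd p))))) (F \<times> F')"
proof -
  let ?N = "{..<n} \<times> {..<n}" and ?R = "F \<times> F'" and ?P = "d * d'"
  let ?J = "\<lambda>p. kron (V (fst p)) (V' (snd p))" and ?w = "\<lambda>p. w (fst p) * w' (snd p)"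
  let ?k = "\<lambda>p s. kron (sigma (fst p) (fst s)) (sigma' (snd p) (snd s))"
  have Jc: "?J p \<in> carrier_mat ?P (e (fst p) * e' (snd p))" if "p \<in> ?R" for p
    using that V V' by (intro kron_carrier) auto
  have kc: "?k p s \<in> carrier_mat (e (fst p) * e' (snd p)) (e (fst p) * e' (snd p))" if "p \<in> ?R" "s \<in> ?N" for p s
    using that sigma[of "fst p"] sigma'[of "snd p"] by (intro kron_carrier) (auto simp: is_rep_map_def)
  have cc: "?J p * ?k p s * adj (?J p) \<in> carrier_mat ?P ?P" if "p \<in> ?R" "s \<in> ?N" for p s
    using conj_carrier[OF Jc[OF that(1)] kc[OF that]] .
  have "tensor_map n d rho d' rho' X = mat_sum ?P ?P (\<lambda>s. mat_sum ?P ?P (\<lambda>p. ?w p \<cdot>\<^sub>m (X (fst s) (snd s) \<cdot>\<^sub>m (?J p * ?k p s * adj (?J p)))) ?R) ?N"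
    unfolding tensor_map_def
  proof (rule mat_sum_cong[OF refl])
    fix s assume s: "s \<in> ?N"
    have e: "kron (rho (fst s)) (rho' (snd s)) = mat_sum ?P ?P (\<lambda>p. ?w p \<cdot>\<^sub>m (?J p * ?k p s * adj (?J p))) ?R"
    proof -
      have s': "fst s < n" "snd s < n" using s by auto
      show ?thesis unfolding rho[OF s'(1)] rho'[OF s'(2)]
        using s' sigma sigma' by (intro kron_block_sum[OF fin V V']) (auto simp: is_rep_map_def)
    qed
    have "X (fst s) (snd s) \<cdot>\<^sub>m kron (rho (fst s)) (rho' (snd s))
       = mat_sum ?P ?P (\<lambda>p. X (fst s) (snd s) \<cdot>\<^sub>m (?w p \<cdot>\<^sub>m (?J p * ?k p s * adj (?J p)))) ?R"
      unfolding e by (rule mat_sum_smult[OF smult_carrier_mat[OF cc[OF _ s]]])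
    then show "(case s of (J,K) \<Rightarrow> X J K \<cdot>\<^sub>m kron (rho J) (rho' K))
       = mat_sum ?P ?P (\<lambda>p. ?w p \<cdot>\<^sub>m (X (fst s) (snd s) \<cdot>\<^sub>m (?J p * ?k p s * adj (?J p)))) ?R"
      by (simp add: case_prod_unfold smult_smult_mat mult.commute)
  qed
  also have "\<dots> = mat_sum ?P ?P (\<lambda>p. mat_sum ?P ?P (\<lambda>s. ?w p \<cdot>\<^sub>m (X (fst s) (snd s) \<cdot>\<^sub>m (?J p * ?k p s * adj (?J p)))) ?N) ?R"
    by (rule mat_sum_swap)
  also have "\<dots> = mat_sum ?P ?P (\<lambda>p. ?w p \<cdot>\<^sub>m
      (?J p * tensor_map n (e (fst p)) (sigma (fst p)) (e' (snd p)) (sigma' (snd p)) X * adj (?J p))) ?R"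
  proof (rule mat_sum_cong[OF refl])
    fix p assume p: "p \<in> ?R"
    have "mat_sum ?P ?P (\<lambda>s. ?w p \<cdot>\<^sub>m (X (fst s) (snd s) \<cdot>\<^sub>m (?J p * ?k p s * adj (?J p)))) ?N
       = ?w p \<cdot>\<^sub>m mat_sum ?P ?P (\<lambda>s. X (fst s) (snd s) \<cdot>\<^sub>m (?J p * ?k p s * adj (?J p))) ?N"
      by (rule mat_sum_smult[OF smult_carrier_mat[OF cc[OF p]], symmetric])
    also have "mat_sum ?P ?P (\<lambda>s. X (fst s) (snd s) \<cdot>\<^sub>m (?J p * ?k p s * adj (?J p))) ?N
       = ?J p * mat_sum (e (fst p) * e' (snd p)) (e (fst p) * e' (snd p)) (\<lambda>s. X (fst s) (snd s) \<cdot>\<^sub>m ?k p s) ?N * adj (?J p)"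
      by (rule conj_mat_sum[OF Jc[OF p] kc[OF p]])
    finally show "mat_sum ?P ?P (\<lambda>s. ?w p \<cdot>\<^sub>m (X (fst s) (snd s) \<cdot>\<^sub>m (?J p * ?k p s * adj (?J p)))) ?N
       = ?w p \<cdot>\<^sub>m (?J p * tensor_map n (e (fst p)) (sigma (fst p)) (e' (snd p)) (sigma' (snd p)) X * adj (?J p))"
      by (simp add: tensor_map_def case_prod_unfold)
  qed
  finally show ?thesis .
qed

lemma repA_tensor_rep:
  assumes rep: "is_rep_map n da rhoa" "is_rep_map n db rhob"
  shows "repA n (da*db) (tensor_rep n Lam da rhoa db rhob) x = tensor_map n da rhoa db rhob (DeltaA n Lam x)"
proof (intro eq_matI)
  have d: "tensor_map n da rhoa db rhob (DeltaA n Lam x) \<in> carrier_mat (da*db) (da*db)"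
    by (simp add: tensor_map_def)
  fix i j assume "i < dim_row (tensor_map n da rhoa db rhob (DeltaA n Lam x))"
    "j < dim_col (tensor_map n da rhoa db rhob (DeltaA n Lam x))"
  then have ij: "i < da*db" "j < da*db" using d by auto
  have c: "dim_row (rhoa J) = da" "dim_col (rhoa J) = da" "dim_row (rhob J) = db" "dim_col (rhob J) = db"
    if "J < n" for J
    using assms that by (auto simp: is_rep_map_def)
  let ?k = "\<lambda>J K. rhoa J $$ (i div db, j div db) * rhob K $$ (i mod db, j mod db)"
  have "repA n (da*db) (tensor_rep n Lam da rhoa db rhob) x $$ (i,j)
     = (\<Sum>I<n. x I * (\<Sum>J<n. \<Sum>K<n. Lam I J K * ?k J K))"
    using ij by (simp add: repA_mat_sum[OF tensor_rep_carrier[OF rep]] tensor_rep_mat_sum[OF rep] c kron_index)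
  also have "\<dots> = (\<Sum>J<n. \<Sum>K<n. \<Sum>I<n. x I * Lam I J K * ?k J K)"
    unfolding sum_distrib_left
    by (subst sum.swap, rule sum.cong[OF refl], subst sum.swap, simp add: mult.assoc)
  also have "\<dots> = tensor_map n da rhoa db rhob (DeltaA n Lam x) $$ (i,j)"
    unfolding tensor_map_index[OF rep ij] by (simp add: DeltaA_def sum_distrib_right)
  finally show "repA n (da*db) (tensor_rep n Lam da rhoa db rhob) x $$ (i,j)
     = tensor_map n da rhoa db rhob (DeltaA n Lam x) $$ (i,j)" .
qed (use repA_carrier[OF tensor_rep_carrier[OF rep]] in \<open>auto simp: tensor_map_def\<close>)

lemma six_sum_reorder:
  fixes f :: "nat \<Rightarrow> nat \<Rightarrow> nat \<Rightarrow> nat \<Rightarrow> nat \<Rightarrow> nat \<Rightarrow> complex"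
  shows "(\<Sum>a<n. \<Sum>b<n. \<Sum>c<n. \<Sum>d<n. \<Sum>p<n. \<Sum>q<n. f a b c d p q)
       = (\<Sum>p<n. \<Sum>q<n. \<Sum>a<n. \<Sum>b<n. \<Sum>c<n. \<Sum>d<n. f a b c d p q)"
  unfolding sum.cartesian_product
  by (rule sum.reindex_bij_witness[of _ "\<lambda>(p,q,a,b,c,d). (a,b,c,d,p,q)" "\<lambda>(a,b,c,d,p,q). (p,q,a,b,c,d)"]) auto

lemma four_sum_reorder:
  fixes f :: "nat \<Rightarrow> nat \<Rightarrow> nat \<Rightarrow> nat \<Rightarrow> complex"
  shows "(\<Sum>a<n. \<Sum>b<n. \<Sum>p<n. \<Sum>q<n. f a b p q) = (\<Sum>p<n. \<Sum>q<n. \<Sum>a<n. \<Sum>b<n. f a b p q)"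
  unfolding sum.cartesian_product
  by (rule sum.reindex_bij_witness[of _ "\<lambda>(p,q,a,b). (a,b,p,q)" "\<lambda>(a,b,p,q). (p,q,a,b)"]) auto

context star_irreps
begin

lemma Delta_mult: "inA n x \<Longrightarrow> inA n y \<Longrightarrow>
    DeltaA n Lam (mulA n mu x y) = mulAA n mu (DeltaA n Lam x) (DeltaA n Lam y)"
  and Delta_star: "inA n x \<Longrightarrow> DeltaA n Lam (starA n st x) = starAA n st (DeltaA n Lam x)"
  and Delta_coassoc: "inA n x \<Longrightarrow> Delta_Id n Lam (DeltaA n Lam x) = Id_Delta n Lam (DeltaA n Lam x)"
  using alg unfolding C_star_pre_bialgebra_def by simp_all

lemma star_rep_basis_mult:
  assumes rho: "star_rep d rho" and J: "J < n" and K: "K < n"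
  shows "rho J * rho K = mat_sum d d (\<lambda>P. mu J K P \<cdot>\<^sub>m rho P) {..<n}"
proof -
  have rep: "is_rep_map n d rho" using rho by (simp add: star_rep_def)
  have "rho J * rho K = repA n d rho (mulA n mu (basisA J) (basisA K))"
    using rho J K repA_basisA[OF rep] by (simp add: star_rep_def)
  also have "\<dots> = mat_sum d d (\<lambda>P. mu J K P \<cdot>\<^sub>m rho P) {..<n}"
    unfolding repA_mat_sum[OF rep]
  proof (rule mat_sum_cong[OF refl])
    fix P assume P: "P \<in> {..<n}"
    have b: "basisA M I * y = (if I = M then y else 0)" for M I y by (simp add: basisA_def)
    have "(\<Sum>I<n. \<Sum>L<n. basisA J I * basisA K L * mu I L P) = mu J K P"
    proof -
      have "(\<Sum>I<n. \<Sum>L<n. basisA J I * basisA K L * mu I L P) = (\<Sum>I<n. basisA J I * (\<Sum>L<n. basisA K L * mu I L P))"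
        unfolding sum_distrib_left by (simp add: mult.assoc)
      then show ?thesis using J K by (simp add: b)
    qed
    then show "mulA n mu (basisA J) (basisA K) P \<cdot>\<^sub>m rho P = mu J K P \<cdot>\<^sub>m rho P"
      using J K P by (simp add: mulA_def)
  qed
  finally show ?thesis .
qed

lemma star_rep_basis_adj:
  assumes rho: "star_rep d rho" and J: "J < n"
  shows "adj (rho J) = mat_sum d d (\<lambda>P. st J P \<cdot>\<^sub>m rho P) {..<n}"
proof -
  have rep: "is_rep_map n d rho" using rho by (simp add: star_rep_def)
  have "adj (rho J) = repA n d rho (starA n st (basisA J))"
    using rho J repA_basisA[OF rep] by (simp add: star_rep_def star_repA_def)
  also have "\<dots> = mat_sum d d (\<lambda>P. st J P \<cdot>\<^sub>m rho P) {..<n}"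
    unfolding repA_mat_sum[OF rep]
  proof (rule mat_sum_cong[OF refl])
    fix P assume P: "P \<in> {..<n}"
    have "(\<Sum>I<n. cnj (basisA J I) * st I P) = (\<Sum>I<n. if I = J then st J P else 0)"
      by (intro sum.cong) (auto simp: basisA_def)
    then show "starA n st (basisA J) P \<cdot>\<^sub>m rho P = st J P \<cdot>\<^sub>m rho P"
      using J P by (simp add: starA_def)
  qed
  finally show ?thesis .
qed

text \<open>The mixed product rule for \<open>kron\<close> separates the two factors; each is then
  expanded by the structure constants \<open>mu\<close>.\<close>

lemma tensor_map_mult:
  assumes a: "star_rep da rhoa" and b: "star_rep db rhob"
  shows "tensor_map n da rhoa db rhob X * tensor_map n da rhoa db rhob Y
     = tensor_map n da rhoa db rhob (mulAA n mu X Y)"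
proof (intro eq_matI)
  have rep: "is_rep_map n da rhoa" "is_rep_map n db rhob" using a b by (auto simp: star_rep_def)
  have c: "rhoa J \<in> carrier_mat da da" "rhob J \<in> carrier_mat db db" if "J < n" for J
    using rep that by (auto simp: is_rep_map_def)
  have cd: "dim_row (rhoa J) = da" "dim_col (rhoa J) = da" "dim_row (rhob J) = db" "dim_col (rhob J) = db"
    if "J < n" for J
    using c[OF that] by auto
  have kc: "kron (rhoa J) (rhob K) \<in> carrier_mat (da*db) (da*db)" if "J < n" "K < n" for J K
    using c that by auto
  let ?N = "{..<n}"
  fix i j assume "i < dim_row (tensor_map n da rhoa db rhob (mulAA n mu X Y))"
    "j < dim_col (tensor_map n da rhoa db rhob (mulAA n mu X Y))"
  then have ij: "i < da*db" "j < da*db" by (auto simp: tensor_map_def)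
  note ij' = div_mod_less[OF ij(1)] div_mod_less[OF ij(2)]
  let ?a = "\<lambda>P. rhoa P $$ (i div db, j div db)" and ?b = "\<lambda>P. rhob P $$ (i mod db, j mod db)"
  have prod: "tensor_map n da rhoa db rhob X * tensor_map n da rhoa db rhob Y
    = mat_sum (da*db) (da*db) (\<lambda>s. mat_sum (da*db) (da*db) (\<lambda>t. (case s of (J,K) \<Rightarrow> X J K \<cdot>\<^sub>m kron (rhoa J) (rhob K))
        * (case t of (J',K') \<Rightarrow> Y J' K' \<cdot>\<^sub>m kron (rhoa J') (rhob K'))) (?N \<times> ?N)) (?N \<times> ?N)"
    unfolding tensor_map_def using kc
    by (subst mat_sum_mult_right, force, force) (auto intro!: mat_sum_cong mat_sum_mult_left)
  have "(tensor_map n da rhoa db rhob X * tensor_map n da rhoa db rhob Y) $$ (i,j) = (\<Sum>J<n. \<Sum>K<n. \<Sum>J'<n. \<Sum>K'<n. \<Sum>P<n. \<Sum>Q<n.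
       X J K * Y J' K' * mu J J' P * mu K K' Q * (?a P * ?b Q))"
    (is "_ = ?S")
  proof -
    have e: "(X J K \<cdot>\<^sub>m kron (rhoa J) (rhob K) * (Y J' K' \<cdot>\<^sub>m kron (rhoa J') (rhob K'))) $$ (i,j)
        = (\<Sum>P<n. \<Sum>Q<n. X J K * Y J' K' * mu J J' P * mu K K' Q * (?a P * ?b Q))"
      if "J < n" "K < n" "J' < n" "K' < n" for J K J' K'
    proof -
      have "X J K \<cdot>\<^sub>m kron (rhoa J) (rhob K) * (Y J' K' \<cdot>\<^sub>m kron (rhoa J') (rhob K'))
         = (X J K * Y J' K') \<cdot>\<^sub>m (kron (rhoa J) (rhob K) * kron (rhoa J') (rhob K'))"
        using mult_smult_distrib[OF smult_carrier_mat[OF kc[OF that(1,2)]] kc[OF that(3,4)]]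
          mult_smult_assoc_mat[OF kc[OF that(1,2)] kc[OF that(3,4)]] 
        by (simp add: smult_smult_mat mult.commute)
      also have "kron (rhoa J) (rhob K) * kron (rhoa J') (rhob K') = kron (rhoa J * rhoa J') (rhob K * rhob K')"
        using c that by (intro kron_mult) auto
      also have "\<dots> = kron (mat_sum da da (\<lambda>P. mu J J' P \<cdot>\<^sub>m rhoa P) ?N) (mat_sum db db (\<lambda>Q. mu K K' Q \<cdot>\<^sub>m rhob Q) ?N)"
        using star_rep_basis_mult[OF a] star_rep_basis_mult[OF b] that by simp
      finally have "(X J K \<cdot>\<^sub>m kron (rhoa J) (rhob K) * (Y J' K' \<cdot>\<^sub>m kron (rhoa J') (rhob K'))) $$ (i,j)
         = X J K * Y J' K' * ((\<Sum>P<n. (mu J J' P \<cdot>\<^sub>m rhoa P) $$ (i div db, j div db)) * (\<Sum>Q<n. (mu K K' Q \<cdot>\<^sub>m rhob Q) $$ (i mod db, j mod db)))"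
        using ij ij' by (simp add: kron_index)
      also have "(\<Sum>P<n. (mu J J' P \<cdot>\<^sub>m rhoa P) $$ (i div db, j div db)) = (\<Sum>P<n. mu J J' P * ?a P)"
        using ij' by (intro sum.cong) (auto simp: cd)
      also have "(\<Sum>Q<n. (mu K K' Q \<cdot>\<^sub>m rhob Q) $$ (i mod db, j mod db)) = (\<Sum>Q<n. mu K K' Q * ?b Q)"
        using ij' by (intro sum.cong) (auto simp: cd)
      finally show ?thesis unfolding sum_product unfolding sum_distrib_left by (simp add: mult_ac)
    qed
    show ?thesis unfolding prod using ij e by (simp add: sum.cartesian_product')
  qed
  also have "?S = (\<Sum>P<n. \<Sum>Q<n. \<Sum>J<n. \<Sum>K<n. \<Sum>J'<n. \<Sum>K'<n.
       X J K * Y J' K' * mu J J' P * mu K K' Q * (?a P * ?b Q))"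
    by (rule six_sum_reorder[where f = "\<lambda>J K J' K' P Q. X J K * Y J' K' * mu J J' P * mu K K' Q * (?a P * ?b Q)"])
  also have "\<dots> = tensor_map n da rhoa db rhob (mulAA n mu X Y) $$ (i,j)"
    unfolding tensor_map_index[OF rep ij] by (simp add: mulAA_def sum_distrib_right)
  finally show "(tensor_map n da rhoa db rhob X * tensor_map n da rhoa db rhob Y) $$ (i,j)
     = tensor_map n da rhoa db rhob (mulAA n mu X Y) $$ (i,j)" .
qed (auto simp: tensor_map_def)

lemma tensor_map_adj:
  assumes a: "star_rep da rhoa" and b: "star_rep db rhob"
  shows "adj (tensor_map n da rhoa db rhob X) = tensor_map n da rhoa db rhob (starAA n st X)"
proof (intro eq_matI)
  have rep: "is_rep_map n da rhoa" "is_rep_map n db rhob" using a b by (auto simp: star_rep_def)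
  have c: "rhoa J \<in> carrier_mat da da" "rhob J \<in> carrier_mat db db" if "J < n" for J
    using rep that by (auto simp: is_rep_map_def)
  have cd: "dim_row (rhoa J) = da" "dim_col (rhoa J) = da" "dim_row (rhob J) = db" "dim_col (rhob J) = db"
    if "J < n" for J
    using c[OF that] by auto
  fix i j assume "i < dim_row (tensor_map n da rhoa db rhob (starAA n st X))"
    "j < dim_col (tensor_map n da rhoa db rhob (starAA n st X))"
  then have ij: "i < da*db" "j < da*db" by (auto simp: tensor_map_def)
  note ij' = div_mod_less[OF ij(1)] div_mod_less[OF ij(2)]
  let ?a = "\<lambda>P. rhoa P $$ (i div db, j div db)" and ?b = "\<lambda>P. rhob P $$ (i mod db, j mod db)"
  have ea: "cnj (rhoa J $$ (j div db, i div db)) = (\<Sum>P<n. st J P * ?a P)" if "J < n" for J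
  proof -
    have "cnj (rhoa J $$ (j div db, i div db)) = adj (rhoa J) $$ (i div db, j div db)"
      using ij' c[OF that] by auto
    also have "\<dots> = (\<Sum>P<n. st J P * ?a P)"
      unfolding star_rep_basis_adj[OF a that] using ij' by (auto simp: cd intro!: sum.cong)
    finally show ?thesis .
  qed
  have eb: "cnj (rhob J $$ (j mod db, i mod db)) = (\<Sum>P<n. st J P * ?b P)" if "J < n" for J
  proof -
    have "cnj (rhob J $$ (j mod db, i mod db)) = adj (rhob J) $$ (i mod db, j mod db)"
      using ij' c[OF that] by auto
    also have "\<dots> = (\<Sum>P<n. st J P * ?b P)"
      unfolding star_rep_basis_adj[OF b that] using ij' by (auto simp: cd intro!: sum.cong)
    finally show ?thesis .
  qed
  have "adj (tensor_map n da rhoa db rhob X) $$ (i,j) = cnj (tensor_map n da rhoa db rhob X $$ (j,i))"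
    using ij by (intro adj_index) (auto simp: tensor_map_def)
  also have "\<dots> = (\<Sum>J<n. \<Sum>K<n. cnj (X J K) * ((\<Sum>P<n. st J P * ?a P) * (\<Sum>Q<n. st K Q * ?b Q)))"
    unfolding tensor_map_index[OF rep ij(2,1)] by (simp add: ea eb)
  also have "\<dots> = (\<Sum>J<n. \<Sum>K<n. \<Sum>P<n. \<Sum>Q<n. cnj (X J K) * st J P * st K Q * (?a P * ?b Q))"
    unfolding sum_product unfolding sum_distrib_left by (simp add: mult_ac)
  also have "\<dots> = (\<Sum>P<n. \<Sum>Q<n. \<Sum>J<n. \<Sum>K<n. cnj (X J K) * st J P * st K Q * (?a P * ?b Q))"
    by (rule four_sum_reorder[where f = "\<lambda>J K P Q. cnj (X J K) * st J P * st K Q * (?a P * ?b Q)"])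
  also have "\<dots> = tensor_map n da rhoa db rhob (starAA n st X) $$ (i,j)"
    unfolding tensor_map_index[OF rep ij] by (simp add: starAA_def sum_distrib_right)
  finally show "adj (tensor_map n da rhoa db rhob X) $$ (i,j) = tensor_map n da rhoa db rhob (starAA n st X) $$ (i,j)" .
qed (auto simp: tensor_map_def)

text \<open>Composition of a *-homomorphism on A (x) A with the coproduct, which respects product
  and star.\<close>

lemma tensor_star_rep:
  assumes a: "star_rep da rhoa" and b: "star_rep db rhob"
  shows "star_rep (da*db) (tensor_rep n Lam da rhoa db rhob)"
proof -
  have rep: "is_rep_map n da rhoa" "is_rep_map n db rhob" using a b by (auto simp: star_rep_def)
  show ?thesis unfolding star_rep_def star_repA_def repA_tensor_rep[OF rep]
    using tensor_rep_carrier[OF rep] tensor_map_adj[OF a b] tensor_map_mult[OF a b] Delta_mult Delta_star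
    by auto
qed

text \<open>The summands \<open>sigma k\<close> of the given block sum may be reducible; decomposing
  each of them gives a decomposition of the whole, indexed by pairs.\<close>

lemma decomposes_compose:
  assumes V: "orthonormal_family d F e V"
    and rho: "\<And>I. I < n \<Longrightarrow> rho I = mat_sum d d (\<lambda>k. V k * sigma k I * adj (V k)) F"
    and dec: "\<And>k. k \<in> F \<Longrightarrow> decomposes (e k) (sigma k) (G k) (cc k) (W k)"
  shows "decomposes d rho (Sigma F G) (\<lambda>(k,l). cc k l) (\<lambda>(k,l). V k * W k l)"
proof -
  note D = decomposesD[OF dec] and fin = orthonormal_familyD(1)[OF V] and e = orthonormal_familyD(2)[OF V]
  have adjVW: "adj (V k * W k l) = adj (W k l) * adj (V k)" if "k \<in> F" "l \<in> G k" for k l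
    using e[OF that(1)] D(3)[OF that] by (rule adj_mult)
  show ?thesis
  proof (rule decomposesI)
    have "orthonormal_family d (Sigma F G) (\<lambda>(k,l). dims (cc k l)) (\<lambda>(k,l). V k * W k l)"
      by (rule orthonormal_family_compose[OF V decomposes_orthonormal[OF dec]])
    then show "orthonormal_family d (Sigma F G) (\<lambda>x. dims (case x of (k,l) \<Rightarrow> cc k l)) (\<lambda>(k,l). V k * W k l)"
      by (simp add: case_prod_unfold)
    show "(case x of (k,l) \<Rightarrow> cc k l) < r" if "x \<in> Sigma F G" for x using D(2) that by auto
    fix I assume I: "I < n"
    have pc: "phi (cc k l) I \<in> carrier_mat (dims (cc k l)) (dims (cc k l))" if "k \<in> F" "l \<in> G k" for k l
      using phi_carrier[OF D(2)[OF that] I] .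
    have m: "W k l * phi (cc k l) I * adj (W k l) \<in> carrier_mat (e k) (e k)" if "k \<in> F" "l \<in> G k" for k l
      using D(3)[OF that] pc[OF that] by (auto intro!: mult_carrier_mat[of _ _ "dims (cc k l)"])
    have "V k * sigma k I * adj (V k) = mat_sum d d (\<lambda>l. V k * W k l * phi (cc k l) I * adj (V k * W k l)) (G k)"
      if k: "k \<in> F" for k
    proof -
      have "V k * sigma k I = mat_sum d (e k) (\<lambda>l. V k * (W k l * phi (cc k l) I * adj (W k l))) (G k)"
        unfolding D(7)[OF k I] using m[OF k] e[OF k] by (intro mat_sum_mult_left) auto
      also have "\<dots> * adj (V k) = mat_sum d d (\<lambda>l. V k * (W k l * phi (cc k l) I * adj (W k l)) * adj (V k)) (G k)"
        using mult_carrier_mat[OF e[OF k] m[OF k]] e[OF k] by (intro mat_sum_mult_right) auto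
      also have "\<dots> = mat_sum d d (\<lambda>l. V k * W k l * phi (cc k l) I * adj (V k * W k l)) (G k)"
      proof (rule mat_sum_cong[OF refl])
        fix l assume l: "l \<in> G k"
        note Wc = D(3)[OF k l] and P = pc[OF k l] and Vc = e[OF k]
        have "V k * (W k l * phi (cc k l) I * adj (W k l)) = V k * (W k l * phi (cc k l) I) * adj (W k l)"
          using assoc_mult_mat[OF Vc mult_carrier_mat[OF Wc P] adj_carrier[OF Wc]] by simp
        also have "V k * (W k l * phi (cc k l) I) = V k * W k l * phi (cc k l) I"
          using assoc_mult_mat[OF Vc Wc P] by simp
        finally show "V k * (W k l * phi (cc k l) I * adj (W k l)) * adj (V k)
            = V k * W k l * phi (cc k l) I * adj (V k * W k l)"
          unfolding adjVW[OF k l]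
          using assoc_mult_mat[OF mult_carrier_mat[OF mult_carrier_mat[OF Vc Wc] P] adj_carrier[OF Wc] adj_carrier[OF Vc]]
          by simp
      qed
      finally show ?thesis .
    qed
    then have "rho I = mat_sum d d (\<lambda>k. mat_sum d d (\<lambda>l. V k * W k l * phi (cc k l) I * adj (V k * W k l)) (G k)) F"
      unfolding rho[OF I] by (intro mat_sum_cong) auto
    also have "\<dots> = mat_sum d d (\<lambda>(k,l). V k * W k l * phi (cc k l) I * adj (V k * W k l)) (Sigma F G)"
      using fin D(1) by (intro mat_sum_Sigma) auto
    finally show "rho I = mat_sum d d (\<lambda>x. (case x of (k,l) \<Rightarrow> V k * W k l) * phi (case x of (k,l) \<Rightarrow> cc k l) I
        * adj (case x of (k,l) \<Rightarrow> V k * W k l)) (Sigma F G)"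
      by (simp add: case_prod_unfold)
  qed
qed

text \<open>Decomposing both factors reduces the tensor product to products of irreducibles, whose
  decompositions \<open>U\<close> are supplied. The multiplicities of iterated tensor products are
  counted this way.\<close>

lemma tensor_decomposes:
  assumes dec: "decomposes d rho F cc W" "decomposes d' rho' F' cc' W'"
    and rep: "is_rep_map n d rho" "is_rep_map n d' rho'"
    and U: "\<And>k l. k \<in> F \<Longrightarrow> l \<in> F' \<Longrightarrow> decomposes (dims (cc k) * dims (cc' l))
        (tensor_rep n Lam (dims (cc k)) (phi (cc k)) (dims (cc' l)) (phi (cc' l))) (G (k,l)) (lab (k,l)) (U (k,l))"
  shows "decomposes (d * d') (tensor_rep n Lam d rho d' rho') (Sigma (F \<times> F') G)
     (\<lambda>(p,j). lab p j) (\<lambda>(p,j). kron (W (fst p)) (W' (snd p)) * U p j)"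
proof (rule decomposes_compose[OF orthonormal_family_kron[OF decomposes_orthonormal[OF dec(1)] decomposes_orthonormal[OF dec(2)]]])
  note D = decomposesD[OF dec(1)] and D' = decomposesD[OF dec(2)]
  fix I assume "I < n"
  let ?J = "\<lambda>p. kron (W (fst p)) (W' (snd p))"
  let ?t = "\<lambda>p. tensor_rep n Lam (dims (cc (fst p))) (phi (cc (fst p))) (dims (cc' (snd p))) (phi (cc' (snd p)))"
  have one: "(1::complex) \<cdot>\<^sub>m A = A" for A by (intro eq_matI) auto
  have "tensor_map n d rho d' rho' (Lam I) = mat_sum (d*d') (d*d') (\<lambda>p. (1 * 1) \<cdot>\<^sub>m (?J p
      * tensor_map n (dims (cc (fst p))) (phi (cc (fst p))) (dims (cc' (snd p))) (phi (cc' (snd p))) (Lam I) * adj (?J p))) (F \<times> F')"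
    using D D' phi_rep_map by (intro tensor_map_block_sum) (auto simp: one)
  also have "\<dots> = mat_sum (d*d') (d*d') (\<lambda>p. ?J p * ?t p I * adj (?J p)) (F \<times> F')"
    using D(2) D'(2) by (intro mat_sum_cong) (auto simp: one tensor_rep_eq_tensor_map phi_rep_map)
  finally show "tensor_rep n Lam d rho d' rho' I = mat_sum (d*d') (d*d') (\<lambda>p. ?J p * ?t p I * adj (?J p)) (F \<times> F')"
    by (simp add: tensor_rep_eq_tensor_map[OF rep])
next
  fix p assume "p \<in> F \<times> F'"
  then show "decomposes (dims (cc (fst p)) * dims (cc' (snd p)))
     (tensor_rep n Lam (dims (cc (fst p))) (phi (cc (fst p))) (dims (cc' (snd p))) (phi (cc' (snd p)))) (G p) (lab p) (U p)"
    using U[of "fst p" "snd p"] by auto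
qed

section \<open>Coassociativity and iterated tensor products\<close>

lemma Lam_coassoc:
  assumes "I < n" "P < n" "Q < n" "R < n"
  shows "(\<Sum>J<n. Lam I J R * Lam J P Q) = (\<Sum>K<n. Lam I P K * Lam K Q R)"
proof -
  have D: "DeltaA n Lam (basisA I) J K = Lam I J K" if "J < n" "K < n" for J K
  proof -
    have "(\<Sum>L<n. basisA I L * Lam L J K) = (\<Sum>L<n. if L = I then Lam I J K else 0)"
      by (intro sum.cong) (auto simp: basisA_def)
    then show ?thesis using that assms(1) by (simp add: DeltaA_def)
  qed
  have "Delta_Id n Lam (DeltaA n Lam (basisA I)) P Q R = Id_Delta n Lam (DeltaA n Lam (basisA I)) P Q R"
    using Delta_coassoc[of "basisA I"] assms(1) by simp
  then show ?thesis using assms D by (simp add: Delta_Id_def Id_Delta_def)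
qed

text \<open>Equality of matrices, beyond mere equivalence: coassociativity matches the coefficients
  and \<open>kron_assoc\<close> matches the matrices. The two intertwiner spaces compared in the
  associativity of fusion are therefore the same set.\<close>

lemma tensor_rep_assoc:
  assumes rep: "is_rep_map n da rhoa" "is_rep_map n db rhob" "is_rep_map n dc rhoc" and I: "I < n"
  shows "tensor_rep n Lam (da*db) (tensor_rep n Lam da rhoa db rhob) dc rhoc I
       = tensor_rep n Lam da rhoa (db*dc) (tensor_rep n Lam db rhob dc rhoc) I"
proof -
  let ?D = "da*db*dc" and ?N = "{..<n}"
  have c: "rhoa J \<in> carrier_mat da da" "rhob J \<in> carrier_mat db db" "rhoc J \<in> carrier_mat dc dc" if "J < n" for J
    using rep that by (auto simp: is_rep_map_def)
  let ?k = "\<lambda>P Q R. kron (rhoa P) (kron (rhob Q) (rhoc R))"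
  have kc: "?k P Q R \<in> carrier_mat ?D ?D" if "P < n" "Q < n" "R < n" for P Q R
    using c that by (auto simp: mult.assoc)
  have L: "x \<cdot>\<^sub>m kron (tensor_rep n Lam da rhoa db rhob J) (rhoc R)
      = mat_sum ?D ?D (\<lambda>P. mat_sum ?D ?D (\<lambda>Q. (x * Lam J P Q) \<cdot>\<^sub>m ?k P Q R) ?N) ?N" if R: "R < n" for x J R
  proof -
    have kc1: "kron (rhoa P) (rhob Q) \<in> carrier_mat (da*db) (da*db)" if "P < n" "Q < n" for P Q using c that by auto
    have "kron (tensor_rep n Lam da rhoa db rhob J) (rhoc R) = mat_sum ?D ?D (\<lambda>P. mat_sum ?D ?D
        (\<lambda>Q. kron (Lam J P Q \<cdot>\<^sub>m kron (rhoa P) (rhob Q)) (rhoc R)) ?N) ?N"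
      unfolding tensor_rep_mat_sum[OF rep(1,2)] using c(3)[OF R] kc1
      by (subst kron_mat_sum_left) (auto intro!: mat_sum_cong kron_mat_sum_left)
    also have "\<dots> = mat_sum ?D ?D (\<lambda>P. mat_sum ?D ?D (\<lambda>Q. Lam J P Q \<cdot>\<^sub>m ?k P Q R) ?N) ?N"
      by (simp add: kron_smult_left kron_assoc)
    finally have e: "kron (tensor_rep n Lam da rhoa db rhob J) (rhoc R)
      = mat_sum ?D ?D (\<lambda>P. mat_sum ?D ?D (\<lambda>Q. Lam J P Q \<cdot>\<^sub>m ?k P Q R) ?N) ?N" .
    show ?thesis unfolding e using kc R by (intro mat_sum_smult2) auto
  qed
  have Rr: "x \<cdot>\<^sub>m kron (rhoa P) (tensor_rep n Lam db rhob dc rhoc K)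
      = mat_sum ?D ?D (\<lambda>Q. mat_sum ?D ?D (\<lambda>R. (x * Lam K Q R) \<cdot>\<^sub>m ?k P Q R) ?N) ?N" if P: "P < n" for x P K
  proof -
    have kc1: "kron (rhob P) (rhoc Q) \<in> carrier_mat (db*dc) (db*dc)" if "P < n" "Q < n" for P Q using c that by auto
    have "kron (rhoa P) (tensor_rep n Lam db rhob dc rhoc K) = mat_sum (da*(db*dc)) (da*(db*dc)) (\<lambda>Q. mat_sum (da*(db*dc)) (da*(db*dc))
        (\<lambda>R. kron (rhoa P) (Lam K Q R \<cdot>\<^sub>m kron (rhob Q) (rhoc R))) ?N) ?N"
      unfolding tensor_rep_mat_sum[OF rep(2,3)] using c(1)[OF P] kc1
      by (subst kron_mat_sum_right) (auto intro!: mat_sum_cong kron_mat_sum_right)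
    also have "\<dots> = mat_sum ?D ?D (\<lambda>Q. mat_sum ?D ?D (\<lambda>R. Lam K Q R \<cdot>\<^sub>m ?k P Q R) ?N) ?N"
      by (simp add: kron_smult_right mult.assoc)
    finally have e: "kron (rhoa P) (tensor_rep n Lam db rhob dc rhoc K)
      = mat_sum ?D ?D (\<lambda>Q. mat_sum ?D ?D (\<lambda>R. Lam K Q R \<cdot>\<^sub>m ?k P Q R) ?N) ?N" .
    show ?thesis unfolding e using kc P by (intro mat_sum_smult2) auto
  qed
  have "tensor_rep n Lam (da*db) (tensor_rep n Lam da rhoa db rhob) dc rhoc I
     = mat_sum ?D ?D (\<lambda>J. mat_sum ?D ?D (\<lambda>R. mat_sum ?D ?D (\<lambda>P. mat_sum ?D ?D (\<lambda>Q. (Lam I J R * Lam J P Q) \<cdot>\<^sub>m ?k P Q R) ?N) ?N) ?N) ?N"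
    unfolding tensor_rep_mat_sum[OF tensor_rep_carrier[OF rep(1,2)] rep(3)]
    using L by (intro mat_sum_cong) auto
  also have "\<dots> = mat_sum ?D ?D (\<lambda>P. mat_sum ?D ?D (\<lambda>K. mat_sum ?D ?D (\<lambda>Q. mat_sum ?D ?D (\<lambda>R. (Lam I P K * Lam K Q R) \<cdot>\<^sub>m ?k P Q R) ?N) ?N) ?N) ?N"
  proof (intro eq_matI)
    fix i j assume "i < dim_row (mat_sum ?D ?D (\<lambda>P. mat_sum ?D ?D (\<lambda>K. mat_sum ?D ?D (\<lambda>Q. mat_sum ?D ?D (\<lambda>R. (Lam I P K * Lam K Q R) \<cdot>\<^sub>m ?k P Q R) ?N) ?N) ?N) ?N)"
      "j < dim_col (mat_sum ?D ?D (\<lambda>P. mat_sum ?D ?D (\<lambda>K. mat_sum ?D ?D (\<lambda>Q. mat_sum ?D ?D (\<lambda>R. (Lam I P K * Lam K Q R) \<cdot>\<^sub>m ?k P Q R) ?N) ?N) ?N) ?N)"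
    then have ij: "i < ?D" "j < ?D" by auto
    have e: "(x \<cdot>\<^sub>m ?k P Q R) $$ (i,j) = x * ?k P Q R $$ (i,j)" if "P < n" "Q < n" "R < n" for x P Q R
      using ij by (intro index_smult_mat(1)) (simp_all only: carrier_matD[OF kc[OF that]])
    \<comment> \<open>Both bracketings carry the same matrix for each triple \<open>P\<close>,
      \<open>Q\<close>, \<open>R\<close>. Moving the remaining summation innermost exposes the
      scalar coefficient to which \<open>Lam_coassoc\<close> applies.\<close>
    have "(\<Sum>J<n. \<Sum>R<n. \<Sum>P<n. \<Sum>Q<n. (Lam I J R * Lam J P Q) * ?k P Q R $$ (i,j))
        = (\<Sum>P<n. \<Sum>Q<n. \<Sum>R<n. \<Sum>J<n. (Lam I J R * Lam J P Q) * ?k P Q R $$ (i,j))"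
      unfolding sum.cartesian_product
      by (rule sum.reindex_bij_witness[of _ "\<lambda>(P,Q,R,J). (J,R,P,Q)" "\<lambda>(J,R,P,Q). (P,Q,R,J)"]) auto
    also have "\<dots> = (\<Sum>P<n. \<Sum>Q<n. \<Sum>R<n. \<Sum>K<n. (Lam I P K * Lam K Q R) * ?k P Q R $$ (i,j))"
    proof (rule sum.cong[OF refl], rule sum.cong[OF refl], rule sum.cong[OF refl])
      fix P Q R assume "P \<in> ?N" "Q \<in> ?N" "R \<in> ?N"
      then show "(\<Sum>J<n. Lam I J R * Lam J P Q * ?k P Q R $$ (i,j)) = (\<Sum>K<n. Lam I P K * Lam K Q R * ?k P Q R $$ (i,j))"
        unfolding sum_distrib_right[symmetric] using Lam_coassoc[OF I, of P Q R] by simp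
    qed
    also have "\<dots> = (\<Sum>P<n. \<Sum>K<n. \<Sum>Q<n. \<Sum>R<n. (Lam I P K * Lam K Q R) * ?k P Q R $$ (i,j))"
      unfolding sum.cartesian_product
      by (rule sum.reindex_bij_witness[of _ "\<lambda>(P,K,Q,R). (P,Q,R,K)" "\<lambda>(P,Q,R,K). (P,K,Q,R)"]) auto
    finally show "mat_sum ?D ?D (\<lambda>J. mat_sum ?D ?D (\<lambda>R. mat_sum ?D ?D (\<lambda>P. mat_sum ?D ?D (\<lambda>Q. (Lam I J R * Lam J P Q) \<cdot>\<^sub>m ?k P Q R) ?N) ?N) ?N) ?N $$ (i,j)
      = mat_sum ?D ?D (\<lambda>P. mat_sum ?D ?D (\<lambda>K. mat_sum ?D ?D (\<lambda>Q. mat_sum ?D ?D (\<lambda>R. (Lam I P K * Lam K Q R) \<cdot>\<^sub>m ?k P Q R) ?N) ?N) ?N) ?N $$ (i,j)"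
      using ij by (simp add: e)
  qed auto
  also have "\<dots> = tensor_rep n Lam da rhoa (db*dc) (tensor_rep n Lam db rhob dc rhoc) I"
    unfolding tensor_rep_mat_sum[OF rep(1) tensor_rep_carrier[OF rep(2,3)]] mult.assoc[symmetric]
    using Rr by (intro mat_sum_cong) auto
  finally show ?thesis .
qed

end

section \<open>Channels between block decompositions\<close>

lemma orthonormal_family_mult_left:
  assumes Y: "orthonormal_family D F e Y" and g: "\<And>k. k \<in> F \<Longrightarrow> g k \<in> carrier_mat (e k) (e k)" and l: "l \<in> F"
  shows "adj (Y l) * mat_sum D D (\<lambda>k. w k \<cdot>\<^sub>m (Y k * g k * adj (Y k))) F = w l \<cdot>\<^sub>m (g l * adj (Y l))"
proof -
  note D = orthonormal_familyD[OF Y]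
  have gY: "g k * adj (Y k) \<in> carrier_mat (e k) D" if "k \<in> F" for k
    using g[OF that] adj_carrier[OF D(2)[OF that]] by (rule mult_carrier_mat)
  have c: "w k \<cdot>\<^sub>m (Y k * g k * adj (Y k)) \<in> carrier_mat D D" if "k \<in> F" for k
    using conj_carrier[OF D(2)[OF that] g[OF that]] by simp
  have eq: "adj (Y l) * (w k \<cdot>\<^sub>m (Y k * g k * adj (Y k))) = w k \<cdot>\<^sub>m (adj (Y l) * Y k * (g k * adj (Y k)))" if "k \<in> F" for k
  proof -
    have "Y k * g k * adj (Y k) = Y k * (g k * adj (Y k))"
      using D(2)[OF that] g[OF that] adj_carrier[OF D(2)[OF that]] by (rule assoc_mult_mat)
    moreover have "adj (Y l) * (Y k * (g k * adj (Y k))) = adj (Y l) * Y k * (g k * adj (Y k))"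
      using assoc_mult_mat[OF adj_carrier[OF D(2)[OF l]] D(2)[OF that] gY[OF that]] by simp
    moreover have "adj (Y l) * (w k \<cdot>\<^sub>m (Y k * g k * adj (Y k))) = w k \<cdot>\<^sub>m (adj (Y l) * (Y k * g k * adj (Y k)))"
      using adj_carrier[OF D(2)[OF l]] conj_carrier[OF D(2)[OF that] g[OF that]] by (rule mult_smult_distrib)
    ultimately show ?thesis by simp
  qed
  have "adj (Y l) * mat_sum D D (\<lambda>k. w k \<cdot>\<^sub>m (Y k * g k * adj (Y k))) F
     = mat_sum (e l) D (\<lambda>k. adj (Y l) * (w k \<cdot>\<^sub>m (Y k * g k * adj (Y k)))) F"
    using c adj_carrier[OF D(2)[OF l]] by (rule mat_sum_mult_left)
  also have "\<dots> = adj (Y l) * (w l \<cdot>\<^sub>m (Y l * g l * adj (Y l)))"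
  proof (rule mat_sum_single[OF D(1) l])
    show "adj (Y l) * (w l \<cdot>\<^sub>m (Y l * g l * adj (Y l))) \<in> carrier_mat (e l) D"
      using adj_carrier[OF D(2)[OF l]] c[OF l] by (rule mult_carrier_mat)
    fix k assume k: "k \<in> F" "k \<noteq> l"
    show "adj (Y l) * (w k \<cdot>\<^sub>m (Y k * g k * adj (Y k))) = 0\<^sub>m (e l) D"
      unfolding eq[OF k(1)] D(4)[OF l k(1) k(2)[symmetric]] left_mult_zero_mat[OF gY[OF k(1)]] by simp
  qed
  also have "\<dots> = w l \<cdot>\<^sub>m (g l * adj (Y l))" unfolding eq[OF l] D(3)[OF l] left_mult_one_mat[OF gY[OF l]] ..
  finally show ?thesis .
qed

text \<open>Compression to the \<open>l\<close>-th range reads off the \<open>l\<close>-th block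
  with its weight; both channels recover their input data this way.\<close>

lemma orthonormal_family_sandwich:
  assumes Y: "orthonormal_family D F e Y" and g: "\<And>k. k \<in> F \<Longrightarrow> g k \<in> carrier_mat (e k) (e k)" and l: "l \<in> F"
  shows "adj (Y l) * mat_sum D D (\<lambda>k. w k \<cdot>\<^sub>m (Y k * g k * adj (Y k))) F * Y l = w l \<cdot>\<^sub>m g l"
proof -
  note D = orthonormal_familyD[OF Y]
  have "adj (Y l) * mat_sum D D (\<lambda>k. w k \<cdot>\<^sub>m (Y k * g k * adj (Y k))) F * Y l = w l \<cdot>\<^sub>m (g l * adj (Y l)) * Y l"
    using orthonormal_family_mult_left[of D F e Y g l w, OF Y g l] by simp
  also have "\<dots> = w l \<cdot>\<^sub>m (g l * adj (Y l) * Y l)"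
    using mult_carrier_mat[OF g[OF l] adj_carrier[OF D(2)[OF l]]] D(2)[OF l] by (rule mult_smult_assoc_mat)
  also have "g l * adj (Y l) * Y l = g l * (adj (Y l) * Y l)"
    using g[OF l] adj_carrier[OF D(2)[OF l]] D(2)[OF l] by (rule assoc_mult_mat)
  also have "\<dots> = g l" unfolding D(3)[OF l] using g[OF l] by (rule right_mult_one_mat)
  finally show ?thesis .
qed

lemma mat_sum_group:
  assumes fin: "finite F" and cc: "\<And>k. k \<in> F \<Longrightarrow> cc k < r" and G: "\<And>c. c < r \<Longrightarrow> G c \<in> carrier_mat d d"
  shows "mat_sum d d (\<lambda>k. a k \<cdot>\<^sub>m G (cc k)) F = mat_sum d d (\<lambda>c::nat. (\<Sum>k\<in>{k\<in>F. cc k = c}. a k) \<cdot>\<^sub>m G c) {..<r}"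
proof (intro eq_matI)
  fix i j assume "i < dim_row (mat_sum d d (\<lambda>c. (\<Sum>k\<in>{k\<in>F. cc k = c}. a k) \<cdot>\<^sub>m G c) {..<r})"
    "j < dim_col (mat_sum d d (\<lambda>c. (\<Sum>k\<in>{k\<in>F. cc k = c}. a k) \<cdot>\<^sub>m G c) {..<r})"
  then have ij: "i < d" "j < d" by auto
  have e: "(x \<cdot>\<^sub>m G c) $$ (i,j) = x * G c $$ (i,j)" if "c < r" for x c using G[OF that] ij by auto
  have "(\<Sum>k\<in>F. a k * G (cc k) $$ (i,j)) = (\<Sum>c<r. \<Sum>k\<in>{k\<in>F. cc k = c}. a k * G (cc k) $$ (i,j))"
    using cc by (intro sum.group[symmetric] fin) auto
  also have "\<dots> = (\<Sum>c<r. (\<Sum>k\<in>{k\<in>F. cc k = c}. a k) * G c $$ (i,j))"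
    by (simp add: sum_distrib_right)
  finally show "mat_sum d d (\<lambda>k. a k \<cdot>\<^sub>m G (cc k)) F $$ (i,j)
      = mat_sum d d (\<lambda>c. (\<Sum>k\<in>{k\<in>F. cc k = c}. a k) \<cdot>\<^sub>m G c) {..<r} $$ (i,j)"
    using ij by (simp add: e cc)
qed auto

text \<open>Allows Kraus operators indexed by any finite set, here by pairs of labels with a
  multiplicity index and by a disjoint sum.\<close>

lemma quantum_channelI:
  assumes fin: "finite F" and K: "\<And>k. k \<in> F \<Longrightarrow> K k \<in> carrier_mat dout din"
    and tp: "mat_sum din din (\<lambda>k. adj (K k) * K k) F = 1\<^sub>m din"
  shows "quantum_channel din dout (\<lambda>X. mat_sum dout dout (\<lambda>k. K k * X * adj (K k)) F)"
proof -
  obtain h where h: "bij_betw h {..<card F} F" using ex_bij_betw_nat_finite[OF fin] by (auto simp: atLeast0LessThan)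
  have Kh: "K (h i) \<in> carrier_mat dout din" if "i < card F" for i
    using h that K by (auto simp: bij_betw_def)
  have "msum din din (\<lambda>i. adj (K (h i)) * K (h i)) (card F) = mat_sum din din (\<lambda>i. adj (K (h i)) * K (h i)) {..<card F}"
    using Kh by (intro msum_eq_mat_sum mult_carrier_mat[of _ _ dout]) auto
  also have "\<dots> = 1\<^sub>m din" using mat_sum_bij_betw[OF h, of din din "\<lambda>k. adj (K k) * K k"] tp by simp
  finally have 1: "msum din din (\<lambda>i. adj (K (h i)) * K (h i)) (card F) = 1\<^sub>m din" .
  have 2: "mat_sum dout dout (\<lambda>k. K k * X * adj (K k)) F
      = msum dout dout (\<lambda>i. K (h i) * X * adj (K (h i))) (card F)" if "X \<in> carrier_mat din din" for X
  proof -
    have "msum dout dout (\<lambda>i. K (h i) * X * adj (K (h i))) (card F) = mat_sum dout dout (\<lambda>i. K (h i) * X * adj (K (h i))) {..<card F}"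
      using Kh that by (intro msum_eq_mat_sum mult_carrier_mat[of _ _ din]) auto
    then show ?thesis using mat_sum_bij_betw[OF h, of dout dout "\<lambda>k. K k * X * adj (K k)"] by simp
  qed
  show ?thesis unfolding quantum_channel_def
    using 1 2 Kh by (intro exI[of _ "card F"] exI[of _ "\<lambda>i. K (h i)"]) auto
qed

lemma conj_product:
  assumes A: "A \<in> carrier_mat d e" and B: "B \<in> carrier_mat d' e" and X: "X \<in> carrier_mat d d"
  shows "(B * adj A) * X * adj (B * adj A) = B * (adj A * X * A) * adj B"
proof -
  note A' = adj_carrier[OF A] and B' = adj_carrier[OF B]
  have "adj (B * adj A) = A * adj B" using adj_mult[OF B A'] by simp
  then have "(B * adj A) * X * adj (B * adj A) = B * adj A * X * (A * adj B)" by simp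
  also have "\<dots> = B * (adj A * X) * (A * adj B)" using assoc_mult_mat[OF B A' X] by simp
  also have "\<dots> = B * (adj A * X) * A * adj B"
    using assoc_mult_mat[OF mult_carrier_mat[OF B mult_carrier_mat[OF A' X]] A B'] by simp
  also have "B * (adj A * X) * A = B * (adj A * X * A)" using B mult_carrier_mat[OF A' X] A by (rule assoc_mult_mat)
  finally show ?thesis .
qed

lemma adj_product_self:
  assumes A: "A \<in> carrier_mat d e" and B: "B \<in> carrier_mat d' e" and iso: "adj B * B = 1\<^sub>m e"
  shows "adj (B * adj A) * (B * adj A) = A * adj A"
proof -
  note A' = adj_carrier[OF A] and B' = adj_carrier[OF B]
  have "adj (B * adj A) * (B * adj A) = A * adj B * (B * adj A)" using adj_mult[OF B A'] by simp
  also have "\<dots> = A * (adj B * (B * adj A))" using A B' mult_carrier_mat[OF B A'] by (rule assoc_mult_mat)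
  also have "adj B * (B * adj A) = adj B * B * adj A" using assoc_mult_mat[OF B' B A'] by simp
  also have "\<dots> = adj A" unfolding iso using A' by (rule left_mult_one_mat)
  finally show ?thesis .
qed

text \<open>Outside the span of the \<open>Y k\<close>, where the second block matrix vanishes, the backward channel
  resets to a fixed basis state; this is why \<open>P = 0\<close> has to force \<open>D = 0\<close>.\<close>

lemma block_channels_exist:
  fixes \<beta> :: "nat \<Rightarrow> real" and w :: "'k \<Rightarrow> real"
  assumes io: "orthonormal_family P {..<r} e iota" and Y: "orthonormal_family D F (\<lambda>k. e (cc k)) Y"
    and full: "mat_sum P P (\<lambda>c. iota c * adj (iota c)) {..<r} = 1\<^sub>m P"
    and cc: "\<And>k. k \<in> F \<Longrightarrow> cc k < r"
    and beta: "\<And>c. c < r \<Longrightarrow> \<beta> c > 0" and w: "\<And>k. k \<in> F \<Longrightarrow> w k \<ge> 0"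
    and weights: "\<And>c. c < r \<Longrightarrow> (\<Sum>k\<in>{k\<in>F. cc k = c}. w k) = \<beta> c"
    and P0: "P = 0 \<Longrightarrow> D = 0"
  shows "\<exists>T S. quantum_channel P D T \<and> quantum_channel D P S
    \<and> (\<forall>g. (\<forall>c<r. g c \<in> carrier_mat (e c) (e c)) \<longrightarrow>
         T (mat_sum P P (\<lambda>c. complex_of_real (\<beta> c) \<cdot>\<^sub>m (iota c * g c * adj (iota c))) {..<r})
           = mat_sum D D (\<lambda>k. complex_of_real (w k) \<cdot>\<^sub>m (Y k * g (cc k) * adj (Y k))) F
       \<and> S (mat_sum D D (\<lambda>k. complex_of_real (w k) \<cdot>\<^sub>m (Y k * g (cc k) * adj (Y k))) F)
           = mat_sum P P (\<lambda>c. complex_of_real (\<beta> c) \<cdot>\<^sub>m (iota c * g c * adj (iota c))) {..<r})"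
proof -
  note I = orthonormal_familyD[OF io] and YD = orthonormal_familyD[OF Y]
  have ik: "iota (cc k) \<in> carrier_mat P (e (cc k))" "adj (iota (cc k)) * iota (cc k) = 1\<^sub>m (e (cc k))" if "k \<in> F" for k
    using I cc[OF that] by auto
  have ii: "iota c * adj (iota c) \<in> carrier_mat P P" if "c < r" for c
    using I(2)[of c] that by (auto intro!: mult_carrier_mat[of _ P "e c"])
  \<comment> \<open>The forward channel reads block \<open>c\<close> and distributes it over its
    copies \<open>k\<close> with probabilities \<open>w k / \<beta> c\<close>; these sum to 1 by
    \<open>weights\<close>, which gives trace preservation.\<close>
  define s where "s = (\<lambda>k. sqrt (w k / \<beta> (cc k)))"
  have s2: "complex_of_real (s k) * complex_of_real (s k) = complex_of_real (w k / \<beta> (cc k))" if "k \<in> F" for k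
    using w[OF that] beta[OF cc[OF that]] by (simp add: s_def flip: of_real_mult)
  define K where "K = (\<lambda>k. complex_of_real (s k) \<cdot>\<^sub>m (Y k * adj (iota (cc k))))"
  have YI: "Y k * adj (iota (cc k)) \<in> carrier_mat D P" if "k \<in> F" for k
    using YD(2)[OF that] adj_carrier[OF ik(1)[OF that]] by (rule mult_carrier_mat)
  have Kc: "K k \<in> carrier_mat D P" if "k \<in> F" for k using YI[OF that] by (simp add: K_def)
  have adjK: "adj (K k) = complex_of_real (s k) \<cdot>\<^sub>m adj (Y k * adj (iota (cc k)))" for k
    by (simp add: K_def adj_smult)
  have KK: "adj (K k) * K k = complex_of_real (w k / \<beta> (cc k)) \<cdot>\<^sub>m (iota (cc k) * adj (iota (cc k)))" if k: "k \<in> F" for k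
  proof -
    have "adj (K k) * K k = complex_of_real (s k) \<cdot>\<^sub>m (adj (Y k * adj (iota (cc k))) * K k)"
      unfolding adjK using adj_carrier[OF YI[OF k]] Kc[OF k] by (rule mult_smult_assoc_mat)
    also have "adj (Y k * adj (iota (cc k))) * K k = complex_of_real (s k) \<cdot>\<^sub>m (adj (Y k * adj (iota (cc k))) * (Y k * adj (iota (cc k))))"
      unfolding K_def using adj_carrier[OF YI[OF k]] YI[OF k] by (rule mult_smult_distrib)
    also have "adj (Y k * adj (iota (cc k))) * (Y k * adj (iota (cc k))) = iota (cc k) * adj (iota (cc k))"
      using ik(1)[OF k] YD(2)[OF k] YD(3)[OF k] by (rule adj_product_self)
    finally show ?thesis by (simp only: smult_smult_mat s2[OF k])
  qed
  have KX: "K k * X * adj (K k) = complex_of_real (w k / \<beta> (cc k)) \<cdot>\<^sub>m (Y k * (adj (iota (cc k)) * X * iota (cc k)) * adj (Y k))"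
    if k: "k \<in> F" and X: "X \<in> carrier_mat P P" for k X
  proof -
    have "K k * X = complex_of_real (s k) \<cdot>\<^sub>m (Y k * adj (iota (cc k)) * X)"
      unfolding K_def using YI[OF k] X by (rule mult_smult_assoc_mat)
    then have "K k * X * adj (K k) = complex_of_real (s k) \<cdot>\<^sub>m (Y k * adj (iota (cc k)) * X * adj (K k))"
      using mult_smult_assoc_mat[OF mult_carrier_mat[OF YI[OF k] X] adj_carrier[OF Kc[OF k]]] by simp
    also have "Y k * adj (iota (cc k)) * X * adj (K k) = complex_of_real (s k) \<cdot>\<^sub>m (Y k * adj (iota (cc k)) * X * adj (Y k * adj (iota (cc k))))"
      unfolding adjK using mult_carrier_mat[OF YI[OF k] X] adj_carrier[OF YI[OF k]] by (rule mult_smult_distrib)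
    also have "Y k * adj (iota (cc k)) * X * adj (Y k * adj (iota (cc k))) = Y k * (adj (iota (cc k)) * X * iota (cc k)) * adj (Y k)"
      using ik(1)[OF k] YD(2)[OF k] X by (rule conj_product)
    finally show ?thesis by (simp only: smult_smult_mat s2[OF k])
  qed
  define T where "T = (\<lambda>X. mat_sum D D (\<lambda>k. K k * X * adj (K k)) F)"
  have T: "quantum_channel P D T" unfolding T_def
  proof (rule quantum_channelI[OF YD(1) Kc])
    have "mat_sum P P (\<lambda>k. adj (K k) * K k) F
       = mat_sum P P (\<lambda>k. complex_of_real (w k / \<beta> (cc k)) \<cdot>\<^sub>m (iota (cc k) * adj (iota (cc k)))) F"
      using KK by (intro mat_sum_cong) auto
    also have "\<dots> = mat_sum P P (\<lambda>c. (\<Sum>k\<in>{k\<in>F. cc k = c}. complex_of_real (w k / \<beta> (cc k))) \<cdot>\<^sub>m (iota c * adj (iota c))) {..<r}"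
      by (rule mat_sum_group[OF YD(1) cc ii])
    also have "\<dots> = mat_sum P P (\<lambda>c. iota c * adj (iota c)) {..<r}"
    proof (rule mat_sum_cong[OF refl])
      fix c assume "c \<in> {..<r}"
      then have c: "c < r" by simp
      have "(\<Sum>k\<in>{k\<in>F. cc k = c}. complex_of_real (w k / \<beta> (cc k))) = complex_of_real ((\<Sum>k\<in>{k\<in>F. cc k = c}. w k) / \<beta> c)"
        by (simp add: sum_divide_distrib)
      then have "(\<Sum>k\<in>{k\<in>F. cc k = c}. complex_of_real (w k / \<beta> (cc k))) = 1"
        using weights[OF c] beta[OF c] by simp
      then show "(\<Sum>k\<in>{k\<in>F. cc k = c}. complex_of_real (w k / \<beta> (cc k))) \<cdot>\<^sub>m (iota c * adj (iota c)) = iota c * adj (iota c)"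
        by (auto intro!: eq_matI)
    qed
    finally show "mat_sum P P (\<lambda>k. adj (K k) * K k) F = 1\<^sub>m P" using full by simp
  qed
  \<comment> \<open>The projection onto the joint range of the copies. The second block matrix lives
    entirely on it.\<close>
  define Q where "Q = mat_sum D D (\<lambda>k. Y k * adj (Y k)) F"
  have Qc: "Q \<in> carrier_mat D D" by (simp add: Q_def)
  have YY: "Y k * adj (Y k) \<in> carrier_mat D D" if "k \<in> F" for k
    using YD(2)[OF that] adj_carrier[OF YD(2)[OF that]] by (rule mult_carrier_mat)
  have Qeq: "Q = mat_sum D D (\<lambda>k. 1 \<cdot>\<^sub>m (Y k * 1\<^sub>m (e (cc k)) * adj (Y k))) F"
    unfolding Q_def using right_mult_one_mat[OF YD(2)] by (intro mat_sum_cong) (auto intro!: eq_matI)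
  have YQ: "adj (Y k) * Q = adj (Y k)" if k: "k \<in> F" for k
  proof -
    have "adj (Y k) * Q = 1 \<cdot>\<^sub>m (1\<^sub>m (e (cc k)) * adj (Y k))"
      unfolding Qeq using orthonormal_family_mult_left[OF Y, of "\<lambda>k. 1\<^sub>m (e (cc k))" k "\<lambda>_. 1"] k by simp
    then show ?thesis using left_mult_one_mat[OF adj_carrier[OF YD(2)[OF k]]] by (auto intro!: eq_matI)
  qed
  have adjQ: "adj Q = Q" unfolding Q_def
  proof (subst adj_mat_sum[OF YY], assumption, intro mat_sum_cong refl)
    fix k assume k: "k \<in> F"
    show "adj (Y k * adj (Y k)) = Y k * adj (Y k)"
      using adj_mult[OF YD(2)[OF k] adj_carrier[OF YD(2)[OF k]]] by simp
  qed
  have QY: "Q * Y k = Y k" if k: "k \<in> F" for k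
  proof -
    have "Q * Y k = adj (adj (Y k) * Q)" using adj_mult[OF adj_carrier[OF YD(2)[OF k]] Qc] adjQ by simp
    then show ?thesis using YQ[OF k] by simp
  qed
  have QQ: "Q * Q = Q"
  proof -
    have "Q * Q = mat_sum D D (\<lambda>k. Q * (Y k * adj (Y k))) F"
      unfolding Q_def[symmetric] using mat_sum_mult_left[OF YY Qc, of F] by (simp add: Q_def)
    also have "\<dots> = Q" unfolding Q_def[symmetric]
    proof -
      have "Q * (Y k * adj (Y k)) = Y k * adj (Y k)" if k: "k \<in> F" for k
        using assoc_mult_mat[OF Qc YD(2)[OF k] adj_carrier[OF YD(2)[OF k]]] QY[OF k] by simp
      then show "mat_sum D D (\<lambda>k. Q * (Y k * adj (Y k))) F = Q" unfolding Q_def by (intro mat_sum_cong) auto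
    qed
    finally show ?thesis .
  qed
  define R where "R = 1\<^sub>m D - Q"
  have Rc: "R \<in> carrier_mat D D" unfolding R_def using Qc by (intro minus_carrier_mat)
  have adjR: "adj R = R" unfolding R_def using adj_minus[OF one_carrier_mat Qc] adjQ by simp
  have RR: "R * R = R"
  proof -
    have "R * R = R - Q * R"
      using minus_mult_distrib_mat[OF one_carrier_mat Qc Rc] unfolding R_def[symmetric] left_mult_one_mat[OF Rc] .
    also have "Q * R = 0\<^sub>m D D" unfolding R_def using mult_minus_distrib_mat[OF Qc one_carrier_mat Qc] QQ Qc by simp
    finally show ?thesis using Rc by (auto intro!: eq_matI)
  qed
  \<comment> \<open>Projects onto the complement by \<open>R\<close>, then sends the basis vector
    \<open>j\<close> to the basis vector 0. Summed over \<open>j\<close>, the operators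
    \<open>adj (Z j) * Z j\<close> give exactly \<open>R\<close>.\<close>
  define Z where "Z = (\<lambda>j. mat P D (\<lambda>(i,l). if i = 0 \<and> l = j then 1 else 0 :: complex) * R)"
  let ?E = "\<lambda>j. mat P D (\<lambda>(i,l). if i = 0 \<and> l = j then 1 else 0 :: complex)"
  have Zc: "Z j \<in> carrier_mat P D" for j using Rc by (auto simp: Z_def intro!: mult_carrier_mat[of _ _ D])
  have ZZ: "mat_sum D D (\<lambda>j. adj (Z j) * Z j) {..<D} = R"
  proof -
    have EE: "mat_sum D D (\<lambda>j. adj (?E j) * ?E j) {..<D} = 1\<^sub>m D"
    proof (intro eq_matI)
      fix a b assume "a < dim_row (1\<^sub>m D)" "b < dim_col (1\<^sub>m D)"
      then have ab: "a < D" "b < D" by auto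
      \<comment> \<open>The target state 0 exists only in positive dimension.\<close>
      then have "P > 0" using P0 by (cases P) auto
      have "(adj (?E j) * ?E j) $$ (a,b) = (if a = j \<and> b = j then 1 else 0)" for j
      proof -
        have "(adj (?E j) * ?E j) $$ (a,b) = (\<Sum>i<P. cnj (?E j $$ (i,a)) * ?E j $$ (i,b))"
          using ab by (simp add: scalar_prod_def atLeast0LessThan)
        also have "\<dots> = (\<Sum>i<P. if i = 0 then (if a = j \<and> b = j then 1 else 0) else 0)"
          using ab by (intro sum.cong) auto
        finally show ?thesis using \<open>P > 0\<close> by simp
      qed
      then have "mat_sum D D (\<lambda>j. adj (?E j) * ?E j) {..<D} $$ (a,b) = (\<Sum>j<D. if j = a then (if a = b then 1 else 0) else 0)"
        using ab by (auto intro!: sum.cong)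
      then show "mat_sum D D (\<lambda>j. adj (?E j) * ?E j) {..<D} $$ (a,b) = 1\<^sub>m D $$ (a,b)" using ab by simp
    qed auto
    have Ec: "?E j \<in> carrier_mat P D" for j by simp
    have e: "adj (Z j) * Z j = R * (adj (?E j) * ?E j) * R" for j
    proof -
      have "adj (Z j) * Z j = R * adj (?E j) * (?E j * R)" unfolding Z_def using adj_mult[OF Ec Rc] adjR by simp
      also have "\<dots> = R * adj (?E j) * ?E j * R"
        using assoc_mult_mat[OF mult_carrier_mat[OF Rc adj_carrier[OF Ec]] Ec Rc] by simp
      also have "R * adj (?E j) * ?E j = R * (adj (?E j) * ?E j)" using Rc adj_carrier[OF Ec] Ec by (rule assoc_mult_mat)
      finally show ?thesis .
    qed
    have EEc: "adj (?E j) * ?E j \<in> carrier_mat D D" for j using adj_carrier[OF Ec] Ec by (rule mult_carrier_mat)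
    have "R * mat_sum D D (\<lambda>j. adj (?E j) * ?E j) {..<D} = mat_sum D D (\<lambda>j. R * (adj (?E j) * ?E j)) {..<D}"
      by (rule mat_sum_mult_left[OF EEc Rc])
    moreover have "mat_sum D D (\<lambda>j. R * (adj (?E j) * ?E j)) {..<D} * R = mat_sum D D (\<lambda>j. R * (adj (?E j) * ?E j) * R) {..<D}"
      by (rule mat_sum_mult_right[OF mult_carrier_mat[OF Rc EEc] Rc])
    ultimately have "mat_sum D D (\<lambda>j. adj (Z j) * Z j) {..<D} = R * 1\<^sub>m D * R" unfolding e EE by simp
    then show ?thesis using RR Rc by simp
  qed
  \<comment> \<open>The operators \<open>Inl k\<close> move each copy back to its block, without
    weights since the copies are to be added up. The operators \<open>Inr j\<close> handle the
    complement.\<close>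
  define L where "L = (\<lambda>x. case x of Inl k \<Rightarrow> iota (cc k) * adj (Y k) | Inr j \<Rightarrow> Z j)"
  let ?F = "Inl ` F \<union> Inr ` {..<D} :: ('k + nat) set"
  have split: "mat_sum d d f ?F = mat_sum d d (\<lambda>k. f (Inl k)) F + mat_sum d d (\<lambda>j. f (Inr j)) {..<D}" for d f
  proof -
    have "mat_sum d d f ?F = mat_sum d d f (Inl ` F) + mat_sum d d f (Inr ` {..<D})"
      using YD(1) by (intro mat_sum_Un) auto
    then show ?thesis by (simp add: mat_sum_reindex)
  qed
  have IY: "iota (cc k) * adj (Y k) \<in> carrier_mat P D" if "k \<in> F" for k
    using ik(1)[OF that] adj_carrier[OF YD(2)[OF that]] by (rule mult_carrier_mat)
  have Lc: "L x \<in> carrier_mat P D" if "x \<in> ?F" for x using that IY Zc by (auto simp: L_def)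
  define S where "S = (\<lambda>X. mat_sum P P (\<lambda>x. L x * X * adj (L x)) ?F)"
  have S: "quantum_channel D P S" unfolding S_def
  proof (rule quantum_channelI[OF _ Lc])
    show "finite ?F" using YD(1) by auto
    have "adj (L (Inl k)) * L (Inl k) = Y k * adj (Y k)" if k: "k \<in> F" for k
      unfolding L_def using adj_product_self[OF YD(2)[OF k] ik[OF k]] by simp
    then have "mat_sum D D (\<lambda>x. adj (L x) * L x) ?F = Q + R"
      unfolding split Q_def using ZZ by (auto simp: L_def intro!: arg_cong2[where f="(+)"] mat_sum_cong)
    also have "\<dots> = 1\<^sub>m D" unfolding R_def using Qc by (intro eq_matI) auto
    finally show "mat_sum D D (\<lambda>x. adj (L x) * L x) ?F = 1\<^sub>m D" .
  qed
  have "T (mat_sum P P (\<lambda>c. complex_of_real (\<beta> c) \<cdot>\<^sub>m (iota c * g c * adj (iota c))) {..<r})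
           = mat_sum D D (\<lambda>k. complex_of_real (w k) \<cdot>\<^sub>m (Y k * g (cc k) * adj (Y k))) F" (is "T ?B = ?C")
    and "S (mat_sum D D (\<lambda>k. complex_of_real (w k) \<cdot>\<^sub>m (Y k * g (cc k) * adj (Y k))) F)
           = mat_sum P P (\<lambda>c. complex_of_real (\<beta> c) \<cdot>\<^sub>m (iota c * g c * adj (iota c))) {..<r}"
    if g: "\<forall>c<r. g c \<in> carrier_mat (e c) (e c)" for g
  proof -
    have gc: "g (cc k) \<in> carrier_mat (e (cc k)) (e (cc k))" if "k \<in> F" for k using g cc[OF that] by simp
    have Bc: "?B \<in> carrier_mat P P" and Cc: "?C \<in> carrier_mat D D" by auto
    have "K k * ?B * adj (K k) = complex_of_real (w k) \<cdot>\<^sub>m (Y k * g (cc k) * adj (Y k))" if k: "k \<in> F" for k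
    proof -
      have "adj (iota (cc k)) * ?B * iota (cc k) = complex_of_real (\<beta> (cc k)) \<cdot>\<^sub>m g (cc k)"
        using g cc[OF k] by (intro orthonormal_family_sandwich[OF io]) auto
      then have "K k * ?B * adj (K k) = complex_of_real (w k / \<beta> (cc k)) \<cdot>\<^sub>m (Y k * (complex_of_real (\<beta> (cc k)) \<cdot>\<^sub>m g (cc k)) * adj (Y k))"
        using KX[OF k Bc] by simp
      also have "Y k * (complex_of_real (\<beta> (cc k)) \<cdot>\<^sub>m g (cc k)) = complex_of_real (\<beta> (cc k)) \<cdot>\<^sub>m (Y k * g (cc k))"
        using YD(2)[OF k] gc[OF k] by (rule mult_smult_distrib)
      also have "\<dots> * adj (Y k) = complex_of_real (\<beta> (cc k)) \<cdot>\<^sub>m (Y k * g (cc k) * adj (Y k))"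
        using mult_carrier_mat[OF YD(2)[OF k] gc[OF k]] adj_carrier[OF YD(2)[OF k]] by (rule mult_smult_assoc_mat)
      finally show ?thesis using beta[OF cc[OF k]] by (simp add: smult_smult_mat)
    qed
    then show "T ?B = ?C" unfolding T_def by (intro mat_sum_cong) auto
    \<comment> \<open>The complement is orthogonal to all ranges, so the reset part contributes
      nothing on the block matrices in question.\<close>
    have RC: "R * ?C = 0\<^sub>m D D"
    proof -
      have RY: "R * Y k = 0\<^sub>m D (e (cc k))" if "k \<in> F" for k
        unfolding R_def using minus_mult_distrib_mat[OF one_carrier_mat Qc YD(2)[OF that]] QY[OF that] YD(2)[OF that] by simp
      have "R * (complex_of_real (w k) \<cdot>\<^sub>m (Y k * g (cc k) * adj (Y k))) = 0\<^sub>m D D" if k: "k \<in> F" for k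
      proof -
        note gY = mult_carrier_mat[OF gc[OF k] adj_carrier[OF YD(2)[OF k]]]
        have "Y k * g (cc k) * adj (Y k) = Y k * (g (cc k) * adj (Y k))"
          using YD(2)[OF k] gc[OF k] adj_carrier[OF YD(2)[OF k]] by (rule assoc_mult_mat)
        moreover have "R * (Y k * (g (cc k) * adj (Y k))) = R * Y k * (g (cc k) * adj (Y k))"
          using assoc_mult_mat[OF Rc YD(2)[OF k] gY] by simp
        moreover have "R * Y k * (g (cc k) * adj (Y k)) = 0\<^sub>m D D" unfolding RY[OF k] using gY by (rule left_mult_zero_mat)
        ultimately show ?thesis using mult_smult_distrib[OF Rc conj_carrier[OF YD(2)[OF k] gc[OF k]]] by simp
      qed
      then have "mat_sum D D (\<lambda>k. R * (complex_of_real (w k) \<cdot>\<^sub>m (Y k * g (cc k) * adj (Y k)))) F = 0\<^sub>m D D"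
        by (intro mat_sum_zero)
      then show ?thesis using mat_sum_mult_left[OF smult_carrier_mat[OF conj_carrier[OF YD(2) gc]] Rc, of F] by simp
    qed
    have ZC: "Z j * ?C * adj (Z j) = 0\<^sub>m P P" for j
    proof -
      have "Z j * ?C = ?E j * (R * ?C)" unfolding Z_def using Rc Cc by (intro assoc_mult_mat[of _ P D _ D _ D]) auto
      also have "\<dots> = 0\<^sub>m P D" unfolding RC by simp
      finally show ?thesis using left_mult_zero_mat[OF adj_carrier[OF Zc]] by simp
    qed
    have LC: "L (Inl k) * ?C * adj (L (Inl k)) = complex_of_real (w k) \<cdot>\<^sub>m (iota (cc k) * g (cc k) * adj (iota (cc k)))" if k: "k \<in> F" for k
    proof -
      have "adj (Y k) * ?C * Y k = complex_of_real (w k) \<cdot>\<^sub>m g (cc k)"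
        using orthonormal_family_sandwich[OF Y, of "\<lambda>k. g (cc k)" k] gc k by simp
      then have "L (Inl k) * ?C * adj (L (Inl k)) = iota (cc k) * (complex_of_real (w k) \<cdot>\<^sub>m g (cc k)) * adj (iota (cc k))"
        unfolding L_def using conj_product[OF YD(2)[OF k] ik(1)[OF k] Cc] by simp
      also have "iota (cc k) * (complex_of_real (w k) \<cdot>\<^sub>m g (cc k)) = complex_of_real (w k) \<cdot>\<^sub>m (iota (cc k) * g (cc k))"
        using ik(1)[OF k] gc[OF k] by (rule mult_smult_distrib)
      also have "\<dots> * adj (iota (cc k)) = complex_of_real (w k) \<cdot>\<^sub>m (iota (cc k) * g (cc k) * adj (iota (cc k)))"
        using mult_carrier_mat[OF ik(1)[OF k] gc[OF k]] adj_carrier[OF ik(1)[OF k]] by (rule mult_smult_assoc_mat)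
      finally show ?thesis .
    qed
    have "S ?C = mat_sum P P (\<lambda>k. L (Inl k) * ?C * adj (L (Inl k))) F + mat_sum P P (\<lambda>j. Z j * ?C * adj (Z j)) {..<D}"
      unfolding S_def split by (simp add: L_def)
    also have "mat_sum P P (\<lambda>j. Z j * ?C * adj (Z j)) {..<D} = 0\<^sub>m P P" using ZC by (intro mat_sum_zero)
    also have "mat_sum P P (\<lambda>k. L (Inl k) * ?C * adj (L (Inl k))) F
        = mat_sum P P (\<lambda>k. complex_of_real (w k) \<cdot>\<^sub>m (iota (cc k) * g (cc k) * adj (iota (cc k)))) F"
      using LC by (intro mat_sum_cong) auto
    \<comment> \<open>The copies with label \<open>c\<close> all return the same matrix, so their
      weights add up to \<open>\<beta> c\<close>.\<close>
    also have "\<dots> = mat_sum P P (\<lambda>c. (\<Sum>k\<in>{k\<in>F. cc k = c}. complex_of_real (w k)) \<cdot>\<^sub>m (iota c * g c * adj (iota c))) {..<r}"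
      using I(2) g by (intro mat_sum_group[OF YD(1) cc] conj_carrier) auto
    also have "\<dots> = ?B" using weights by (intro mat_sum_cong) (auto simp flip: of_real_sum)
    finally show "S ?C = ?B" by simp
  qed
  then show ?thesis using T S by blast
qed

section \<open>Block diagonal matrices\<close>

definition block_offset :: "(nat \<Rightarrow> nat) \<Rightarrow> nat \<Rightarrow> nat" where
  "block_offset dims a = (\<Sum>b<a. dims b)"

text \<open>The isometry of the carrier space of \<open>phi a\<close> onto its summand. Through
  these the direct sum over all labels becomes a block sum to which the channel construction
  applies.\<close>

definition block_incl :: "nat \<Rightarrow> (nat \<Rightarrow> nat) \<Rightarrow> nat \<Rightarrow> complex mat" where
  "block_incl r dims a = mat (phys_dim r dims) (dims a) (\<lambda>(i,j). if i = block_offset dims a + j then 1 else 0)"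

lemma block_incl_carrier: "block_incl r dims a \<in> carrier_mat (phys_dim r dims) (dims a)"
  by (simp add: block_incl_def)

lemma block_offset_mono: "a \<le> b \<Longrightarrow> block_offset dims a \<le> block_offset dims b"
  unfolding block_offset_def by (intro sum_mono2) auto

lemma block_offset_less:
  assumes "a < r" "i < dims a"
  shows "block_offset dims a + i < phys_dim r dims"
proof -
  have "block_offset dims a + i < block_offset dims (Suc a)" using assms(2) by (simp add: block_offset_def)
  also have "\<dots> \<le> block_offset dims r" using assms(1) by (intro block_offset_mono) simp
  finally show ?thesis by (simp add: block_offset_def phys_dim_def)
qed

lemma block_offset_add_less:
  assumes "a < b" "i < dims a"
  shows "block_offset dims a + i < block_offset dims b"
proof -
  have "block_offset dims a + i < block_offset dims (Suc a)" using assms(2) by (simp add: block_offset_def)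
  also have "\<dots> \<le> block_offset dims b" using assms(1) by (intro block_offset_mono) simp
  finally show ?thesis .
qed

lemma block_offset_inj:
  assumes "i < dims a" "j < dims b"
  shows "block_offset dims a + i = block_offset dims b + j \<longleftrightarrow> a = b \<and> i = j"
  using block_offset_add_less[of a b i dims] block_offset_add_less[of b a j dims] assms
  by (cases a b rule: linorder_cases) auto

lemma block_offset_cases:
  assumes "p < phys_dim r dims"
  shows "\<exists>a<r. \<exists>i<dims a. p = block_offset dims a + i"
  using assms
proof (induction r)
  case (Suc r)
  show ?case
  proof (cases "p < phys_dim r dims")
    case True
    then show ?thesis using Suc.IH less_SucI by blast
  next
    case False
    then have "p - block_offset dims r < dims r" "p = block_offset dims r + (p - block_offset dims r)"
      using Suc.prems by (auto simp: phys_dim_def block_offset_def)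
    then show ?thesis by blast
  qed
qed (simp add: phys_dim_def)

lemma diag_block_mat_carrier:
  fixes f :: "nat \<Rightarrow> complex mat"
  assumes "\<And>a. a < r \<Longrightarrow> f a \<in> carrier_mat (dims a) (dims a)"
  shows "diag_block_mat (map f [0..<r]) \<in> carrier_mat (phys_dim r dims) (phys_dim r dims)"
proof -
  have "sum_list (map (dim_row \<circ> f) [0..<r]) = (\<Sum>a<r. dim_row (f a))"
      "sum_list (map (dim_col \<circ> f) [0..<r]) = (\<Sum>a<r. dim_col (f a))"
    by (simp_all add: interv_sum_list_conv_sum_set_nat atLeast0LessThan)
  moreover have "(\<Sum>a<r. dim_row (f a)) = phys_dim r dims" "(\<Sum>a<r. dim_col (f a)) = phys_dim r dims"
    unfolding phys_dim_def using assms by (auto intro!: sum.cong)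
  ultimately show ?thesis by (intro carrier_matI) (simp_all add: dim_diag_block_mat)
qed

text \<open>Induction on the number of blocks, splitting off the last one; its upper left corner
  sits at \<open>block_offset dims s\<close>.\<close>

lemma diag_block_mat_index:
  fixes f :: "nat \<Rightarrow> complex mat"
  assumes "\<And>a. a < r \<Longrightarrow> f a \<in> carrier_mat (dims a) (dims a)" "a < r" "b < r" "i < dims a" "j < dims b"
  shows "diag_block_mat (map f [0..<r]) $$ (block_offset dims a + i, block_offset dims b + j) = (if a = b then f a $$ (i,j) else 0)"
proof -
  have car: "diag_block_mat (map f [0..<s]) \<in> carrier_mat (phys_dim s dims) (phys_dim s dims)" if "s \<le> r" for s
    using assms(1) that by (intro diag_block_mat_carrier) simp
  have "diag_block_mat (map f [0..<s]) $$ (block_offset dims a + i, block_offset dims b + j) = (if a = b then f a $$ (i,j) else 0)"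
    if "s \<le> r" "a < s" "b < s" for s
    using that
  proof (induction s)
    case (Suc s)
    have A: "diag_block_mat (map f [0..<s]) \<in> carrier_mat (phys_dim s dims) (phys_dim s dims)" using car Suc.prems by simp
    have B: "f s \<in> carrier_mat (dims s) (dims s)" using assms(1) Suc.prems by simp
    have o: "phys_dim s dims = block_offset dims s" by (simp add: phys_dim_def block_offset_def)
    have eq: "diag_block_mat (map f [0..<Suc s]) = four_block_mat (diag_block_mat (map f [0..<s]))
        (0\<^sub>m (phys_dim s dims) (dims s)) (0\<^sub>m (dims s) (phys_dim s dims)) (f s)"
      using A B by (simp add: diag_block_mat_last Let_def)
    have la: "block_offset dims a + i < phys_dim s dims \<longleftrightarrow> a < s" "block_offset dims b + j < phys_dim s dims \<longleftrightarrow> b < s"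
      using block_offset_add_less[of a s i dims] block_offset_add_less[of b s j dims] Suc.prems assms(4,5)
      by (auto simp: o less_Suc_eq)
    have lb: "block_offset dims a + i < phys_dim s dims + dims s" "block_offset dims b + j < phys_dim s dims + dims s"
      using block_offset_less[of a "Suc s" i dims] block_offset_less[of b "Suc s" j dims] Suc.prems assms(4,5)
      by (auto simp: phys_dim_def)
    show ?case unfolding eq using A B la lb Suc assms(4,5) o by (auto simp: less_Suc_eq)
  qed simp
  then show "diag_block_mat (map f [0..<r]) $$ (block_offset dims a + i, block_offset dims b + j) = (if a = b then f a $$ (i,j) else 0)"
    using assms(2,3) by simp
qed

lemma block_incl_conj_index:
  assumes X: "X \<in> carrier_mat (dims a) (dims a)" and a: "a < r" and b: "b < r" "i < dims b" and c: "c < r" "j < dims c"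
  shows "(block_incl r dims a * X * adj (block_incl r dims a)) $$ (block_offset dims b + i, block_offset dims c + j)
     = (if a = b \<and> a = c then X $$ (i,j) else 0)"
proof -
  let ?V = "block_incl r dims a" and ?P = "phys_dim r dims"
  have V: "?V \<in> carrier_mat ?P (dims a)" by (rule block_incl_carrier)
  note pb = block_offset_less[of b r i dims, OF b] and pc = block_offset_less[of c r j dims, OF c]
  have VX: "(?V * X) $$ (block_offset dims b + i, l) = (if a = b then X $$ (i,l) else 0)" if l: "l < dims a" for l
  proof -
    have "(?V * X) $$ (block_offset dims b + i, l) = (\<Sum>k<dims a. ?V $$ (block_offset dims b + i, k) * X $$ (k,l))"
      using V X pb l by (auto simp: scalar_prod_def atLeast0LessThan)
    also have "\<dots> = (\<Sum>k<dims a. if k = i then (if a = b then X $$ (i,l) else 0) else 0)"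
      using pb block_offset_inj[of i dims b _ a, OF b(2)]
      by (intro sum.cong) (auto simp: block_incl_def)
    also have "\<dots> = (if a = b then X $$ (i,l) else 0)" using b by auto
    finally show ?thesis .
  qed
  have "(?V * X * adj ?V) $$ (block_offset dims b + i, block_offset dims c + j)
     = (\<Sum>l<dims a. (?V * X) $$ (block_offset dims b + i, l) * cnj (?V $$ (block_offset dims c + j, l)))"
    using V X pb pc by (auto simp: scalar_prod_def atLeast0LessThan)
  also have "\<dots> = (\<Sum>l<dims a. if l = j then (if a = b \<and> a = c then X $$ (i,j) else 0) else 0)"
    using pc block_offset_inj[of j dims c _ a, OF c(2)] VX
    by (intro sum.cong) (auto simp: block_incl_def)
  also have "\<dots> = (if a = b \<and> a = c then X $$ (i,j) else 0)" using c by auto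
  finally show ?thesis .
qed

lemma diag_block_mat_eq_sum:
  assumes f: "\<And>a. a < r \<Longrightarrow> f a \<in> carrier_mat (dims a) (dims a)"
  shows "diag_block_mat (map f [0..<r]) = mat_sum (phys_dim r dims) (phys_dim r dims)
     (\<lambda>a. block_incl r dims a * f a * adj (block_incl r dims a)) {..<r}"
proof (intro eq_matI)
  let ?P = "phys_dim r dims"
  have car: "diag_block_mat (map f [0..<r]) \<in> carrier_mat ?P ?P" by (rule diag_block_mat_carrier[OF f])
  then show "dim_row (diag_block_mat (map f [0..<r])) = dim_row (mat_sum ?P ?P (\<lambda>a. block_incl r dims a * f a * adj (block_incl r dims a)) {..<r})"
    "dim_col (diag_block_mat (map f [0..<r])) = dim_col (mat_sum ?P ?P (\<lambda>a. block_incl r dims a * f a * adj (block_incl r dims a)) {..<r})"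
    by auto
  fix p q assume "p < dim_row (mat_sum ?P ?P (\<lambda>a. block_incl r dims a * f a * adj (block_incl r dims a)) {..<r})"
    "q < dim_col (mat_sum ?P ?P (\<lambda>a. block_incl r dims a * f a * adj (block_incl r dims a)) {..<r})"
  then have pq: "p < ?P" "q < ?P" by auto
  obtain b i where b: "b < r" "i < dims b" "p = block_offset dims b + i" using block_offset_cases[OF pq(1)] by blast
  obtain c j where c: "c < r" "j < dims c" "q = block_offset dims c + j" using block_offset_cases[OF pq(2)] by blast
  have "(\<Sum>a<r. (block_incl r dims a * f a * adj (block_incl r dims a)) $$ (p,q)) = (\<Sum>a<r. if a = b then (if b = c then f b $$ (i,j) else 0) else 0)"
    unfolding b(3) c(3) using block_incl_conj_index[OF f _ b(1,2) c(1,2)] by (intro sum.cong) auto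
  also have "\<dots> = diag_block_mat (map f [0..<r]) $$ (p,q)"
    using diag_block_mat_index[OF f b(1) c(1) b(2) c(2)] b c by simp
  finally show "diag_block_mat (map f [0..<r]) $$ (p,q) = mat_sum ?P ?P (\<lambda>a. block_incl r dims a * f a * adj (block_incl r dims a)) {..<r} $$ (p,q)"
    using pq by simp
qed

lemma block_incl_full:
  "mat_sum (phys_dim r dims) (phys_dim r dims) (\<lambda>a. block_incl r dims a * adj (block_incl r dims a)) {..<r} = 1\<^sub>m (phys_dim r dims)"
proof (intro eq_matI)
  let ?P = "phys_dim r dims"
  fix p q assume "p < dim_row (1\<^sub>m ?P)" "q < dim_col (1\<^sub>m ?P)"
  then have pq: "p < ?P" "q < ?P" by auto
  obtain b i where b: "b < r" "i < dims b" "p = block_offset dims b + i" using block_offset_cases[OF pq(1)] by blast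
  obtain c j where c: "c < r" "j < dims c" "q = block_offset dims c + j" using block_offset_cases[OF pq(2)] by blast
  have "(block_incl r dims a * adj (block_incl r dims a)) $$ (p,q) = (if a = b then (if b = c \<and> i = j then 1 else 0) else 0)" if "a < r" for a
    using block_incl_conj_index[OF one_carrier_mat that b(1,2) c(1,2)] right_mult_one_mat[OF block_incl_carrier[of r dims a]] b c by auto
  then have "(\<Sum>a<r. (block_incl r dims a * adj (block_incl r dims a)) $$ (p,q)) = (\<Sum>a<r. if a = b then (if b = c \<and> i = j then 1 else 0) else 0)"
    by (intro sum.cong) auto
  also have "\<dots> = 1\<^sub>m ?P $$ (p,q)" using pq b c block_offset_inj[of i dims b j c] by auto
  finally show "mat_sum ?P ?P (\<lambda>a. block_incl r dims a * adj (block_incl r dims a)) {..<r} $$ (p,q) = 1\<^sub>m ?P $$ (p,q)"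
    using pq by simp
qed auto

lemma block_incl_orthonormal: "orthonormal_family (phys_dim r dims) {..<r} dims (block_incl r dims)"
proof -
  have e: "(adj (block_incl r dims a) * block_incl r dims b) $$ (i,j) = (if a = b \<and> i = j then 1 else 0)"
    if "a < r" "b < r" "i < dims a" "j < dims b" for a b i j
  proof -
    have "(adj (block_incl r dims a) * block_incl r dims b) $$ (i,j)
       = (\<Sum>p<phys_dim r dims. cnj (block_incl r dims a $$ (p,i)) * block_incl r dims b $$ (p,j))"
      using that carrier_matD[OF block_incl_carrier[of r dims]] by (simp add: scalar_prod_def atLeast0LessThan)
    also have "\<dots> = (\<Sum>p<phys_dim r dims. if p = block_offset dims a + i then (if p = block_offset dims b + j then 1 else 0) else 0)"
      using that by (intro sum.cong) (auto simp: block_incl_def)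
    also have "\<dots> = (if a = b \<and> i = j then 1 else 0)"
      using block_offset_less[of a r i dims] that block_offset_inj[of i dims a j b] by simp
    finally show ?thesis .
  qed
  show ?thesis unfolding orthonormal_family_def
    using e block_incl_carrier by (auto intro!: eq_matI simp: block_incl_def)
qed

section \<open>Fusion multiplicities and the matrix product operator\<close>

lemma sum_group_card:
  fixes g :: "nat \<Rightarrow> nat"
  assumes "\<And>k. k < m \<Longrightarrow> cc k < r"
  shows "(\<Sum>k<m. g (cc k)) = (\<Sum>e<r. card {k\<in>{..<m::nat}. cc k = e} * g e)"
proof -
  have "(\<Sum>k<m. g (cc k)) = (\<Sum>e<r. \<Sum>k\<in>{k\<in>{..<m}. cc k = e}. g (cc k))"
    using assms by (intro sum.group[symmetric]) auto
  then show ?thesis by simp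
qed

lemma card_Sigma_label:
  assumes "finite A" "\<And>p. p \<in> A \<Longrightarrow> finite (G p)"
  shows "card {x \<in> Sigma A G. (case x of (p,j) \<Rightarrow> lab p j) = d} = (\<Sum>p\<in>A. card {j\<in>G p. lab p j = d})"
proof -
  have "{x \<in> Sigma A G. (case x of (p,j) \<Rightarrow> lab p j) = d} = Sigma A (\<lambda>p. {j\<in>G p. lab p j = d})"
    by auto
  then show ?thesis using assms by simp
qed

context star_irreps
begin

lemma fusion_decompositions:
  "\<exists>m cc W. \<forall>a<r. \<forall>b<r. decomposes (dims a * dims b) (tensor_rep n Lam (dims a) (phi a) (dims b) (phi b))
       {..<m a b :: nat} (cc a b) (W a b)"
  using decomposition_exists[OF tensor_star_rep[OF phi_star_rep phi_star_rep]] by metis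

lemma fusion_mult_eq_card:
  assumes "decomposes (dims a * dims b) (tensor_rep n Lam (dims a) (phi a) (dims b) (phi b)) F cc W"
    "a < r" "b < r" "c < r"
  shows "fusion_mult n Lam dims phi c a b = card {k\<in>F. cc k = c}"
  unfolding fusion_mult_def using multiplicity_eq_card[OF assms(1) _ assms(4)] tensor_rep_carrier phi_rep_map assms by blast

text \<open>Both sides are the multiplicity of \<open>phi d\<close> in the threefold tensor product,
  counted through its two bracketings.\<close>

lemma fusion_mult_assoc:
  assumes a: "a < r" and b: "b < r" and c: "c < r" and d: "d < r"
  defines "N \<equiv> fusion_mult n Lam dims phi"
  shows "(\<Sum>e<r. N e a b * N d e c) = (\<Sum>f<r. N d a f * N f b c)"
proof -
  obtain m cc W where dec: "\<And>a b. a < r \<Longrightarrow> b < r \<Longrightarrow> decomposes (dims a * dims b)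
      (tensor_rep n Lam (dims a) (phi a) (dims b) (phi b)) {..<m a b :: nat} (cc a b) (W a b)"
    using fusion_decompositions by blast
  have N: "N z x y = card {k\<in>{..<m x y}. cc x y k = z}" if "x < r" "y < r" "z < r" for x y z
    unfolding N_def using fusion_mult_eq_card[OF dec] that by blast
  have ccr: "cc x y k < r" if "x < r" "y < r" "k < m x y" for x y k using decomposesD(2)[OF dec] that by blast
  note rep = phi_rep_map[OF a] phi_rep_map[OF b] phi_rep_map[OF c]
  let ?ab = "tensor_rep n Lam (dims a) (phi a) (dims b) (phi b)" and ?bc = "tensor_rep n Lam (dims b) (phi b) (dims c) (phi c)"
  let ?l = "tensor_rep n Lam (dims a * dims b) ?ab (dims c) (phi c)" and ?r = "tensor_rep n Lam (dims a) (phi a) (dims b * dims c) ?bc"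
  have ab: "is_rep_map n (dims a * dims b) ?ab" and bc: "is_rep_map n (dims b * dims c) ?bc"
    using rep by (auto intro: tensor_rep_carrier)
  \<comment> \<open>First \<open>a\<close> and \<open>b\<close> are decomposed, then each summand is
    tensored with \<open>c\<close>. The factor \<open>c\<close> enters with its one-block
    decomposition, whence the index set \<open>{0}\<close>.\<close>
  have l: "decomposes (dims a * dims b * dims c) ?l (Sigma ({..<m a b} \<times> {0::nat}) (\<lambda>p. {..<m (cc a b (fst p)) c}))
     (\<lambda>(p,l). cc (cc a b (fst p)) c l) (\<lambda>(p,l). kron (W a b (fst p)) (1\<^sub>m (dims c)) * W (cc a b (fst p)) c l)"
    using ccr[OF a b] c
    by (intro tensor_decomposes[OF dec[OF a b] phi_decomposes[OF c] ab rep(3)]) (auto intro!: dec)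
  have r: "decomposes (dims a * (dims b * dims c)) ?r (Sigma ({0::nat} \<times> {..<m b c}) (\<lambda>p. {..<m a (cc b c (snd p))}))
     (\<lambda>(p,l). cc a (cc b c (snd p)) l) (\<lambda>(p,l). kron (1\<^sub>m (dims a)) (W b c (snd p)) * W a (cc b c (snd p)) l)"
    using ccr[OF b c] a
    by (intro tensor_decomposes[OF phi_decomposes[OF a] dec[OF b c] rep(1) bc]) (auto intro!: dec)
  have lm: "mat_space_dim (dims a * dims b * dims c) (dims d) {T. \<forall>I<n. T * phi d I = ?l I * T} = (\<Sum>e<r. N e a b * N d e c)"
  proof -
    have "mat_space_dim (dims a * dims b * dims c) (dims d) {T. \<forall>I<n. T * phi d I = ?l I * T}
       = (\<Sum>k<m a b. card {l\<in>{..<m (cc a b k) c}. cc (cc a b k) c l = d})"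
      using multiplicity_eq_card[OF l tensor_rep_carrier[OF ab rep(3)] d]
      by (simp add: card_Sigma_label sum.cartesian_product')
    also have "\<dots> = (\<Sum>k<m a b. N d (cc a b k) c)" using N ccr a b c d by simp
    also have "\<dots> = (\<Sum>e<r. N e a b * N d e c)" using sum_group_card[of "m a b" "cc a b" r "\<lambda>e. N d e c"] N ccr a b by simp
    finally show ?thesis .
  qed
  have rm: "mat_space_dim (dims a * (dims b * dims c)) (dims d) {T. \<forall>I<n. T * phi d I = ?r I * T} = (\<Sum>f<r. N d a f * N f b c)"
  proof -
    have "mat_space_dim (dims a * (dims b * dims c)) (dims d) {T. \<forall>I<n. T * phi d I = ?r I * T}
       = (\<Sum>k<m b c. card {l\<in>{..<m a (cc b c k)}. cc a (cc b c k) l = d})"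
      using multiplicity_eq_card[OF r tensor_rep_carrier[OF rep(1) bc] d]
      by (simp add: card_Sigma_label sum.cartesian_product')
    also have "\<dots> = (\<Sum>k<m b c. N d a (cc b c k))" using N ccr a b c d by simp
    also have "\<dots> = (\<Sum>f<r. N d a f * N f b c)" using sum_group_card[of "m b c" "cc b c" r "\<lambda>f. N d a f"] N ccr b c by (simp add: mult.commute)
    finally show ?thesis .
  qed
  \<comment> \<open>The two bracketings are the same representation, so one intertwiner space has
    both dimensions.\<close>
  have "{T. \<forall>I<n. T * phi d I = ?l I * T} = {T. \<forall>I<n. T * phi d I = ?r I * T}"
    using tensor_rep_assoc[OF rep] by auto
  then show ?thesis using lm rm by (simp add: mult.assoc)
qed

text \<open>Turns the transpose condition on fusion matrices into an identity of multiplicities and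
  applies the Perron argument to the fusion rule.\<close>

lemma qdim_properties:
  assumes "r > 0"
    and transitive: "\<forall>a<r. \<forall>b<r. \<exists>c<r. \<exists>d<r.
                       fusion_mult n Lam dims phi d a c > 0 \<and> fusion_mult n Lam dims phi b d a > 0"
    and duals: "\<forall>a<r. \<exists>a'<r. fusion_matrix n Lam r dims phi a' = transpose_mat (fusion_matrix n Lam r dims phi a)"
  shows "\<forall>a<r. qdim n Lam r dims phi a > 0"
    "\<forall>a<r. \<forall>c<r. (\<Sum>b<r. real (fusion_mult n Lam dims phi c a b) * qdim n Lam r dims phi b)
        = qdim n Lam r dims phi a * qdim n Lam r dims phi c"
proof -
  let ?N = "fusion_mult n Lam dims phi"
  have dual: "\<exists>a'<r. \<forall>b<r. \<forall>c<r. ?N c a' b = ?N b a c" if a: "a < r" for a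
  proof -
    obtain a' where a': "a' < r" "fusion_matrix n Lam r dims phi a' = transpose_mat (fusion_matrix n Lam r dims phi a)"
      using duals a by blast
    have "?N c a' b = ?N b a c" if "b < r" "c < r" for b c
    proof -
      have "fusion_matrix n Lam r dims phi a' $$ (c,b) = fusion_matrix n Lam r dims phi a $$ (b,c)"
        unfolding a'(2) using that by (simp add: fusion_matrix_def)
      then show ?thesis using that by (simp add: fusion_matrix_def)
    qed
    then show ?thesis using a' by blast
  qed
  have pos: "\<exists>d<r. ?N b d a > 0" if "a < r" "b < r" for a b using transitive that by blast
  note R = fusion_spectral_radius[of r ?N, OF \<open>r > 0\<close> fusion_mult_assoc pos dual]
  show "\<forall>a<r. qdim n Lam r dims phi a > 0"
    "\<forall>a<r. \<forall>c<r. (\<Sum>b<r. real (?N c a b) * qdim n Lam r dims phi b) = qdim n Lam r dims phi a * qdim n Lam r dims phi c"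
    unfolding qdim_def fusion_matrix_def using R by blast+
qed

end

section \<open>The tensors as images of matrix coefficients of \<open>psi\<close>\<close>

lemma MPO_eq_repA:
  "MPO n Lam r dims phi psi \<alpha> \<beta> = repA n (phys_dim r dims) (b_phi n Lam r dims phi) (\<lambda>I. psi I $$ (\<alpha>,\<beta>))"
  by (simp add: MPO_def repA_def)

text \<open>Multiplicativity of \<open>psi\<close> in dual form: the matrix coefficients of a
  representation of the dual algebra comultiply like matrix entries.\<close>

lemma dual_rep_Delta:
  assumes psi: "faithful_rep_dual n Lam chi psi" and ab: "\<alpha> < chi" "\<beta> < chi" and IJ: "I < n" "J < n"
  shows "DeltaA n Lam (\<lambda>I. psi I $$ (\<alpha>,\<beta>)) I J = (\<Sum>\<gamma><chi. psi I $$ (\<alpha>,\<gamma>) * psi J $$ (\<gamma>,\<beta>))"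
proof -
  have rep: "is_rep_map n chi psi" using psi by (simp add: faithful_rep_dual_def)
  have c: "psi K \<in> carrier_mat chi chi" if "K < n" for K using rep that by (simp add: is_rep_map_def)
  have cd: "dim_row (psi K) = chi" "dim_col (psi K) = chi" if "K < n" for K using c[OF that] by auto
  have "psi I * psi J = repA n chi psi (mulDual n Lam (basisA I) (basisA J))"
    using psi IJ repA_basisA[OF rep] by (simp add: faithful_rep_dual_def)
  then have "(psi I * psi J) $$ (\<alpha>,\<beta>) = (\<Sum>K<n. mulDual n Lam (basisA I) (basisA J) K * psi K $$ (\<alpha>,\<beta>))"
    using ab cd by (simp add: repA_mat_sum[OF rep])
  also have "\<dots> = (\<Sum>K<n. psi K $$ (\<alpha>,\<beta>) * Lam K I J)"
  proof (rule sum.cong[OF refl])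
    fix K assume K: "K \<in> {..<n}"
    have b: "basisA M L * y = (if L = M then y else 0)" for M L y by (simp add: basisA_def)
    have "(\<Sum>P<n. \<Sum>Q<n. basisA I P * basisA J Q * Lam K P Q) = (\<Sum>P<n. basisA I P * (\<Sum>Q<n. basisA J Q * Lam K P Q))"
      unfolding sum_distrib_left by (simp add: mult.assoc)
    then show "mulDual n Lam (basisA I) (basisA J) K * psi K $$ (\<alpha>,\<beta>) = psi K $$ (\<alpha>,\<beta>) * Lam K I J"
      using IJ K by (simp add: mulDual_def b)
  qed
  also have "(psi I * psi J) $$ (\<alpha>,\<beta>) = (\<Sum>\<gamma><chi. psi I $$ (\<alpha>,\<gamma>) * psi J $$ (\<gamma>,\<beta>))"
    using c[OF IJ(1)] c[OF IJ(2)] ab by (auto simp: scalar_prod_def atLeast0LessThan)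
  finally show ?thesis using IJ by (simp add: DeltaA_def)
qed

text \<open>Contracting the virtual bond is therefore the same as applying the coproduct to the
  one-site element.\<close>

lemma MPO2_eq_tensor_map:
  assumes psi: "faithful_rep_dual n Lam chi psi" and ab: "\<alpha> < chi" "\<beta> < chi"
    and rep: "is_rep_map n (phys_dim r dims) (b_phi n Lam r dims phi)"
  shows "MPO2 n Lam r dims phi chi psi \<alpha> \<beta> = tensor_map n (phys_dim r dims) (b_phi n Lam r dims phi)
     (phys_dim r dims) (b_phi n Lam r dims phi) (DeltaA n Lam (\<lambda>I. psi I $$ (\<alpha>,\<beta>)))"
proof (intro eq_matI)
  let ?P = "phys_dim r dims" and ?B = "b_phi n Lam r dims phi"
  let ?M = "\<lambda>\<gamma> \<delta>. MPO n Lam r dims phi psi \<gamma> \<delta>"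
  let ?T = "tensor_map n ?P ?B ?P ?B (DeltaA n Lam (\<lambda>I. psi I $$ (\<alpha>,\<beta>)))"
  have Mc: "?M \<gamma> \<delta> \<in> carrier_mat ?P ?P" for \<gamma> \<delta> using rep by (simp add: MPO_eq_repA)
  have Bd: "dim_row (?B I) = ?P" "dim_col (?B I) = ?P" if "I < n" for I using rep that by (auto simp: is_rep_map_def)
  have M2: "MPO2 n Lam r dims phi chi psi \<alpha> \<beta> = mat_sum (?P*?P) (?P*?P) (\<lambda>\<gamma>. kron (?M \<alpha> \<gamma>) (?M \<gamma> \<beta>)) {..<chi}"
    unfolding MPO2_def using Mc by (intro msum_eq_mat_sum kron_carrier)
  then show "dim_row (MPO2 n Lam r dims phi chi psi \<alpha> \<beta>) = dim_row ?T" "dim_col (MPO2 n Lam r dims phi chi psi \<alpha> \<beta>) = dim_col ?T"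
    by (auto simp: tensor_map_def)
  fix i j assume "i < dim_row ?T" "j < dim_col ?T"
  then have ij: "i < ?P*?P" "j < ?P*?P" by (auto simp: tensor_map_def)
  note ij' = div_mod_less[OF ij(1)] div_mod_less[OF ij(2)]
  have M: "?M \<gamma> \<delta> $$ (p,q) = (\<Sum>I<n. psi I $$ (\<gamma>,\<delta>) * ?B I $$ (p,q))" if "p < ?P" "q < ?P" for \<gamma> \<delta> p q
    using that Bd by (simp add: MPO_eq_repA repA_mat_sum[OF rep])
  let ?b1 = "\<lambda>I. ?B I $$ (i div ?P, j div ?P)" and ?b2 = "\<lambda>I. ?B I $$ (i mod ?P, j mod ?P)"
  have "MPO2 n Lam r dims phi chi psi \<alpha> \<beta> $$ (i,j)
     = (\<Sum>\<gamma><chi. (\<Sum>I<n. psi I $$ (\<alpha>,\<gamma>) * ?b1 I) * (\<Sum>J<n. psi J $$ (\<gamma>,\<beta>) * ?b2 J))"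
    unfolding M2 using ij ij' carrier_matD[OF Mc] by (simp add: kron_index M)
  also have "\<dots> = (\<Sum>\<gamma><chi. \<Sum>I<n. \<Sum>J<n. psi I $$ (\<alpha>,\<gamma>) * psi J $$ (\<gamma>,\<beta>) * (?b1 I * ?b2 J))"
    unfolding sum_product by (simp add: mult_ac)
  also have "\<dots> = (\<Sum>I<n. \<Sum>J<n. \<Sum>\<gamma><chi. psi I $$ (\<alpha>,\<gamma>) * psi J $$ (\<gamma>,\<beta>) * (?b1 I * ?b2 J))"
    by (subst sum.swap, rule sum.cong[OF refl], rule sum.swap)
  also have "\<dots> = (\<Sum>I<n. \<Sum>J<n. DeltaA n Lam (\<lambda>I. psi I $$ (\<alpha>,\<beta>)) I J * (?b1 I * ?b2 J))"
    by (simp add: dual_rep_Delta[OF psi ab] sum_distrib_right)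
  also have "\<dots> = ?T $$ (i,j)" by (rule tensor_map_index[OF rep rep ij, symmetric])
  finally show "MPO2 n Lam r dims phi chi psi \<alpha> \<beta> $$ (i,j) = ?T $$ (i,j)" .
qed

section \<open>Block forms of the one-site and two-site tensors\<close>

context star_irreps
begin

definition block_weight :: "nat \<Rightarrow> real" where
  "block_weight a = qdim n Lam r dims phi a / FPdim n Lam r dims phi"

abbreviation "pdim \<equiv> phys_dim r dims"
abbreviation "\<iota> \<equiv> block_incl r dims"
abbreviation "bphi \<equiv> b_phi n Lam r dims phi"

lemma incl_carrier: "\<iota> a \<in> carrier_mat pdim (dims a)"
  by (rule block_incl_carrier)

lemma b_phi_eq_sum:
  assumes I: "I < n"
  shows "bphi I = mat_sum pdim pdim (\<lambda>a. complex_of_real (block_weight a) \<cdot>\<^sub>m (\<iota> a * phi a I * adj (\<iota> a))) {..<r}"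
proof -
  have "bphi I = mat_sum pdim pdim (\<lambda>a. \<iota> a * (complex_of_real (block_weight a) \<cdot>\<^sub>m phi a I) * adj (\<iota> a)) {..<r}"
    unfolding b_phi_def block_weight_def[symmetric] using phi_carrier[OF _ I] by (intro diag_block_mat_eq_sum) auto
  also have "\<dots> = mat_sum pdim pdim (\<lambda>a. complex_of_real (block_weight a) \<cdot>\<^sub>m (\<iota> a * phi a I * adj (\<iota> a))) {..<r}"
  proof (rule mat_sum_cong[OF refl])
    fix a assume "a \<in> {..<r}"
    then have p: "phi a I \<in> carrier_mat (dims a) (dims a)" using phi_carrier[OF _ I] by simp
    show "\<iota> a * (complex_of_real (block_weight a) \<cdot>\<^sub>m phi a I) * adj (\<iota> a)
        = complex_of_real (block_weight a) \<cdot>\<^sub>m (\<iota> a * phi a I * adj (\<iota> a))"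
      using mult_smult_distrib[OF incl_carrier p]
        mult_smult_assoc_mat[OF mult_carrier_mat[OF incl_carrier p] adj_carrier[OF incl_carrier]] by simp
  qed
  finally show ?thesis .
qed

lemma b_phi_rep_map: "is_rep_map n pdim bphi"
  by (simp add: is_rep_map_def b_phi_eq_sum)

lemma repA_b_phi:
  "repA n pdim bphi x = mat_sum pdim pdim (\<lambda>a. complex_of_real (block_weight a) \<cdot>\<^sub>m (\<iota> a * repA n (dims a) (phi a) x * adj (\<iota> a))) {..<r}"
proof -
  have "repA n pdim bphi x = mat_sum pdim pdim (\<lambda>I. mat_sum pdim pdim (\<lambda>a. complex_of_real (block_weight a) \<cdot>\<^sub>m (x I \<cdot>\<^sub>m (\<iota> a * phi a I * adj (\<iota> a)))) {..<r}) {..<n}"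
    unfolding repA_mat_sum[OF b_phi_rep_map]
  proof (rule mat_sum_cong[OF refl])
    fix I assume "I \<in> {..<n}"
    then have I: "I < n" by simp
    have "x I \<cdot>\<^sub>m bphi I = mat_sum pdim pdim (\<lambda>a. x I \<cdot>\<^sub>m (complex_of_real (block_weight a) \<cdot>\<^sub>m (\<iota> a * phi a I * adj (\<iota> a)))) {..<r}"
      unfolding b_phi_eq_sum[OF I]
      using conj_carrier[OF incl_carrier phi_carrier[OF _ I]] by (intro mat_sum_smult) auto
    then show "x I \<cdot>\<^sub>m bphi I = mat_sum pdim pdim (\<lambda>a. complex_of_real (block_weight a) \<cdot>\<^sub>m (x I \<cdot>\<^sub>m (\<iota> a * phi a I * adj (\<iota> a)))) {..<r}"
      by (simp add: smult_smult_mat mult.commute)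
  qed
  also have "\<dots> = mat_sum pdim pdim (\<lambda>a. mat_sum pdim pdim (\<lambda>I. complex_of_real (block_weight a) \<cdot>\<^sub>m (x I \<cdot>\<^sub>m (\<iota> a * phi a I * adj (\<iota> a)))) {..<n}) {..<r}"
    by (rule mat_sum_swap)
  also have "\<dots> = mat_sum pdim pdim (\<lambda>a. complex_of_real (block_weight a) \<cdot>\<^sub>m (\<iota> a * repA n (dims a) (phi a) x * adj (\<iota> a))) {..<r}"
  proof (rule mat_sum_cong[OF refl])
    fix a assume "a \<in> {..<r}"
    then have a: "a < r" by simp
    have "mat_sum pdim pdim (\<lambda>I. complex_of_real (block_weight a) \<cdot>\<^sub>m (x I \<cdot>\<^sub>m (\<iota> a * phi a I * adj (\<iota> a)))) {..<n}
       = complex_of_real (block_weight a) \<cdot>\<^sub>m mat_sum pdim pdim (\<lambda>I. x I \<cdot>\<^sub>m (\<iota> a * phi a I * adj (\<iota> a))) {..<n}"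
      using conj_carrier[OF incl_carrier phi_carrier[OF a]] by (intro mat_sum_smult[symmetric]) auto
    also have "mat_sum pdim pdim (\<lambda>I. x I \<cdot>\<^sub>m (\<iota> a * phi a I * adj (\<iota> a))) {..<n} = \<iota> a * repA n (dims a) (phi a) x * adj (\<iota> a)"
      unfolding repA_mat_sum[OF phi_rep_map[OF a]] using phi_carrier[OF a] by (intro conj_mat_sum[OF incl_carrier]) auto
    finally show "mat_sum pdim pdim (\<lambda>I. complex_of_real (block_weight a) \<cdot>\<^sub>m (x I \<cdot>\<^sub>m (\<iota> a * phi a I * adj (\<iota> a)))) {..<n}
       = complex_of_real (block_weight a) \<cdot>\<^sub>m (\<iota> a * repA n (dims a) (phi a) x * adj (\<iota> a))" .
  qed
  finally show ?thesis .
qed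

lemma tensor_map_b_phi:
  "tensor_map n pdim bphi pdim bphi X = mat_sum (pdim*pdim) (pdim*pdim)
     (\<lambda>p. complex_of_real (block_weight (fst p) * block_weight (snd p)) \<cdot>\<^sub>m (kron (\<iota> (fst p)) (\<iota> (snd p))
         * tensor_map n (dims (fst p)) (phi (fst p)) (dims (snd p)) (phi (snd p)) X
         * adj (kron (\<iota> (fst p)) (\<iota> (snd p))))) ({..<r} \<times> {..<r})"
  unfolding of_real_mult
  by (rule tensor_map_block_sum) (auto simp: incl_carrier phi_rep_map b_phi_eq_sum)

text \<open>Brings the two-site tensor into the shape expected by the channel construction: the
  blocks are the same matrices \<open>phi c\<close> at \<open>x\<close> as on one site, each copy
  weighted by the product of the weights of the two sites it comes from.\<close>

lemma tensor_map_b_phi_decomposition: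
  assumes dec: "\<And>a b. a < r \<Longrightarrow> b < r \<Longrightarrow> decomposes (dims a * dims b)
      (tensor_rep n Lam (dims a) (phi a) (dims b) (phi b)) {..<m a b :: nat} (cc a b) (W a b)"
  shows "tensor_map n pdim bphi pdim bphi (DeltaA n Lam x) = mat_sum (pdim*pdim) (pdim*pdim)
     (\<lambda>(p,k). complex_of_real (block_weight (fst p) * block_weight (snd p)) \<cdot>\<^sub>m
        (kron (\<iota> (fst p)) (\<iota> (snd p)) * W (fst p) (snd p) k
          * repA n (dims (cc (fst p) (snd p) k)) (phi (cc (fst p) (snd p) k)) x
          * adj (kron (\<iota> (fst p)) (\<iota> (snd p)) * W (fst p) (snd p) k)))
     (Sigma ({..<r} \<times> {..<r}) (\<lambda>p. {..<m (fst p) (snd p)}))"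
proof -
  let ?R = "{..<r} \<times> {..<r}"
  let ?J = "\<lambda>p. kron (\<iota> (fst p)) (\<iota> (snd p))" and ?w = "\<lambda>p. complex_of_real (block_weight (fst p) * block_weight (snd p))"
  have Jc: "?J p \<in> carrier_mat (pdim*pdim) (dims (fst p) * dims (snd p))" for p
    using incl_carrier by (intro kron_carrier)
  have "?w p \<cdot>\<^sub>m (?J p * tensor_map n (dims (fst p)) (phi (fst p)) (dims (snd p)) (phi (snd p)) (DeltaA n Lam x) * adj (?J p))
     = mat_sum (pdim*pdim) (pdim*pdim) (\<lambda>k. ?w p \<cdot>\<^sub>m (?J p * W (fst p) (snd p) k
          * repA n (dims (cc (fst p) (snd p) k)) (phi (cc (fst p) (snd p) k)) x * adj (?J p * W (fst p) (snd p) k))) {..<m (fst p) (snd p)}"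
    if p: "p \<in> ?R" for p
  proof -
    obtain a b where ab: "p = (a,b)" "a < r" "b < r" using p by auto
    note D = decomposesD[OF dec[OF ab(2,3)]] and rep = phi_rep_map[OF ab(2)] phi_rep_map[OF ab(3)]
    let ?d = "dims a * dims b"
    let ?g = "\<lambda>k. repA n (dims (cc a b k)) (phi (cc a b k)) x"
    have gc: "?g k \<in> carrier_mat (dims (cc a b k)) (dims (cc a b k))" if "k < m a b" for k
      using D(2) phi_rep_map that by (intro repA_carrier) auto
    have Wc: "W a b k \<in> carrier_mat ?d (dims (cc a b k))" if "k < m a b" for k using D(3) that by auto
    have c1: "W a b k * ?g k * adj (W a b k) \<in> carrier_mat ?d ?d" if "k < m a b" for k
      using conj_carrier[OF Wc[OF that] gc[OF that]] .
    have J: "?J p \<in> carrier_mat (pdim*pdim) ?d" using Jc[of p] ab by simp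
    have tm: "tensor_map n (dims a) (phi a) (dims b) (phi b) (DeltaA n Lam x)
        = mat_sum ?d ?d (\<lambda>k. 1 \<cdot>\<^sub>m (W a b k * ?g k * adj (W a b k))) {..<m a b}"
    proof -
      have "tensor_map n (dims a) (phi a) (dims b) (phi b) (DeltaA n Lam x)
          = mat_sum ?d ?d (\<lambda>k. W a b k * ?g k * adj (W a b k)) {..<m a b}"
        using decomposes_repA[OF dec[OF ab(2,3)] tensor_rep_carrier[OF rep]] repA_tensor_rep[OF rep] by simp
      then show ?thesis by (auto intro!: mat_sum_cong eq_matI)
    qed
    have "?J p * tensor_map n (dims a) (phi a) (dims b) (phi b) (DeltaA n Lam x) * adj (?J p)
       = mat_sum (pdim*pdim) (pdim*pdim) (\<lambda>k. 1 \<cdot>\<^sub>m (?J p * (W a b k * ?g k * adj (W a b k)) * adj (?J p))) {..<m a b}"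
      unfolding tm using c1 by (intro conj_mat_sum[symmetric] J) auto
    also have "\<dots> = mat_sum (pdim*pdim) (pdim*pdim) (\<lambda>k. ?J p * W a b k * ?g k * adj (?J p * W a b k)) {..<m a b}"
    proof (rule mat_sum_cong[OF refl])
      fix k assume "k \<in> {..<m a b}"
      then have k: "k < m a b" by simp
      note w = Wc[OF k] and g = gc[OF k]
      have "?J p * (W a b k * ?g k * adj (W a b k)) = ?J p * (W a b k * ?g k) * adj (W a b k)"
        using assoc_mult_mat[OF J mult_carrier_mat[OF w g] adj_carrier[OF w]] by simp
      also have "?J p * (W a b k * ?g k) = ?J p * W a b k * ?g k" using assoc_mult_mat[OF J w g] by simp
      finally have "?J p * (W a b k * ?g k * adj (W a b k)) * adj (?J p) = ?J p * W a b k * ?g k * adj (?J p * W a b k)"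
        unfolding adj_mult[OF J w]
        using assoc_mult_mat[OF mult_carrier_mat[OF mult_carrier_mat[OF J w] g] adj_carrier[OF w] adj_carrier[OF J]] by simp
      then show "1 \<cdot>\<^sub>m (?J p * (W a b k * ?g k * adj (W a b k)) * adj (?J p)) = ?J p * W a b k * ?g k * adj (?J p * W a b k)"
        by (auto intro!: eq_matI)
    qed
    finally have e: "?J p * tensor_map n (dims a) (phi a) (dims b) (phi b) (DeltaA n Lam x) * adj (?J p)
       = mat_sum (pdim*pdim) (pdim*pdim) (\<lambda>k. ?J p * W a b k * ?g k * adj (?J p * W a b k)) {..<m a b}" .
    have c2: "?J p * W a b k * ?g k * adj (?J p * W a b k) \<in> carrier_mat (pdim*pdim) (pdim*pdim)" if "k < m a b" for k
      using conj_carrier[OF mult_carrier_mat[OF J Wc[OF that]] gc[OF that]] .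
    have "?w p \<cdot>\<^sub>m mat_sum (pdim*pdim) (pdim*pdim) (\<lambda>k. ?J p * W a b k * ?g k * adj (?J p * W a b k)) {..<m a b}
       = mat_sum (pdim*pdim) (pdim*pdim) (\<lambda>k. ?w p \<cdot>\<^sub>m (?J p * W a b k * ?g k * adj (?J p * W a b k))) {..<m a b}"
      using c2 by (intro mat_sum_smult) auto
    then show ?thesis unfolding ab(1) fst_conv snd_conv e[unfolded ab(1) fst_conv snd_conv] .
  qed
  then have "tensor_map n pdim bphi pdim bphi (DeltaA n Lam x) = mat_sum (pdim*pdim) (pdim*pdim) (\<lambda>p. mat_sum (pdim*pdim) (pdim*pdim) (\<lambda>k. ?w p \<cdot>\<^sub>m (?J p * W (fst p) (snd p) k
          * repA n (dims (cc (fst p) (snd p) k)) (phi (cc (fst p) (snd p) k)) x * adj (?J p * W (fst p) (snd p) k))) {..<m (fst p) (snd p)}) ?R"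
    unfolding tensor_map_b_phi by (intro mat_sum_cong) auto
  also have "\<dots> = mat_sum (pdim*pdim) (pdim*pdim) (\<lambda>(p,k). ?w p \<cdot>\<^sub>m (?J p * W (fst p) (snd p) k
          * repA n (dims (cc (fst p) (snd p) k)) (phi (cc (fst p) (snd p) k)) x * adj (?J p * W (fst p) (snd p) k)))
      (Sigma ?R (\<lambda>p. {..<m (fst p) (snd p)}))"
    by (intro mat_sum_Sigma) auto
  finally show ?thesis .
qed

end

theorem theorem1:
  fixes n :: nat and mu :: "nat \<Rightarrow> nat \<Rightarrow> nat \<Rightarrow> complex" and u :: "nat \<Rightarrow> complex"
    and Lam :: "nat \<Rightarrow> nat \<Rightarrow> nat \<Rightarrow> complex" and st :: "nat \<Rightarrow> nat \<Rightarrow> complex"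
    and r :: nat and dims :: "nat \<Rightarrow> nat" and phi :: "nat \<Rightarrow> nat \<Rightarrow> complex mat"
    and chi :: nat and psi :: "nat \<Rightarrow> complex mat"
  assumes alg: "C_star_pre_bialgebra n mu u Lam st"
    and ss: "semisimpleA n mu u"
    and psi: "faithful_rep_dual n Lam chi psi"
    and irr: "complete_irreps n mu u st r dims phi"
    and transitive: "\<forall>a<r. \<forall>b<r. \<exists>c<r. \<exists>d<r.
                       fusion_mult n Lam dims phi d a c > 0 \<and> fusion_mult n Lam dims phi b d a > 0"
    and duals: "\<forall>a<r. \<exists>a'<r. fusion_matrix n Lam r dims phi a' = transpose_mat (fusion_matrix n Lam r dims phi a)"
  shows "\<exists>T S. quantum_channel (phys_dim r dims) (phys_dim r dims * phys_dim r dims) T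
             \<and> quantum_channel (phys_dim r dims * phys_dim r dims) (phys_dim r dims) S
             \<and> (\<forall>\<alpha><chi. \<forall>\<beta><chi.
                   T (MPO n Lam r dims phi psi \<alpha> \<beta>) = MPO2 n Lam r dims phi chi psi \<alpha> \<beta>
                 \<and> S (MPO2 n Lam r dims phi chi psi \<alpha> \<beta>) = MPO n Lam r dims phi psi \<alpha> \<beta>)"
proof -
  interpret star_irreps n mu u Lam st r dims phi using alg irr by unfold_locales
  let ?q = "qdim n Lam r dims phi" and ?D = "FPdim n Lam r dims phi" and ?N = "fusion_mult n Lam dims phi"
  have qpos: "?q a > 0" if "a < r" for a using qdim_properties(1)[OF _ transitive duals] that by auto
  have qN: "(\<Sum>b<r. real (?N c a b) * ?q b) = ?q a * ?q c" if "a < r" "c < r" for a c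
    using qdim_properties(2)[OF _ transitive duals] that by auto
  have Dpos: "?D > 0" if "r > 0" unfolding FPdim_def using qpos that by (intro sum_pos) (auto simp: power2_eq_square)
  obtain m cc W where dec: "\<And>a b. a < r \<Longrightarrow> b < r \<Longrightarrow> decomposes (dims a * dims b)
      (tensor_rep n Lam (dims a) (phi a) (dims b) (phi b)) {..<m a b :: nat} (cc a b) (W a b)"
    using fusion_decompositions by blast
  let ?R = "{..<r} \<times> {..<r}"
  \<comment> \<open>An index is a pair of site labels together with the number of a summand in their
    tensor product.\<close>
  define F where "F = Sigma ?R (\<lambda>p. {..<m (fst p) (snd p)})"
  define Y where "Y = (\<lambda>(p,k). kron (\<iota> (fst p)) (\<iota> (snd p)) * W (fst p) (snd p) k)"
  define lab where "lab = (\<lambda>(p,k). cc (fst p) (snd p) k)"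
  define w where "w = (\<lambda>z :: (nat \<times> nat) \<times> nat. block_weight (fst (fst z)) * block_weight (snd (fst z)))"
  have "orthonormal_family (pdim * pdim) F (\<lambda>(p,k). dims (cc (fst p) (snd p) k)) Y" unfolding F_def Y_def
  proof (rule orthonormal_family_compose[OF orthonormal_family_kron[OF block_incl_orthonormal block_incl_orthonormal]])
    fix p assume "p \<in> ?R"
    then have ab: "fst p < r" "snd p < r" by auto
    show "orthonormal_family (dims (fst p) * dims (snd p)) {..<m (fst p) (snd p)}
        (\<lambda>k. dims (cc (fst p) (snd p) k)) (W (fst p) (snd p))"
      by (rule decomposes_orthonormal[OF dec[OF ab]])
  qed
  then have Y: "orthonormal_family (pdim * pdim) F (\<lambda>z. dims (lab z)) Y" by (simp add: lab_def case_prod_unfold)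
  \<comment> \<open>Here the choice of \<open>b\<close> pays off. The eigenvector identity turns the
    inner sum into \<open>d_a d_c\<close>, and the remaining sum of the \<open>d_a^2\<close> cancels
    one of the two factors FPdim.\<close>
  have weights: "(\<Sum>z\<in>{z\<in>F. lab z = c}. w z) = block_weight c" if c: "c < r" for c
  proof -
    have r0: "r > 0" using c by simp
    have S: "{z\<in>F. lab z = c} = Sigma ?R (\<lambda>p. {k\<in>{..<m (fst p) (snd p)}. cc (fst p) (snd p) k = c})"
      by (auto simp: F_def lab_def)
    have "(\<Sum>z\<in>{z\<in>F. lab z = c}. w z)
        = (\<Sum>p\<in>?R. \<Sum>k\<in>{k\<in>{..<m (fst p) (snd p)}. cc (fst p) (snd p) k = c}. block_weight (fst p) * block_weight (snd p))"
      unfolding S by (subst sum.Sigma) (auto simp: w_def case_prod_unfold)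
    also have "\<dots> = (\<Sum>a<r. \<Sum>b<r. real (?N c a b) * (block_weight a * block_weight b))"
      using fusion_mult_eq_card[OF dec _ _ c] by (simp add: sum.cartesian_product')
    also have "\<dots> = (\<Sum>a<r. ?q a / ?D\<^sup>2 * (\<Sum>b<r. real (?N c a b) * ?q b))"
      by (simp add: block_weight_def sum_distrib_left sum_divide_distrib power2_eq_square mult_ac)
    also have "\<dots> = (\<Sum>a<r. (?q a)\<^sup>2 * (?q c / ?D\<^sup>2))"
      by (intro sum.cong) (auto simp: qN[OF _ c] power2_eq_square)
    also have "\<dots> = ?D * (?q c / ?D\<^sup>2)" unfolding sum_distrib_right[symmetric] FPdim_def ..
    also have "\<dots> = block_weight c"
      using Dpos[OF r0] by (simp add: block_weight_def power2_eq_square)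
    finally show ?thesis .
  qed
  \<comment> \<open>The channels are fixed before any virtual indices are chosen; the quantification
    over \<open>g\<close> covers all of them together.\<close>
  have "\<exists>T S. quantum_channel pdim (pdim * pdim) T \<and> quantum_channel (pdim * pdim) pdim S
    \<and> (\<forall>g. (\<forall>c<r. g c \<in> carrier_mat (dims c) (dims c)) \<longrightarrow>
         T (mat_sum pdim pdim (\<lambda>c. complex_of_real (block_weight c) \<cdot>\<^sub>m (\<iota> c * g c * adj (\<iota> c))) {..<r})
           = mat_sum (pdim * pdim) (pdim * pdim) (\<lambda>z. complex_of_real (w z) \<cdot>\<^sub>m (Y z * g (lab z) * adj (Y z))) F
       \<and> S (mat_sum (pdim * pdim) (pdim * pdim) (\<lambda>z. complex_of_real (w z) \<cdot>\<^sub>m (Y z * g (lab z) * adj (Y z))) F)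
           = mat_sum pdim pdim (\<lambda>c. complex_of_real (block_weight c) \<cdot>\<^sub>m (\<iota> c * g c * adj (\<iota> c))) {..<r})"
  proof (rule block_channels_exist[where e = dims and cc = lab, OF block_incl_orthonormal[of r dims] Y block_incl_full[of r dims]])
    show "lab z < r" if "z \<in> F" for z using that decomposesD(2)[OF dec] by (auto simp: F_def lab_def)
    show bw: "block_weight c > 0" if "c < r" for c using that qpos Dpos by (simp add: block_weight_def)
    show "w z \<ge> 0" if "z \<in> F" for z using that bw by (auto simp: F_def w_def intro!: mult_nonneg_nonneg less_imp_le)
  qed (use weights in auto)
  then obtain T S where ch: "quantum_channel pdim (pdim * pdim) T" "quantum_channel (pdim * pdim) pdim S"
    and TS: "\<And>g. (\<forall>c<r. g c \<in> carrier_mat (dims c) (dims c)) \<Longrightarrow>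
         T (mat_sum pdim pdim (\<lambda>c. complex_of_real (block_weight c) \<cdot>\<^sub>m (\<iota> c * g c * adj (\<iota> c))) {..<r})
           = mat_sum (pdim * pdim) (pdim * pdim) (\<lambda>z. complex_of_real (w z) \<cdot>\<^sub>m (Y z * g (lab z) * adj (Y z))) F
       \<and> S (mat_sum (pdim * pdim) (pdim * pdim) (\<lambda>z. complex_of_real (w z) \<cdot>\<^sub>m (Y z * g (lab z) * adj (Y z))) F)
           = mat_sum pdim pdim (\<lambda>c. complex_of_real (block_weight c) \<cdot>\<^sub>m (\<iota> c * g c * adj (\<iota> c))) {..<r}"
    by blast
  have "T (MPO n Lam r dims phi psi \<alpha> \<beta>) = MPO2 n Lam r dims phi chi psi \<alpha> \<beta>
      \<and> S (MPO2 n Lam r dims phi chi psi \<alpha> \<beta>) = MPO n Lam r dims phi psi \<alpha> \<beta>" if ab: "\<alpha> < chi" "\<beta> < chi" for \<alpha> \<beta>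
  proof -
    \<comment> \<open>Coordinates of the algebra element behind the tensor at these virtual indices;
      its blocks \<open>phi c\<close> at \<open>x\<close> play the role of \<open>g\<close>.\<close>
    define x where "x = (\<lambda>I. psi I $$ (\<alpha>,\<beta>))"
    have 1: "MPO n Lam r dims phi psi \<alpha> \<beta>
       = mat_sum pdim pdim (\<lambda>c. complex_of_real (block_weight c) \<cdot>\<^sub>m (\<iota> c * repA n (dims c) (phi c) x * adj (\<iota> c))) {..<r}"
      unfolding MPO_eq_repA x_def by (rule repA_b_phi)
    have 2: "MPO2 n Lam r dims phi chi psi \<alpha> \<beta> = mat_sum (pdim * pdim) (pdim * pdim)
        (\<lambda>z. complex_of_real (w z) \<cdot>\<^sub>m (Y z * repA n (dims (lab z)) (phi (lab z)) x * adj (Y z))) F"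
      unfolding MPO2_eq_tensor_map[OF psi ab b_phi_rep_map] x_def[symmetric] F_def
      by (subst tensor_map_b_phi_decomposition[of m cc W], erule (1) dec)
         (simp add: w_def Y_def lab_def case_prod_unfold)
    show ?thesis unfolding 1 2 using phi_rep_map by (intro TS) simp
  qed
  then show ?thesis using ch by blast
qed

end
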